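(* Let $f:\Omega_D\to\mathbb{O}$ be a slice function induced by the stem function $F=(F_1,F_2):D\to\mathbb{O}^2$. The following are equivalent: (1) $f$ is slice Fueter-regular, i.e. the function $\mathcal F=(\mathcal F_0,\dots,\mathcal F_3):E\to\mathbb{O}^4$ defined by $\mathcal F_0(v)=F_1(x_0,r)$, $\mathcal F_h(v)=\frac{x_h}{r}F_2(x_0,r)$ ($h=1,2,3$) for $v=(x_0,x_1,x_2,x_3)\in E$ with $r=(x_1^2+x_2^2+x_3^2)^{1/2}>0$, and $\mathcal F(x_0,0,0,0)=(F_1(x_0,0),0,0,0)$, is of class $C^1$ and satisfies the system $\partial_0\mathcal F_0-\partial_1\mathcal F_1-\partial_2\mathcal F_2-\partial_3\mathcal F_3=0$, $\partial_1\mathcal F_0+\partial_0\mathcal F_1-\partial_3\mathcal F_2+\partial_2\mathcal F_3=0$, $\partial_2\mathcal F_0+\partial_3\mathcal F_1+\partial_0\mathcal F_2-\partial_1\mathcal F_3=0$, $\partial_3\mathcal F_0-\partial_2\mathcal F_1+\partial_1\mathcal F_2+\partial_0\mathcal F_3=0$ on $E$ (where $\partial_h=\partial/\partial x_h$). (2) $F_1$ is of class $C^2$, $F_2$ is of class $C^3$, and on $D\setminus\mathbb{R}$ (i.e. where $x_1\neq0$): $\frac{\partial F_1}{\partial x_0}-\frac{\partial F_2}{\partial x_1}=\frac{2F_2}{x_1}$ and $\frac{\partial F_1}{\partial x_1}+\frac{\partial F_2}{\partial x_0}=0$. (2a) $F_1$ is of class $C^2$, $F_2$ is of class $C^3$,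 and $\overline\partial f=f'_s$ on $\Omega_D\setminus\mathbb{R}$. (2b) $F_1$ is of class $C^2$ and there is a function $G_2:D\to\mathbb{O}$ of class $C^3$ with $F_2(x_0,x_1)=x_1G_2(x_0,x_1)$ and, on all of $D$, $\frac{\partial F_1}{\partial x_0}-x_1\frac{\partial G_2}{\partial x_1}=3G_2$ and $\frac{\partial F_1}{\partial x_1}+x_1\frac{\partial G_2}{\partial x_0}=0$. (2c) With $D^*:=\{(x_0,x_1)\in\mathbb{R}^2:x_1\ge0,(x_0,\sqrt{x_1})\in D\}$, there exist an open neighbourhood $D^{**}$ of $D^*$ in $\mathbb{R}^2$ and functions $H_1,H_2:D^{**}\to\mathbb{O}$, $H_1$ of class $C^2$ and $H_2$ of class $C^3$, such that $F_1(x_0,x_1)=H_1(x_0,x_1^2)$, $F_2(x_0,x_1)=x_1H_2(x_0,x_1^2)$ on $D$ and, at every point of $D^*$, $\frac{\partial H_1}{\partial x_0}-2x_1\frac{\partial H_2}{\partial x_1}=3H_2$ and $2\frac{\partial H_1}{\partial x_1}+\frac{\partial H_2}{\partial x_0}=0$. Moreover, if these assertions hold, then $F$, $\mathcal F$ and $f$ are real analytic.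
   Context: Octonions: $\mathbb{O}=\mathbb{H}+\ell\mathbb{H}$ with product $(a+\ell b)(c+\ell d)=(ac-d\bar b)+\ell(\bar a d+cb)$, conjugation $\overline{a+\ell b}=\bar a-\ell b$, identified with $\mathbb{R}^8$. $\mathbb{S}=\{I\in\mathbb{O}:I^2=-1\}$. $D\subset\mathbb{R}^2$ is a non-empty open set invariant under $(x_0,x_1)\mapsto(x_0,-x_1)$, $\Omega_D=\{x_0+x_1I:(x_0,x_1)\in D,I\in\mathbb{S}\}$, assumed connected, and $E=\{(x_0,x_1,x_2,x_3)\in\mathbb{R}^4:(x_0,(x_1^2+x_2^2+x_3^2)^{1/2})\in D\}$. A stem function is $F=(F_1,F_2):D\to\mathbb{O}^2$ with $F_1(x_0,-x_1)=F_1(x_0,x_1)$, $F_2(x_0,-x_1)=-F_2(x_0,x_1)$; it induces the slice function $f(x_0+x_1I)=F_1(x_0,x_1)+IF_2(x_0,x_1)$. For $F$ of class $C^1$: $\overline\partial f$ is the slice function induced by the stem function $\frac12\big(\frac{\partial F_1}{\partial x_0}-\frac{\partial F_2}{\partial x_1},\frac{\partial F_1}{\partial x_1}+\frac{\partial F_2}{\partial x_0}\big)$, and the spherical derivative $f'_s:\Omega_D\setminus\mathbb{R}\to\mathbb{O}$ is $f'_s(x_0+x_1I)=F_2(x_0,x_1)/x_1$ ($x_1\neq0$), i.e. the slice function induced by $(F_2/x_1,0)$. (The function $\mathcal F$ in (1) is the unique $O(3)$-stem function inducing $f$, and "slice Fueter-regular" means induced by such an $\mathcal F$ of class $C^1$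 satisfying the stated system.) *)

theory Defs
  imports "HOL-Analysis.Analysis"
begin

type_synonym quat = "real \<times> real \<times> real \<times> real"

text \<open>Hamilton product: components (real, i, j, k).\<close>
definition qmult :: "quat \<Rightarrow> quat \<Rightarrow> quat" where
  "qmult a b = (case a of (a0, a1, a2, a3) \<Rightarrow> case b of (b0, b1, b2, b3) \<Rightarrow>
     (a0*b0 - a1*b1 - a2*b2 - a3*b3,
      a0*b1 + a1*b0 + a2*b3 - a3*b2,
      a0*b2 - a1*b3 + a2*b0 + a3*b1,
      a0*b3 + a1*b2 - a2*b1 + a3*b0))"

definition qconj :: "quat \<Rightarrow> quat" where
  "qconj a = (case a of (a0, a1, a2, a3) \<Rightarrow> (a0, -a1, -a2, -a3))"

text \<open>Octonion a + l b is the pair (a, b).\<close>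
type_synonym oct = "quat \<times> quat"

definition omult :: "oct \<Rightarrow> oct \<Rightarrow> oct" where
  "omult x y = (case x of (a, b) \<Rightarrow> case y of (c, d) \<Rightarrow>
     (qmult a c - qmult d (qconj b), qmult (qconj a) d + qmult c b))"

definition oreal :: "real \<Rightarrow> oct" where
  "oreal t = ((t, 0, 0, 0), (0, 0, 0, 0))"

definition octS :: "oct set" where
  "octS = {I. omult I I = oreal (-1)}"

definition OmegaD :: "(real \<times> real) set \<Rightarrow> oct set" where
  "OmegaD D = {oreal x0 + x1 *\<^sub>R I | x0 x1 I. (x0, x1) \<in> D \<and> I \<in> octS}"

definition Eset :: "(real \<times> real) set \<Rightarrow> (real \<times> real \<times> real \<times> real) set" where
  "Eset D = {(x0, x1, x2, x3). (x0, sqrt (x1^2 + x2^2 + x3^2)) \<in> D}"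

definition Dstar :: "(real \<times> real) set \<Rightarrow> (real \<times> real) set" where
  "Dstar D = {(x0, x1). x1 \<ge> 0 \<and> (x0, sqrt x1) \<in> D}"

definition pdiff :: "('a::real_normed_vector \<Rightarrow> 'b::real_normed_vector) \<Rightarrow> 'a \<Rightarrow> 'a \<Rightarrow> 'b" where
  "pdiff f e x = vector_derivative (\<lambda>t. f (x + t *\<^sub>R e)) (at 0)"

fun Ck_on :: "nat \<Rightarrow> 'a::euclidean_space set \<Rightarrow> ('a \<Rightarrow> 'b::real_normed_vector) \<Rightarrow> bool" where
  "Ck_on 0 S f = continuous_on S f"
| "Ck_on (Suc k) S f = ((\<forall>x\<in>S. f differentiable (at x)) \<and>
      (\<forall>b\<in>Basis. Ck_on k S (\<lambda>x. frechet_derivative f (at x) b)))"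

definition real_analytic_on :: "'a::euclidean_space set \<Rightarrow> ('a \<Rightarrow> 'b::real_normed_vector) \<Rightarrow> bool" where
  "real_analytic_on S f \<longleftrightarrow> (\<forall>x\<in>S. \<exists>r>0. \<exists>c :: ('a \<Rightarrow> nat) \<Rightarrow> 'b. \<forall>y\<in>ball x r.
      ((\<lambda>\<alpha>. (\<Prod>b\<in>Basis. ((y - x) \<bullet> b) ^ \<alpha> b) *\<^sub>R c \<alpha>) has_sum f y)
        {\<alpha>. \<forall>b. b \<notin> Basis \<longrightarrow> \<alpha> b = 0})"

definition slice_fun :: "(real \<times> real) set \<Rightarrow> (real \<times> real \<Rightarrow> oct) \<Rightarrow> (real \<times> real \<Rightarrow> oct) \<Rightarrow> oct \<Rightarrow> oct" where
  "slice_fun D G1 G2 q = (SOME y. \<exists>x0 x1 I. (x0, x1) \<in> D \<and> I \<in> octS \<and>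
      q = oreal x0 + x1 *\<^sub>R I \<and> y = G1 (x0, x1) + omult I (G2 (x0, x1)))"

definition slice_dbar :: "(real \<times> real) set \<Rightarrow> (real \<times> real \<Rightarrow> oct) \<Rightarrow> (real \<times> real \<Rightarrow> oct) \<Rightarrow> oct \<Rightarrow> oct" where
  "slice_dbar D F1 F2 = slice_fun D
     (\<lambda>p. (1/2) *\<^sub>R (pdiff F1 (1, 0) p - pdiff F2 (0, 1) p))
     (\<lambda>p. (1/2) *\<^sub>R (pdiff F1 (0, 1) p + pdiff F2 (1, 0) p))"

text \<open>Spherical derivative, induced by (F2/x1, 0) (used only off the real axis).\<close>
definition sph_deriv :: "(real \<times> real) set \<Rightarrow> (real \<times> real \<Rightarrow> oct) \<Rightarrow> oct \<Rightarrow> oct" where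
  "sph_deriv D F2 = slice_fun D (\<lambda>p. (1 / snd p) *\<^sub>R F2 p) (\<lambda>p. 0)"

definition coord4 :: "nat \<Rightarrow> real \<times> real \<times> real \<times> real \<Rightarrow> real" where
  "coord4 h v = (case v of (x0, x1, x2, x3) \<Rightarrow>
     (if h = 0 then x0 else if h = 1 then x1 else if h = 2 then x2 else x3))"

definition e4 :: "nat \<Rightarrow> real \<times> real \<times> real \<times> real" where
  "e4 h = (if h = 0 then (1, 0, 0, 0) else if h = 1 then (0, 1, 0, 0)
           else if h = 2 then (0, 0, 1, 0) else (0, 0, 0, 1))"

definition Fcal :: "(real \<times> real \<Rightarrow> oct) \<Rightarrow> (real \<times> real \<Rightarrow> oct) \<Rightarrow> nat \<Rightarrow> real \<times> real \<times> real \<times> real \<Rightarrow> oct" where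
  "Fcal F1 F2 h v = (let x0 = coord4 0 v;
       r = sqrt ((coord4 1 v)^2 + (coord4 2 v)^2 + (coord4 3 v)^2) in
     if h = 0 then F1 (x0, r)
     else if r = 0 then 0
     else (coord4 h v / r) *\<^sub>R F2 (x0, r))"

end

theory Submission
  imports Defs "HOL-Complex_Analysis.Complex_Analysis"
begin

text \<open>
  Off the real axis the components \<open>u\<close> of \<open>F\<^sub>1\<close> and \<open>v\<close> of \<open>F\<^sub>2\<close> satisfy
  \<open>u\<^sub>x - v\<^sub>y = 2 v / y\<close> and \<open>u\<^sub>y + v\<^sub>x = 0\<close>. A local potential \<open>\<phi>\<close> of \<open>u dx - v dy\<close> then solves
  \<open>\<Delta>\<phi> + (2 / y) \<phi>\<^sub>y = 0\<close>, that is, \<open>y \<phi>\<close> is harmonic; it is the imaginary part of a holomorphic \<open>g\<close>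
  with \<open>y u = Im g'\<close> and \<open>y\<^sup>2 v = Im g - y Re g'\<close>. This gives analyticity off the axis. At a point
  of the axis, parity removes half of the Taylor series of \<open>g\<close>, and what remains is
  \<open>u = H\<^sub>1(x, y\<^sup>2)\<close>, \<open>v = y H\<^sub>2(x, y\<^sup>2)\<close> with convergent power series \<open>H\<^sub>1\<close>, \<open>H\<^sub>2\<close>. Each of the
  conditions is the first order system for \<open>H\<^sub>1\<close>, \<open>H\<^sub>2\<close> rewritten by the chain rule, and \<open>F\<close>,
  the \<open>O(3)\<close>-stem function and \<open>f\<close> are polynomial expressions in \<open>H\<^sub>1\<close>, \<open>H\<^sub>2\<close> composed with polynomial maps.

  Convergence is controlled by the weighted \<open>l\<^sup>1\<close> norm \<open>\<Sum> \<bar>c\<^sub>\<alpha>\<bar> r ^ \<bar>\<alpha>\<bar>\<close> of the coefficients: it is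
  countably subadditive and submultiplicative, so products, compositions and power series of
  power series need no rearrangement beyond one interchange of sums.
\<close>

text \<open>The obstacle is the open neighbourhood of \<open>Dstar D\<close> in the last condition.
  For t > 0 the values H_1(x, t) = F_1(x, sqrt t) and H_2(x, t) = F_2(x, sqrt t) / sqrt t are
  forced, but for t < 0 the stem function prescribes nothing, and the expansions found at different
  points of the axis must still define one function there. The gluing therefore continues each
  function across t = 0 on every line x = const separately. The function g has its origin in the
  choice Im g = y \<phi>: it forces g' = (\<phi> - y v) + i y u, and the Cauchy-Riemann equations of
  this g' are exactly the two equations of the system. The identities for u and v carry factors y
  and y^2, so g also exists on discs that meet the axis; what has to be gained there is the division
  by y. All conditions are compared with a single C^1 form of the system,
  \<open>C1_stem_solution\<close>. Its coefficients are real, so up to that point an octonion is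
  just a vector; the product of octonions enters only through slice functions.\<close>

section \<open>Power series on cubes and their weighted norm\<close>

definition midx :: "('a::euclidean_space \<Rightarrow> nat) set" where
  "midx = {\<alpha>. \<forall>b. b \<notin> Basis \<longrightarrow> \<alpha> b = 0}"

definition mpow :: "('a::euclidean_space \<Rightarrow> nat) \<Rightarrow> 'a \<Rightarrow> real" where
  "mpow \<alpha> w = (\<Prod>b\<in>Basis. (w \<bullet> b) ^ \<alpha> b)"

definition mdeg :: "('a::euclidean_space \<Rightarrow> nat) \<Rightarrow> nat" where
  "mdeg \<alpha> = (\<Sum>b\<in>Basis. \<alpha> b)"

definition cube :: "'a::euclidean_space \<Rightarrow> real \<Rightarrow> 'a set" where
  "cube x r = {y. \<forall>b\<in>Basis. \<bar>(y - x) \<bullet> b\<bar> \<le> r}"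

text \<open>A cube is used because r ^ \<open>mdeg \<alpha>\<close> is the maximum of the monomial
  on it: the weighted sum of the coefficients then dominates the series at every point of the cube,
  with one radius for all coordinates.\<close>

definition ps_expansion ::
  "'a::euclidean_space \<Rightarrow> real \<Rightarrow> ('a \<Rightarrow> 'b::banach) \<Rightarrow> (('a \<Rightarrow> nat) \<Rightarrow> 'b) \<Rightarrow> real \<Rightarrow> bool" where
  "ps_expansion x r f c S \<longleftrightarrow> ((\<lambda>\<alpha>. norm (c \<alpha>) * r ^ mdeg \<alpha>) has_sum S) midx \<and>
     (\<forall>y\<in>cube x r. ((\<lambda>\<alpha>. mpow \<alpha> (y - x) *\<^sub>R c \<alpha>) has_sum f y) midx)"

text \<open>Coefficients are hidden and the norm is replaced by an upper bound, so that the closure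
  lemmas can be chained on functions and numbers alone.\<close>

definition ps_bound ::
  "'a::euclidean_space \<Rightarrow> real \<Rightarrow> ('a \<Rightarrow> 'b::banach) \<Rightarrow> real \<Rightarrow> bool" where
  "ps_bound x r f K \<longleftrightarrow> (\<exists>c S. ps_expansion x r f c S \<and> S \<le> K)"

lemma ps_boundI:
  assumes "((\<lambda>\<alpha>. norm (c \<alpha>) * r ^ mdeg \<alpha>) has_sum S) midx" "S \<le> K"
    "\<And>y. y \<in> cube x r \<Longrightarrow> ((\<lambda>\<alpha>. mpow \<alpha> (y - x) *\<^sub>R c \<alpha>) has_sum f y) midx"
  shows "ps_bound x r f K"
  using assms unfolding ps_bound_def ps_expansion_def by blast

lemma ps_boundE:
  assumes "ps_bound x r f K"
  obtains c S where "ps_expansion x r f c S" "S \<le> K"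
  using assms unfolding ps_bound_def by blast

lemma ps_expansionD:
  assumes "ps_expansion x r f c S"
  shows "((\<lambda>\<alpha>. norm (c \<alpha>) * r ^ mdeg \<alpha>) has_sum S) midx"
    and "y \<in> cube x r \<Longrightarrow> ((\<lambda>\<alpha>. mpow \<alpha> (y - x) *\<^sub>R c \<alpha>) has_sum f y) midx"
  using assms unfolding ps_expansion_def by blast+

lemma abs_mpow_le:
  assumes "\<And>b. b \<in> Basis \<Longrightarrow> \<bar>w \<bullet> b\<bar> \<le> r"
  shows "\<bar>mpow \<alpha> w\<bar> \<le> r ^ mdeg \<alpha>"
proof -
  have "\<bar>mpow \<alpha> w\<bar> = (\<Prod>b\<in>Basis. \<bar>w \<bullet> b\<bar> ^ \<alpha> b)"
    by (simp add: mpow_def abs_prod power_abs)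
  also have "\<dots> \<le> (\<Prod>b\<in>(Basis::'a set). r ^ \<alpha> b)"
    by (rule prod_mono) (auto intro!: power_mono assms)
  also have "\<dots> = r ^ mdeg \<alpha>"
    by (simp add: mdeg_def power_sum)
  finally show ?thesis .
qed

lemma cubeD: "y \<in> cube x r \<Longrightarrow> b \<in> Basis \<Longrightarrow> \<bar>(y - x) \<bullet> b\<bar> \<le> r"
  by (simp add: cube_def)

lemma norm_mpow_scaleR_le:
  assumes "y \<in> cube x r"
  shows "norm (mpow \<alpha> (y - x) *\<^sub>R v) \<le> norm v * r ^ mdeg \<alpha>"
  using abs_mpow_le[of "y - x" r \<alpha>] cubeD[OF assms]
  by (simp add: mult.commute mult_left_mono)

lemma cube_mono: "r \<le> r' \<Longrightarrow> cube x r \<subseteq> cube x r'"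
  unfolding cube_def by force

lemma center_in_cube: "0 \<le> r \<Longrightarrow> x \<in> cube x r"
  by (simp add: cube_def)

lemma ball_subset_cube: "ball x r \<subseteq> cube x r"
proof
  fix y assume "y \<in> ball x r"
  then have "norm (y - x) < r" by (simp add: dist_norm norm_minus_commute)
  then show "y \<in> cube x r"
    unfolding cube_def using Basis_le_norm order.trans less_imp_le by fastforce
qed

lemma cube_nhds: "0 < r \<Longrightarrow> eventually (\<lambda>y. y \<in> cube x r) (nhds x)"
  using ball_subset_cube[of x r] by (auto simp: eventually_nhds intro!: exI[of _ "ball x r"])

text \<open>Comparison test for the norm: once candidate coefficients are known to sum to f, only a
  coefficientwise estimate by a summable family remains to be proved.\<close>

lemma ps_bound_dominated:
  assumes r: "0 \<le> r" and w: "(w has_sum W) midx" "W \<le> K"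
    and le: "\<And>\<alpha>. \<alpha> \<in> midx \<Longrightarrow> norm (c \<alpha>) * r ^ mdeg \<alpha> \<le> w \<alpha>"
    and f: "\<And>y. y \<in> cube x r \<Longrightarrow> ((\<lambda>\<alpha>. mpow \<alpha> (y - x) *\<^sub>R c \<alpha>) has_sum f y) midx"
  shows "ps_bound x r f K"
proof -
  have "(\<lambda>\<alpha>. norm (norm (c \<alpha>) * r ^ mdeg \<alpha>)) summable_on midx"
    by (rule Infinite_Sum.abs_summable_on_comparison_test'[OF has_sum_imp_summable[OF w(1)]])
       (use le r in auto)
  then have s: "(\<lambda>\<alpha>. norm (c \<alpha>) * r ^ mdeg \<alpha>) summable_on midx"
    by (rule abs_summable_summable)
  show ?thesis
    by (rule ps_boundI[OF has_sum_infsum[OF s] _ f])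
       (use has_sum_mono[OF has_sum_infsum[OF s] w(1) le] w(2) in linarith)
qed

section \<open>Sums, products and compositions of power series\<close>

text \<open>Countable subadditivity of the norm. The family of all weighted coefficients is
  absolutely summable over pairs of an index i and a multiindex, so the two sums may be exchanged;
  the coefficients of g are the sums over i of those of \<open>f i\<close>. The index set is
  arbitrary, which lets the same lemma serve for series, products and substitutions.\<close>

lemma ps_bound_has_sum:
  fixes f :: "'i \<Rightarrow> 'a::euclidean_space \<Rightarrow> 'b::banach"
  assumes r: "0 < r"
    and f: "\<And>i. i \<in> I \<Longrightarrow> ps_bound x r (f i) (K i)"
    and K: "(K has_sum T) I"
    and g: "\<And>y. y \<in> cube x r \<Longrightarrow> ((\<lambda>i. f i y) has_sum g y) I"
  shows "ps_bound x r g T"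
proof -
  define Q where "Q i c S \<longleftrightarrow> ps_expansion x r (f i) c S \<and> S \<le> K i" for i c S
  have "\<forall>i\<in>I. \<exists>c S. Q i c S"
    using f unfolding ps_bound_def Q_def by blast
  from bchoice[OF this] obtain c where "\<forall>i\<in>I. \<exists>S. Q i (c i) S" ..
  from bchoice[OF this] obtain S where Q: "\<forall>i\<in>I. Q i (c i) (S i)" ..
  from Q have
    c1: "\<And>i. i \<in> I \<Longrightarrow> ((\<lambda>\<alpha>. norm (c i \<alpha>) * r ^ mdeg \<alpha>) has_sum S i) midx"
    and c2: "\<And>i. i \<in> I \<Longrightarrow> S i \<le> K i"
    and c3: "\<And>i y. i \<in> I \<Longrightarrow> y \<in> cube x r \<Longrightarrow>
       ((\<lambda>\<alpha>. mpow \<alpha> (y - x) *\<^sub>R c i \<alpha>) has_sum f i y) midx"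
    unfolding Q_def ps_expansion_def by blast+
  have Spos: "0 \<le> S i" if "i \<in> I" for i
    by (rule has_sum_nonneg[OF c1[OF that]]) (use r in auto)
  have "K summable_on I" using K by (rule has_sum_imp_summable)
  then have "(\<lambda>i. norm (S i)) summable_on I"
    by (rule Infinite_Sum.abs_summable_on_comparison_test') (use Spos c2 in auto)
  then have Ssum: "S summable_on I"
    by (rule abs_summable_summable)
  \<comment> \<open>\<open>w\<close> is the family of weighted absolute values and controls the
    norm; the family \<open>v\<close> further down consists of the actual terms at a point y and is
    dominated by \<open>w\<close>.\<close>
  define w where "w = (\<lambda>(i, \<alpha>). norm (c i \<alpha>) * r ^ mdeg \<alpha>)"
  have w_sum: "w summable_on I \<times> midx"
    by (rule summable_on_SigmaI[where g = S]) (use c1 Ssum r in \<open>auto simp: w_def\<close>)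
  have w_tot: "(w has_sum infsum S I) (I \<times> midx)"
    by (rule has_sum_SigmaI[where g = S]) (use c1 Ssum w_sum in \<open>auto simp: w_def\<close>)
  have tot_le: "infsum S I \<le> T"
    using has_sum_mono[OF has_sum_infsum[OF Ssum] K] c2 by blast
  have w_sw: "((\<lambda>(\<alpha>, i). w (i, \<alpha>)) has_sum infsum S I) (midx \<times> I)"
    using w_tot by (subst (asm) has_sum_swap) (simp add: case_prod_unfold)
  have w_row: "(\<lambda>i. w (i, \<alpha>)) summable_on I" if "\<alpha> \<in> midx" for \<alpha>
    using summable_on_SigmaD1[of "\<lambda>\<alpha> i. w (i, \<alpha>)" midx "\<lambda>_. I" \<alpha>] w_sw that
    by (auto dest: has_sum_imp_summable)
  define W where "W \<alpha> = infsum (\<lambda>i. w (i, \<alpha>)) I" for \<alpha>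
  have W: "(W has_sum infsum S I) midx"
    by (rule has_sum_Sigma'[OF w_sw]) (use w_row in \<open>auto simp: W_def\<close>)
  have c_abs: "(\<lambda>i. norm (c i \<alpha>)) summable_on I" if "\<alpha> \<in> midx" for \<alpha>
  proof -
    have "(\<lambda>i. w (i, \<alpha>) * (1 / r ^ mdeg \<alpha>)) summable_on I"
      by (rule summable_on_cmult_left[OF w_row[OF that]])
    then show ?thesis using r by (simp add: w_def)
  qed
  define C where "C \<alpha> = infsum (\<lambda>i. c i \<alpha>) I" for \<alpha>
  have C: "((\<lambda>i. c i \<alpha>) has_sum C \<alpha>) I" if "\<alpha> \<in> midx" for \<alpha>
    unfolding C_def using c_abs[OF that] by (rule has_sum_infsum[OF abs_summable_summable])
  have C_le: "norm (C \<alpha>) * r ^ mdeg \<alpha> \<le> W \<alpha>" if "\<alpha> \<in> midx" for \<alpha>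
  proof -
    have "norm (C \<alpha>) \<le> infsum (\<lambda>i. norm (c i \<alpha>)) I"
      by (rule norm_infsum_le[OF C[OF that] has_sum_infsum[OF c_abs[OF that]]]) auto
    then have "norm (C \<alpha>) * r ^ mdeg \<alpha> \<le> infsum (\<lambda>i. norm (c i \<alpha>)) I * r ^ mdeg \<alpha>"
      using r by (intro mult_right_mono) auto
    also have "\<dots> = W \<alpha>"
      unfolding W_def w_def using c_abs[OF that] by (simp add: infsum_cmult_left')
    finally show ?thesis .
  qed
  show ?thesis
  proof (rule ps_bound_dominated[OF _ W tot_le C_le])
    fix y assume y: "y \<in> cube x r"
    define v where "v = (\<lambda>(i, \<alpha>). mpow \<alpha> (y - x) *\<^sub>R c i \<alpha>)"
    have "(\<lambda>p. norm (v p)) summable_on I \<times> midx"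
      by (rule Infinite_Sum.abs_summable_on_comparison_test'[OF w_sum])
         (use norm_mpow_scaleR_le[OF y] in \<open>auto simp: v_def w_def\<close>)
    then have v_sum: "v summable_on I \<times> midx"
      by (rule abs_summable_summable)
    have v_tot: "(v has_sum g y) (I \<times> midx)"
      by (rule has_sum_SigmaI[where g = "\<lambda>i. f i y"]) (use c3 y g v_sum in \<open>auto simp: v_def\<close>)
    then have v_sw: "((\<lambda>(\<alpha>, i). v (i, \<alpha>)) has_sum g y) (midx \<times> I)"
      by (subst (asm) has_sum_swap) (simp add: case_prod_unfold)
    show "((\<lambda>\<alpha>. mpow \<alpha> (y - x) *\<^sub>R C \<alpha>) has_sum g y) midx"
      by (rule has_sum_SigmaD[OF v_sw]) (auto simp: v_def intro!: has_sum_scaleR C)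
  qed (use r in auto)
qed

lemma ps_bound_mpow:
  assumes "\<alpha> \<in> midx" 
  shows "ps_bound x r (\<lambda>y. mpow \<alpha> (y - x) *\<^sub>R v) (norm v * r ^ mdeg \<alpha>)"
proof (rule ps_boundI[where c = "\<lambda>\<beta>. if \<beta> = \<alpha> then v else 0"])
  show "((\<lambda>\<beta>. norm (if \<beta> = \<alpha> then v else 0) * r ^ mdeg \<beta>) has_sum norm v * r ^ mdeg \<alpha>) midx"
    by (rule has_sum_finite_neutralI[of "{\<alpha>}"]) (use assms in auto)
  show "((\<lambda>\<beta>. mpow \<beta> (y - x) *\<^sub>R (if \<beta> = \<alpha> then v else 0)) has_sum
        mpow \<alpha> (y - x) *\<^sub>R v) midx" for y
    by (rule has_sum_finite_neutralI[of "{\<alpha>}"]) (use assms in auto)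
qed auto

lemma ps_bound_mono:
  assumes "ps_bound x r f K" "K \<le> K'"
  shows "ps_bound x r f K'"
  using assms unfolding ps_bound_def by (meson order.trans)

lemma ps_bound_cong:
  assumes "ps_bound x r f K" "\<And>y. y \<in> cube x r \<Longrightarrow> f y = g y"
  shows "ps_bound x r g K"
  using assms unfolding ps_bound_def ps_expansion_def by auto

lemma ps_bound_shrink:
  assumes "ps_bound x r f K" "0 \<le> r'" "r' \<le> r"
  shows "ps_bound x r' f K"
proof -
  obtain c S where c': "ps_expansion x r f c S" "S \<le> K"
    by (rule ps_boundE[OF assms(1)])
  note c = ps_expansionD(1)[OF c'(1)] c'(2) ps_expansionD(2)[OF c'(1)]
  show ?thesis
    by (rule ps_bound_dominated[OF assms(2) c(1,2) mult_left_mono[OF power_mono] c(3)])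
       (use assms cube_mono[OF assms(3)] in auto)
qed

lemma norm_le_ps_bound:
  assumes "ps_bound x r f K" "y \<in> cube x r"
  shows "norm (f y) \<le> K"
proof -
  obtain c S where c': "ps_expansion x r f c S" "S \<le> K"
    by (rule ps_boundE[OF assms(1)])
  note c = ps_expansionD(1)[OF c'(1)] c'(2) ps_expansionD(2)[OF c'(1)]
  have "norm (f y) \<le> S"
    by (rule norm_infsum_le[OF c(3)[OF assms(2)] c(1)]) (rule norm_mpow_scaleR_le[OF assms(2)])
  with c(2) show ?thesis by simp
qed

lemma ps_bound_nonneg: "ps_bound x r f K \<Longrightarrow> 0 \<le> r \<Longrightarrow> 0 \<le> K"
  using norm_le_ps_bound[of x r f K x] center_in_cube[of r x] norm_ge_zero order.trans by blast

lemma zero_midx: "(\<lambda>_. 0) \<in> midx"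
  by (simp add: midx_def)

lemma ps_bound_const: "ps_bound x r (\<lambda>_. v) (norm v)"
  using ps_bound_mpow[OF zero_midx, of x r v] by (simp add: mpow_def mdeg_def)

lemma ps_bound_coord:
  assumes "b \<in> Basis"
  shows "ps_bound x r (\<lambda>y. (y - x) \<bullet> b) r"
proof -
  let ?\<alpha> = "\<lambda>b'. if b' = b then 1 else (0::nat)"
  have 1: "?\<alpha> \<in> midx" using assms by (auto simp: midx_def)
  have 2: "mpow ?\<alpha> w = w \<bullet> b" for w
    using assms by (simp add: mpow_def if_distrib prod.delta cong: if_cong)
  have 3: "mdeg ?\<alpha> = 1" using assms by (simp add: mdeg_def)
  show ?thesis using ps_bound_mpow[OF 1, of x r "1::real"] by (simp add: 2 3)
qed

lemma ps_bound_sum: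
  assumes "0 < r" "finite A" "\<And>i. i \<in> A \<Longrightarrow> ps_bound x r (f i) (K i)"
  shows "ps_bound x r (\<lambda>y. \<Sum>i\<in>A. f i y) (\<Sum>i\<in>A. K i)"
  by (rule ps_bound_has_sum[where I = A and f = f and K = K]) (use assms in auto)

lemma ps_bound_add:
  assumes "0 < r" "ps_bound x r f K" "ps_bound x r g L"
  shows "ps_bound x r (\<lambda>y. f y + g y) (K + L)"
  using ps_bound_sum[of r "UNIV::bool set" x "\<lambda>i. if i then f else g" "\<lambda>i. if i then K else L"] assms
  by (simp add: UNIV_bool add.commute)

lemma ps_bound_linear:
  assumes "ps_bound x r f K" "bounded_linear L" "\<And>v. norm (L v) \<le> C * norm v" "0 \<le> C" "0 \<le> r"
  shows "ps_bound x r (\<lambda>y. L (f y)) (C * K)"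
proof -
  interpret L: bounded_linear L by fact
  obtain c S where c': "ps_expansion x r f c S" "S \<le> K"
    by (rule ps_boundE[OF assms(1)])
  note c = ps_expansionD(1)[OF c'(1)] c'(2) ps_expansionD(2)[OF c'(1)]
  have c': "((\<lambda>\<alpha>. C * (norm (c \<alpha>) * r ^ mdeg \<alpha>)) has_sum C * S) midx"
    using has_sum_cmult_right[OF c(1)] by simp
  have le: "norm (L (c \<alpha>)) * r ^ mdeg \<alpha> \<le> C * (norm (c \<alpha>) * r ^ mdeg \<alpha>)" for \<alpha>
    using mult_right_mono[OF assms(3)[of "c \<alpha>"], of "r ^ mdeg \<alpha>"] assms(5) by (simp add: mult.assoc)
  show ?thesis
  proof (rule ps_bound_dominated[OF assms(5) c' mult_left_mono[OF c(2) assms(4)] le])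
    fix y assume "y \<in> cube x r"
    from has_sum_bounded_linear[OF assms(2) c(3)[OF this]]
    show "((\<lambda>\<alpha>. mpow \<alpha> (y - x) *\<^sub>R L (c \<alpha>)) has_sum L (f y)) midx"
      by (simp add: L.scaleR)
  qed
qed

lemma mpow_plus: "mpow (\<lambda>b. \<alpha> b + \<beta> b) w = mpow \<alpha> w * mpow \<beta> w"
  by (simp add: mpow_def power_add prod.distrib)

lemma mdeg_plus: "mdeg (\<lambda>b. \<alpha> b + \<beta> b) = mdeg \<alpha> + mdeg \<beta>"
  by (simp add: mdeg_def sum.distrib)

text \<open>No convolution of coefficients is formed. The product is the sum, over pairs of
  multiindices, of single monomials of exponent \<alpha> + \<beta>, each of norm at most
  \<open>C * s \<alpha> * t \<beta>\<close>; countable subadditivity over the product index set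
  collects equal exponents by itself.\<close>

lemma ps_bound_bilinear:
  assumes r: "0 < r" and f: "ps_bound x r f K" and g: "ps_bound x r g L"
    and B: "bounded_bilinear B" and C: "\<And>u v. norm (B u v) \<le> C * norm u * norm v" "0 \<le> C"
  shows "ps_bound x r (\<lambda>y. B (f y) (g y)) (C * K * L)"
proof -
  interpret B: bounded_bilinear B by fact
  obtain c S where c': "ps_expansion x r f c S" "S \<le> K"
    by (rule ps_boundE[OF f])
  note c = ps_expansionD(1)[OF c'(1)] c'(2) ps_expansionD(2)[OF c'(1)]
  obtain d T where d': "ps_expansion x r g d T" "T \<le> L"
    by (rule ps_boundE[OF g])
  note d = ps_expansionD(1)[OF d'(1)] d'(2) ps_expansionD(2)[OF d'(1)]
  define s where "s \<alpha> = norm (c \<alpha>) * r ^ mdeg \<alpha>" for \<alpha>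
  define t where "t \<alpha> = norm (d \<alpha>) * r ^ mdeg \<alpha>" for \<alpha>
  have s: "(s has_sum S) midx" and t: "(t has_sum T) midx"
    using c(1) d(1) by (simp_all add: s_def[abs_def] t_def[abs_def])
  have s0: "s \<alpha> \<ge> 0" "t \<alpha> \<ge> 0" for \<alpha> using r by (auto simp: s_def t_def)
  have S0: "0 \<le> S" "0 \<le> T" using has_sum_nonneg[OF s s0(1)] has_sum_nonneg[OF t s0(2)] by auto
  define w where "w = (\<lambda>(\<alpha>, \<beta>). C * s \<alpha> * t \<beta>)"
  have w1: "((\<lambda>\<beta>. w (\<alpha>, \<beta>)) has_sum C * s \<alpha> * T) midx" for \<alpha>
    unfolding w_def using has_sum_cmult_right[OF t] by simp
  have w2: "((\<lambda>\<alpha>. C * s \<alpha> * T) has_sum C * S * T) midx"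
    by (intro has_sum_cmult_left has_sum_cmult_right s)
  have w_sum: "w summable_on midx \<times> midx"
    by (rule summable_on_SigmaI[where g = "\<lambda>\<alpha>. C * s \<alpha> * T"])
       (use w1 w2 s0 C in \<open>auto simp: w_def dest: has_sum_imp_summable\<close>)
  have w: "(w has_sum C * S * T) (midx \<times> midx)"
    by (rule has_sum_SigmaI[where g = "\<lambda>\<alpha>. C * s \<alpha> * T"]) (use w1 w2 w_sum in auto)
  have "ps_bound x r (\<lambda>y. B (f y) (g y)) (C * S * T)"
  proof (rule ps_bound_has_sum[where I = "midx \<times> midx" and K = w and
       f = "\<lambda>(\<alpha>, \<beta>) y. mpow (\<lambda>b. \<alpha> b + \<beta> b) (y - x) *\<^sub>R B (c \<alpha>) (d \<beta>)", OF r _ w])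
    fix p :: "('a \<Rightarrow> nat) \<times> ('a \<Rightarrow> nat)"
    obtain \<alpha> \<beta> where p: "p = (\<alpha>, \<beta>)" by force
    assume "p \<in> midx \<times> midx"
    then have m: "(\<lambda>b. \<alpha> b + \<beta> b) \<in> midx" by (auto simp: p midx_def)
    have "norm (B (c \<alpha>) (d \<beta>)) * r ^ mdeg (\<lambda>b. \<alpha> b + \<beta> b)
        \<le> C * norm (c \<alpha>) * norm (d \<beta>) * r ^ mdeg (\<lambda>b. \<alpha> b + \<beta> b)"
      using C(1) r by (intro mult_right_mono) auto
    also have "\<dots> = w p"
      by (simp add: p w_def s_def t_def mdeg_plus power_add)
    finally show "ps_bound x r (case p of (\<alpha>, \<beta>) \<Rightarrow> \<lambda>y. mpow (\<lambda>b. \<alpha> b + \<beta> b) (y - x) *\<^sub>R B (c \<alpha>) (d \<beta>)) (w p)"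
      using ps_bound_mono[OF ps_bound_mpow[OF m]] by (simp add: p)
  next
    fix y assume y: "y \<in> cube x r"
    let ?v = "\<lambda>(\<alpha>, \<beta>). B (mpow \<alpha> (y - x) *\<^sub>R c \<alpha>) (mpow \<beta> (y - x) *\<^sub>R d \<beta>)"
    have "norm (?v p) \<le> w p" for p
    proof -
      obtain \<alpha> \<beta> where p: "p = (\<alpha>, \<beta>)" by force
      have "norm (?v p) \<le> C * norm (mpow \<alpha> (y - x) *\<^sub>R c \<alpha>) * norm (mpow \<beta> (y - x) *\<^sub>R d \<beta>)"
        unfolding p prod.case by (rule C(1))
      also have "\<dots> \<le> C * s \<alpha> * t \<beta>"
        unfolding s_def t_def using C(2) r
        by (intro mult_mono norm_mpow_scaleR_le[OF y]) auto
      finally show ?thesis by (simp add: p w_def)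
    qed
    then have "?v summable_on midx \<times> midx"
      by (rule abs_summable_summable[OF Infinite_Sum.abs_summable_on_comparison_test'[OF w_sum]])
    then have "(?v has_sum B (f y) (g y)) (midx \<times> midx)"
    proof (intro has_sum_SigmaI[where g = "\<lambda>\<alpha>. B (mpow \<alpha> (y - x) *\<^sub>R c \<alpha>) (g y)"])
      show "((\<lambda>\<beta>. ?v (\<alpha>, \<beta>)) has_sum B (mpow \<alpha> (y - x) *\<^sub>R c \<alpha>) (g y)) midx" for \<alpha>
        using has_sum_bounded_linear[OF B.bounded_linear_right d(3)[OF y]] by simp
      show "((\<lambda>\<alpha>. B (mpow \<alpha> (y - x) *\<^sub>R c \<alpha>) (g y)) has_sum B (f y) (g y)) midx"
        using has_sum_bounded_linear[OF B.bounded_linear_left c(3)[OF y]] by simp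
    qed
    then show "((\<lambda>i. (case i of (\<alpha>, \<beta>) \<Rightarrow> \<lambda>y. mpow (\<lambda>b. \<alpha> b + \<beta> b) (y - x) *\<^sub>R B (c \<alpha>) (d \<beta>)) y)
          has_sum B (f y) (g y)) (midx \<times> midx)"
      by (simp add: case_prod_unfold mpow_plus B.scaleR_left B.scaleR_right mult.commute)
  qed
  moreover have "C * S * T \<le> C * K * L"
    using S0 C(2) c(2) d(2) by (intro mult_mono) auto
  ultimately show ?thesis by (rule ps_bound_mono)
qed

lemma ps_bound_mult:
  fixes f g :: "_ \<Rightarrow> 'b::{real_normed_algebra,banach}"
  assumes "0 < r" "ps_bound x r f K" "ps_bound x r g L"
  shows "ps_bound x r (\<lambda>y. f y * g y) (K * L)"
  using ps_bound_bilinear[OF assms bounded_bilinear_mult, of 1] by (simp add: norm_mult_ineq)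

lemma ps_bound_scaleR:
  assumes "0 < r" "ps_bound x r f K" "ps_bound x r g L"
  shows "ps_bound x r (\<lambda>y. f y *\<^sub>R g y) (K * L)"
  using ps_bound_bilinear[OF assms bounded_bilinear_scaleR, of 1] by simp

lemma ps_bound_power:
  fixes f :: "_ \<Rightarrow> 'b::{real_normed_algebra_1,banach}"
  assumes "0 < r" "ps_bound x r f K"
  shows "ps_bound x r (\<lambda>y. f y ^ n) (K ^ n)"
proof (induction n)
  case 0
  show ?case using ps_bound_const[of x r "1::'b"] by simp
next
  case (Suc n)
  show ?case using ps_bound_mult[OF assms(1) assms(2) Suc] by simp
qed

lemma ps_bound_prod:
  fixes f :: "_ \<Rightarrow> _ \<Rightarrow> real"
  assumes "0 < r" "finite A" "\<And>i. i \<in> A \<Longrightarrow> ps_bound x r (f i) (K i)"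
  shows "ps_bound x r (\<lambda>y. \<Prod>i\<in>A. f i y) (\<Prod>i\<in>A. K i)"
  using assms(2,3)
proof (induction A rule: finite_induct)
  case empty
  show ?case using ps_bound_const[of x r "1::real"] by simp
next
  case (insert i A)
  then show ?case using ps_bound_mult[OF assms(1), of x "f i" "K i"] by simp
qed

text \<open>If every coordinate of q - x has norm at most r, then submultiplicativity bounds the
  norm of the substituted monomial by r ^ \<open>mdeg \<alpha>\<close>. Summing over the monomials
  of f gives back the very bound of f.\<close>

lemma ps_bound_compose:
  fixes q :: "'c::euclidean_space \<Rightarrow> 'a::euclidean_space" and f :: "'a \<Rightarrow> 'b::banach"
  assumes f: "ps_bound x r f K" and \<rho>: "0 < \<rho>" and r: "0 \<le> r"
    and q: "\<And>b. b \<in> Basis \<Longrightarrow> ps_bound z \<rho> (\<lambda>y. (q y - x) \<bullet> b) r"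
  shows "ps_bound z \<rho> (\<lambda>y. f (q y)) K"
proof -
  obtain c S where c': "ps_expansion x r f c S" "S \<le> K"
    by (rule ps_boundE[OF f])
  note c = ps_expansionD(1)[OF c'(1)] c'(2) ps_expansionD(2)[OF c'(1)]
  have "ps_bound z \<rho> (\<lambda>y. f (q y)) S"
  proof (rule ps_bound_has_sum[OF \<rho> _ c(1), where f = "\<lambda>\<alpha> y. mpow \<alpha> (q y - x) *\<^sub>R c \<alpha>"])
    fix \<alpha> :: "'a \<Rightarrow> nat"
    have "ps_bound z \<rho> (\<lambda>y. mpow \<alpha> (q y - x)) (r ^ mdeg \<alpha>)"
      unfolding mpow_def mdeg_def power_sum
      by (intro ps_bound_prod \<rho> ps_bound_power q) auto
    from ps_bound_scaleR[OF \<rho> this ps_bound_const[of z \<rho> "c \<alpha>"]]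
    show "ps_bound z \<rho> (\<lambda>y. mpow \<alpha> (q y - x) *\<^sub>R c \<alpha>) (norm (c \<alpha>) * r ^ mdeg \<alpha>)"
      by (simp add: mult.commute)
  next
    fix y assume y: "y \<in> cube z \<rho>"
    have "q y \<in> cube x r"
      unfolding cube_def using norm_le_ps_bound[OF q y] by auto
    then show "((\<lambda>\<alpha>. mpow \<alpha> (q y - x) *\<^sub>R c \<alpha>) has_sum f (q y)) midx" by (rule c(3))
  qed
  with c(2) show ?thesis by (rule ps_bound_mono[rotated])
qed

text \<open>Substitution into a series in one variable whose coefficients lie in the algebra itself.
  With complex values this covers the Taylor series of a holomorphic function.\<close>

lemma ps_bound_powser:
  fixes g :: "'a::euclidean_space \<Rightarrow> 'b::{real_normed_algebra_1,banach}"
  assumes r: "0 < r" and g: "ps_bound x r g K"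
    and s: "summable (\<lambda>n. norm (a n) * K ^ n)"
    and h: "\<And>y. y \<in> cube x r \<Longrightarrow> (\<lambda>n. a n * g y ^ n) sums h y"
  shows "\<exists>L. ps_bound x r h L"
proof -
  have K: "0 \<le> K" using ps_bound_nonneg[OF g] r by simp
  have "((\<lambda>n. norm (a n) * K ^ n) has_sum (\<Sum>n. norm (a n) * K ^ n)) UNIV"
    using s K by (intro norm_summable_imp_has_sum) (auto simp: summable_sums)
  then have "ps_bound x r h (\<Sum>n. norm (a n) * K ^ n)"
  proof (rule ps_bound_has_sum[OF r, where f = "\<lambda>n y. a n * g y ^ n", rotated])
    show "ps_bound x r (\<lambda>y. a n * g y ^ n) (norm (a n) * K ^ n)" for n
      by (intro ps_bound_mult ps_bound_power ps_bound_const r g)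
    fix y assume y: "y \<in> cube x r"
    have "norm (a n * g y ^ n) \<le> norm (a n) * K ^ n" for n
    proof -
      have "norm (a n * g y ^ n) \<le> norm (a n) * norm (g y ^ n)" by (rule norm_mult_ineq)
      also have "\<dots> \<le> norm (a n) * norm (g y) ^ n" by (intro mult_left_mono norm_power_ineq) auto
      also have "\<dots> \<le> norm (a n) * K ^ n"
        using norm_le_ps_bound[OF g y] by (intro mult_left_mono power_mono) auto
      finally show ?thesis .
    qed
    then have "summable (\<lambda>n. norm (a n * g y ^ n))"
      by (intro summable_comparison_test'[OF s]) auto
    then show "((\<lambda>n. a n * g y ^ n) has_sum h y) UNIV"
      using h[OF y] by (rule norm_summable_imp_has_sum)
  qed
  then show ?thesis by blast
qed

section \<open>Analytic germs and their closure properties\<close>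

definition ps_analytic :: "('a::euclidean_space \<Rightarrow> 'b::banach) \<Rightarrow> 'a \<Rightarrow> bool" where
  "ps_analytic f x \<longleftrightarrow> (\<exists>r>0. \<exists>K. ps_bound x r f K)"

lemma ps_analyticI: "0 < r \<Longrightarrow> ps_bound x r f K \<Longrightarrow> ps_analytic f x"
  unfolding ps_analytic_def by blast

lemma cube_subset_ball:
  fixes x :: "'a::euclidean_space"
  assumes "0 < d"
  obtains r where "0 < r" "cube x r \<subseteq> ball x d"
proof
  \<comment> \<open>The Euclidean norm is at most the sum of the coordinates, hence at most the
    dimension times the half-width; the factor 2 makes the inequality strict.\<close>
  let ?r = "d / (2 * DIM('a))"
  show "0 < ?r" using assms by simp
  show "cube x ?r \<subseteq> ball x d"
  proof
    fix y assume y: "y \<in> cube x ?r"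
    have "norm (y - x) \<le> (\<Sum>b\<in>Basis. \<bar>(y - x) \<bullet> b\<bar>)" by (rule norm_le_l1)
    also have "\<dots> \<le> (\<Sum>b\<in>(Basis::'a set). ?r)" by (intro sum_mono cubeD[OF y])
    also have "\<dots> = d / 2" by simp
    also have "\<dots> < d" using assms by simp
    finally show "y \<in> ball x d" by (simp add: dist_norm norm_minus_commute)
  qed
qed

lemma ps_analytic_cong:
  assumes "ps_analytic f x" "eventually (\<lambda>y. f y = g y) (nhds x)"
  shows "ps_analytic g x"
proof -
  obtain r K where r: "0 < r" "ps_bound x r f K" using assms(1) by (auto simp: ps_analytic_def)
  obtain d where d: "0 < d" "\<And>y. y \<in> ball x d \<Longrightarrow> f y = g y"
    using assms(2) by (auto simp: eventually_nhds_metric dist_commute)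
  obtain \<rho> where \<rho>: "0 < \<rho>" "cube x \<rho> \<subseteq> ball x d" using cube_subset_ball[OF d(1)] by blast
  have "ps_bound x (min r \<rho>) f K"
    using ps_bound_shrink[OF r(2)] r(1) \<rho>(1) by simp
  then have "ps_bound x (min r \<rho>) g K"
    by (rule ps_bound_cong) (use d(2) \<rho>(2) cube_mono[of "min r \<rho>" \<rho> x] in auto)
  with r(1) \<rho>(1) show ?thesis by (intro ps_analyticI[of "min r \<rho>"]) auto
qed

lemma ps_analytic_common:
  assumes "ps_analytic f x" "ps_analytic g x"
  obtains r K L where "0 < r" "ps_bound x r f K" "ps_bound x r g L"
proof -
  obtain r K r' L where "0 < r" "ps_bound x r f K" "0 < r'" "ps_bound x r' g L"
    using assms by (auto simp: ps_analytic_def)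
  then show ?thesis
    using that[of "min r r'" K L] ps_bound_shrink[of x r f K "min r r'"]
      ps_bound_shrink[of x r' g L "min r r'"] by auto
qed

lemma ps_analytic_const: "ps_analytic (\<lambda>_. c) x"
  by (rule ps_analyticI[OF _ ps_bound_const[of _ 1]]) simp

lemma ps_analytic_add:
  assumes "ps_analytic f x" "ps_analytic g x"
  shows "ps_analytic (\<lambda>y. f y + g y) x"
  by (rule ps_analytic_common[OF assms]) (blast intro: ps_analyticI ps_bound_add)

lemma ps_analytic_linear:
  assumes "bounded_linear L" "ps_analytic f x"
  shows "ps_analytic (\<lambda>y. L (f y)) x"
proof -
  interpret bounded_linear L by fact
  obtain C where C: "0 < C" "\<And>v. norm (L v) \<le> norm v * C" using pos_bounded by blast
  obtain r K where r: "0 < r" "ps_bound x r f K" using assms(2) by (auto simp: ps_analytic_def)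
  have "ps_bound x r (\<lambda>y. L (f y)) (C * K)"
    by (rule ps_bound_linear[OF r(2) assms(1)]) (use C r in \<open>auto simp: mult.commute\<close>)
  with r(1) show ?thesis by (rule ps_analyticI)
qed

lemma ps_analytic_bilinear:
  assumes "bounded_bilinear B" "ps_analytic f x" "ps_analytic g x"
  shows "ps_analytic (\<lambda>y. B (f y) (g y)) x"
proof -
  interpret bounded_bilinear B by fact
  obtain C where C: "0 < C" "\<And>u v. norm (B u v) \<le> norm u * norm v * C" using pos_bounded by blast
  obtain r K L where r: "0 < r" "ps_bound x r f K" "ps_bound x r g L"
    using ps_analytic_common[OF assms(2,3)] by blast
  have "ps_bound x r (\<lambda>y. B (f y) (g y)) (C * K * L)"
    by (rule ps_bound_bilinear[OF r assms(1)]) (use C in \<open>auto simp: mult_ac\<close>)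
  with r(1) show ?thesis by (rule ps_analyticI)
qed

lemmas ps_analytic_scaleR = ps_analytic_bilinear[OF bounded_bilinear_scaleR]
lemmas ps_analytic_mult = ps_analytic_bilinear[OF bounded_bilinear_mult]

lemma ps_analytic_uminus: "ps_analytic f x \<Longrightarrow> ps_analytic (\<lambda>y. - f y) x"
  by (rule ps_analytic_linear[OF bounded_linear_minus[OF bounded_linear_ident]])

lemma ps_analytic_diff:
  "ps_analytic f x \<Longrightarrow> ps_analytic g x \<Longrightarrow> ps_analytic (\<lambda>y. f y - g y) x"
  using ps_analytic_add[OF _ ps_analytic_uminus] by fastforce

lemma ps_analytic_power:
  fixes f :: "_ \<Rightarrow> 'b::{real_normed_algebra_1,banach}"
  shows "ps_analytic f x \<Longrightarrow> ps_analytic (\<lambda>y. f y ^ n) x"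
  unfolding ps_analytic_def using ps_bound_power by blast

lemma ps_analytic_sum:
  assumes "finite A" "\<And>i. i \<in> A \<Longrightarrow> ps_analytic (f i) x"
  shows "ps_analytic (\<lambda>y. \<Sum>i\<in>A. f i y) x"
  using assms by (induction A rule: finite_induct) (auto intro: ps_analytic_const ps_analytic_add)

lemma ps_analytic_inner: "ps_analytic (\<lambda>y. y \<bullet> b) x"
  if "b \<in> Basis" for b :: "'a::euclidean_space"
proof -
  have "ps_analytic (\<lambda>y. (y - x) \<bullet> b) x"
    by (rule ps_analyticI[of 1, OF _ ps_bound_coord[OF that]]) simp
  from ps_analytic_add[OF this ps_analytic_const[of "x \<bullet> b"]]
  show ?thesis by (simp add: inner_diff_left)
qed

lemma ps_analytic_ident: "ps_analytic (\<lambda>y. y) x"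
proof -
  have "ps_analytic (\<lambda>y::'a. \<Sum>b\<in>Basis. (y \<bullet> b) *\<^sub>R b) x"
    by (intro ps_analytic_sum ps_analytic_scaleR ps_analytic_inner ps_analytic_const) auto
  then show ?thesis by (simp add: euclidean_representation)
qed

lemma ps_analytic_componentwise:
  fixes f :: "'a::euclidean_space \<Rightarrow> 'b::euclidean_space"
  assumes "\<And>b. b \<in> Basis \<Longrightarrow> ps_analytic (\<lambda>y. f y \<bullet> b) x"
  shows "ps_analytic f x"
proof -
  have "ps_analytic (\<lambda>y. \<Sum>b\<in>Basis. (f y \<bullet> b) *\<^sub>R b) x"
    by (intro ps_analytic_sum ps_analytic_scaleR assms ps_analytic_const) auto
  then show ?thesis by (simp add: euclidean_representation)
qed

lemma ps_analytic_Pair: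
  fixes f :: "'a::euclidean_space \<Rightarrow> 'b::euclidean_space" and g :: "'a \<Rightarrow> 'c::euclidean_space"
  assumes "ps_analytic f x" "ps_analytic g x"
  shows "ps_analytic (\<lambda>y. (f y, g y)) x"
  by (rule ps_analytic_componentwise)
     (use ps_analytic_linear[OF bounded_linear_inner_left assms(1)]
          ps_analytic_linear[OF bounded_linear_inner_left assms(2)]
      in \<open>auto simp: Basis_prod_def\<close>)

lemma mdeg_eq_0D: "mdeg \<alpha> = 0 \<Longrightarrow> mpow \<alpha> w = 1"
  by (simp add: mdeg_def mpow_def)

lemma mpow_zero: "mpow \<alpha> 0 = (if mdeg \<alpha> = 0 then 1 else 0)"
proof (cases "mdeg \<alpha> = 0")
  case False
  then obtain b :: 'a where "b \<in> Basis" "\<alpha> b \<noteq> 0" unfolding mdeg_def by (metis sum.neutral)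
  then show ?thesis using False by (auto simp: mpow_def intro!: prod_zero)
qed (simp add: mdeg_eq_0D)

text \<open>A function that vanishes at the centre has no constant coefficient, so every remaining
  term has degree at least 1 and shrinking the radius by t gains at least one factor t.\<close>

lemma ps_bound_small:
  assumes f: "ps_bound x r f K" and r: "0 < r" and x: "f x = 0" and t: "0 < t" "t \<le> 1"
  shows "ps_bound x (t * r) f (t * K)"
proof -
  obtain c S where c': "ps_expansion x r f c S" "S \<le> K"
    by (rule ps_boundE[OF f])
  note c = ps_expansionD(1)[OF c'(1)] c'(2) ps_expansionD(2)[OF c'(1)]
  have "((\<lambda>\<alpha>. mpow \<alpha> (x - x) *\<^sub>R c \<alpha>) has_sum c (\<lambda>_. 0)) midx"
  proof (rule has_sum_finite_neutralI[of "{\<lambda>_. 0}"])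
    show "mpow \<alpha> (x - x) *\<^sub>R c \<alpha> = 0" if "\<alpha> \<in> midx - {\<lambda>_. 0}" for \<alpha>
    proof -
      have "mdeg \<alpha> \<noteq> 0" using that by (force simp: midx_def mdeg_def)
      then show ?thesis by (simp add: mpow_zero)
    qed
  qed (auto simp: zero_midx mpow_def)
  with c(3)[OF center_in_cube] r x have c0: "c (\<lambda>_. 0) = 0"
    using has_sum_unique by (metis less_imp_le)
  have le: "norm (c \<alpha>) * (t * r) ^ mdeg \<alpha> \<le> t * (norm (c \<alpha>) * r ^ mdeg \<alpha>)" if "\<alpha> \<in> midx" for \<alpha>
  proof (cases "mdeg \<alpha>")
    case 0
    then have "\<alpha> = (\<lambda>_. 0)" using that by (force simp: midx_def mdeg_def)
    then show ?thesis using c0 by simp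
  next
    case (Suc n)
    have "t ^ mdeg \<alpha> \<le> t" using t unfolding Suc by (simp add: mult_left_le power_le_one)
    then have "t ^ mdeg \<alpha> * (norm (c \<alpha>) * r ^ mdeg \<alpha>) \<le> t * (norm (c \<alpha>) * r ^ mdeg \<alpha>)"
      using r by (intro mult_right_mono) auto
    then show ?thesis by (simp add: power_mult_distrib mult_ac)
  qed
  have c': "((\<lambda>\<alpha>. t * (norm (c \<alpha>) * r ^ mdeg \<alpha>)) has_sum t * S) midx"
    using has_sum_cmult_right[OF c(1)] by simp
  show ?thesis
  proof (rule ps_bound_dominated[OF _ c' mult_left_mono[OF c(2)] le])
    have "t * r \<le> r" using t r by simp
    then show "((\<lambda>\<alpha>. mpow \<alpha> (y - x) *\<^sub>R c \<alpha>) has_sum f y) midx" if "y \<in> cube x (t * r)" for y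
      using c(3) that cube_mono by blast
  qed (use t r in auto)
qed

text \<open>This is what allows an inner function to be substituted: its deviation from the centre
  fits into any prescribed radius. The eventual form lets the finitely many coordinates share one
  radius.\<close>

lemma ps_analytic_small:
  assumes "ps_analytic f x" "f x = 0" "0 < e"
  shows "eventually (\<lambda>\<rho>. ps_bound x \<rho> f e) (at_right 0)"
proof -
  obtain r K where r: "0 < r" "ps_bound x r f K" using assms(1) by (auto simp: ps_analytic_def)
  have K: "0 \<le> K" using ps_bound_nonneg[OF r(2)] r(1) by simp
  \<comment> \<open>Chosen so that t * K \<le> e; the summand 1 guards against K = 0.\<close>
  define t where "t = min 1 (e / (K + 1))"
  have t: "0 < t" "t \<le> 1" using K assms(3) by (auto simp: t_def)
  have "t * K \<le> e / (K + 1) * (K + 1)"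
    unfolding t_def using K assms(3) by (intro mult_mono) auto
  then have "t * K \<le> e" using K by simp
  then have b: "ps_bound x (t * r) f e"
    using ps_bound_mono[OF ps_bound_small[OF r(2,1) assms(2) t]] by simp
  have "eventually (\<lambda>\<rho>. \<rho> \<in> {0<..<t * r}) (at_right 0)"
    using t r by (intro eventually_at_right_real) simp
  then show ?thesis
    by eventually_elim (use ps_bound_shrink[OF b] in auto)
qed

lemma ps_analytic_compose:
  fixes q :: "'c::euclidean_space \<Rightarrow> 'a::euclidean_space" and f :: "'a \<Rightarrow> 'b::banach"
  assumes f: "ps_analytic f (q z)" and q: "ps_analytic q z"
  shows "ps_analytic (\<lambda>y. f (q y)) z"
proof -
  obtain r K where r: "0 < r" "ps_bound (q z) r f K" using f by (auto simp: ps_analytic_def)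
  have "\<forall>b\<in>Basis. eventually (\<lambda>\<rho>. ps_bound z \<rho> (\<lambda>y. (q y - q z) \<bullet> b) r) (at_right 0)"
    by (intro ballI ps_analytic_small ps_analytic_linear[OF bounded_linear_inner_left]
        ps_analytic_diff q ps_analytic_const r) auto
  then have "eventually (\<lambda>\<rho>. \<forall>b\<in>Basis. ps_bound z \<rho> (\<lambda>y. (q y - q z) \<bullet> b) r) (at_right 0)"
    by (simp add: eventually_ball_finite_distrib)
  then have "eventually (\<lambda>\<rho>. 0 < \<rho> \<and> (\<forall>b\<in>Basis. ps_bound z \<rho> (\<lambda>y. (q y - q z) \<bullet> b) r)) (at_right 0)"
    using eventually_at_right_less[of "0::real"] by eventually_elim auto
  then obtain \<rho> where \<rho>: "0 < \<rho>" "\<forall>b\<in>Basis. ps_bound z \<rho> (\<lambda>y. (q y - q z) \<bullet> b) r"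
    using eventually_happens'[OF trivial_limit_at_right_real] by blast
  have "ps_bound z \<rho> (\<lambda>y. f (q y)) K"
    by (rule ps_bound_compose[OF r(2)]) (use \<rho> r(1) in auto)
  with \<rho>(1) show ?thesis by (rule ps_analyticI)
qed

text \<open>Re-expansion at z is composition with the identity: y - x = (y - z) + (z - x), and each
  part has norm at most r / 2 in every coordinate.\<close>

lemma ps_bound_recenter:
  assumes f: "ps_bound x r f K" and r: "0 < r" and z: "z \<in> cube x (r / 2)"
  shows "ps_bound z (r / 2) f K"
proof (rule ps_bound_compose[OF f, where q = "\<lambda>y. y"])
  fix b :: 'a assume b: "b \<in> Basis"
  have "ps_bound z (r / 2) (\<lambda>y. (y - z) \<bullet> b + (z - x) \<bullet> b) (r / 2 + norm ((z - x) \<bullet> b))"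
    by (intro ps_bound_add ps_bound_const ps_bound_coord b) (use r in auto)
  moreover have "r / 2 + norm ((z - x) \<bullet> b) \<le> r" using cubeD[OF z b] by simp
  ultimately show "ps_bound z (r / 2) (\<lambda>y. (y - x) \<bullet> b) r"
    by (auto simp: inner_diff_left elim: ps_bound_mono)
qed (use r in auto)

lemma eventually_ps_analytic:
  assumes "ps_analytic f x"
  shows "eventually (\<lambda>z. ps_analytic f z) (nhds x)"
proof -
  obtain r K where r: "0 < r" "ps_bound x r f K" using assms by (auto simp: ps_analytic_def)
  have "eventually (\<lambda>z. z \<in> cube x (r / 2)) (nhds x)" using r by (intro cube_nhds) simp
  then show ?thesis
    by eventually_elim (use r in \<open>auto intro: ps_analyticI[of "r / 2"] ps_bound_recenter\<close>)
qed

section \<open>Termwise differentiation\<close>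

lemma mpow_mdeg_1:
  assumes "mdeg \<alpha> = 1"
  obtains b where "b \<in> Basis" "\<And>w. mpow \<alpha> w = w \<bullet> b"
proof -
  from assms obtain b where b: "b \<in> Basis" "\<alpha> b = 1" "\<forall>b'\<in>Basis. b \<noteq> b' \<longrightarrow> \<alpha> b' = 0"
    unfolding mdeg_def by (subst (asm) sum_eq_1_iff) auto
  have "mpow \<alpha> w = w \<bullet> b" for w
  proof -
    have "mpow \<alpha> w = (w \<bullet> b) ^ \<alpha> b * (\<Prod>b'\<in>Basis - {b}. (w \<bullet> b') ^ \<alpha> b')"
      unfolding mpow_def using b(1) by (intro prod.remove) auto
    also have "(\<Prod>b'\<in>Basis - {b}. (w \<bullet> b') ^ \<alpha> b') = 1"
      using b(3) by (intro prod.neutral) auto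
    finally show ?thesis using b(2) by simp
  qed
  with b(1) show ?thesis by (rule that)
qed

lemma has_sum_minus:
  fixes f g :: "_ \<Rightarrow> 'a::real_normed_vector"
  assumes "(f has_sum S) A" "(g has_sum T) A"
  shows "((\<lambda>x. f x - g x) has_sum (S - T)) A"
  using has_sum_add[OF assms(1) has_sum_bounded_linear[OF bounded_linear_minus[OF bounded_linear_ident] assms(2)]]
  by simp

text \<open>The derivative at the centre is the part of degree 1. Terms of degree at least 2 at h
  are bounded by (|h| / r)^2 times their weight, so the remainder is quadratic in |h|. Other points
  of the cube are reached by moving the centre.\<close>

lemma ps_bound_differentiable:
  assumes f: "ps_bound x r f K" and r: "0 < r"
  shows "f differentiable (at x)"
proof -
  obtain c S where c': "ps_expansion x r f c S" "S \<le> K"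
    by (rule ps_boundE[OF f])
  note c = ps_expansionD(1)[OF c'(1)] c'(2) ps_expansionD(2)[OF c'(1)]
  define l where "l \<alpha> h = (if mdeg \<alpha> = 1 then mpow \<alpha> h else 0)" for \<alpha> and h :: 'a
  have l_add: "l \<alpha> (h + h') = l \<alpha> h + l \<alpha> h'" for \<alpha> h h'
    by (cases "mdeg \<alpha> = 1") (erule mpow_mdeg_1, simp_all add: l_def inner_add_left)
  have l_scale: "l \<alpha> (s *\<^sub>R h) = s * l \<alpha> h" for \<alpha> s h
    by (cases "mdeg \<alpha> = 1") (erule mpow_mdeg_1, simp_all add: l_def)
  have l_le: "\<bar>l \<alpha> h\<bar> \<le> norm h / r * r ^ mdeg \<alpha>" for \<alpha> h
    by (cases "mdeg \<alpha> = 1") (erule mpow_mdeg_1, use r in \<open>simp_all add: l_def Basis_le_norm\<close>)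
  have n_le: "norm (l \<alpha> h *\<^sub>R c \<alpha>) \<le> norm h / r * (norm (c \<alpha>) * r ^ mdeg \<alpha>)" for \<alpha> h
    using mult_right_mono[OF l_le[of \<alpha> h], of "norm (c \<alpha>)"] by (simp add: mult_ac)
  have cs: "((\<lambda>\<alpha>. t * (norm (c \<alpha>) * r ^ mdeg \<alpha>)) has_sum t * S) midx" for t
    by (rule has_sum_cmult_right[OF c(1)])
  define L where "L h = infsum (\<lambda>\<alpha>. l \<alpha> h *\<^sub>R c \<alpha>) midx" for h
  have L: "((\<lambda>\<alpha>. l \<alpha> h *\<^sub>R c \<alpha>) has_sum L h) midx" for h
    unfolding L_def
    by (rule has_sum_infsum[OF abs_summable_summable[OF
          Infinite_Sum.abs_summable_on_comparison_test'[OF has_sum_imp_summable[OF cs]]]])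
       (rule n_le)
  have "bounded_linear L"
  proof (rule bounded_linear_intro[where K = "S / r"])
    show "L (h + h') = L h + L h'" for h h'
      using has_sum_unique[OF L[of "h + h'"]] has_sum_add[OF L[of h] L[of h']]
      by (simp add: l_add scaleR_add_left)
    show "L (s *\<^sub>R h) = s *\<^sub>R L h" for s h
      using has_sum_unique[OF L[of "s *\<^sub>R h"]] has_sum_scaleR[OF L[of h], of s]
      by (simp add: l_scale)
    show "norm (L h) \<le> norm h * (S / r)" for h
      using norm_infsum_le[OF L cs n_le, of h] by simp
  qed
  have rem: "\<bar>mpow \<alpha> h - mpow \<alpha> 0 - l \<alpha> h\<bar> \<le> (norm h / r)\<^sup>2 * r ^ mdeg \<alpha>" if "norm h \<le> r" for \<alpha> h
  proof -
    consider "mdeg \<alpha> = 0" | "mdeg \<alpha> = 1" | n where "mdeg \<alpha> = Suc (Suc n)"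
      by (metis One_nat_def nat.exhaust)
    then show ?thesis
    proof cases
      case 3
      have "\<bar>mpow \<alpha> h\<bar> \<le> norm h ^ mdeg \<alpha>"
        by (rule abs_mpow_le) (rule Basis_le_norm)
      also have "\<dots> = (norm h)\<^sup>2 * norm h ^ n" unfolding 3 by (simp add: power2_eq_square)
      also have "\<dots> \<le> (norm h)\<^sup>2 * r ^ n" by (intro mult_left_mono power_mono that) auto
      also have "\<dots> = (norm h / r)\<^sup>2 * r ^ mdeg \<alpha>"
        unfolding 3 using r by (simp add: power2_eq_square)
      finally show ?thesis using 3 by (simp add: mpow_zero l_def)
    qed (use r in \<open>auto simp: mpow_zero l_def mdeg_eq_0D\<close>)
  qed
  have est: "norm (f (x + h) - f x - L h) \<le> S / r\<^sup>2 * (norm h)\<^sup>2" if h: "norm h \<le> r" for h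
  proof -
    have m: "x + h \<in> cube x r" "x \<in> cube x r"
      using h Basis_le_norm[of _ h] r order.trans by (fastforce simp: cube_def)+
    have "((\<lambda>\<alpha>. mpow \<alpha> h *\<^sub>R c \<alpha> - mpow \<alpha> 0 *\<^sub>R c \<alpha> - l \<alpha> h *\<^sub>R c \<alpha>) has_sum (f (x + h) - f x - L h)) midx"
      using has_sum_minus[OF has_sum_minus[OF c(3)[OF m(1)] c(3)[OF m(2)]] L[of h]] by simp
    then have "norm (f (x + h) - f x - L h) \<le> (norm h / r)\<^sup>2 * S"
    proof (rule norm_infsum_le[OF _ cs])
      fix \<alpha>
      have "norm (mpow \<alpha> h *\<^sub>R c \<alpha> - mpow \<alpha> 0 *\<^sub>R c \<alpha> - l \<alpha> h *\<^sub>R c \<alpha>)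
          = \<bar>mpow \<alpha> h - mpow \<alpha> 0 - l \<alpha> h\<bar> * norm (c \<alpha>)"
        by (simp flip: scaleR_diff_left)
      also have "\<dots> \<le> (norm h / r)\<^sup>2 * (norm (c \<alpha>) * r ^ mdeg \<alpha>)"
        using mult_right_mono[OF rem[OF h], of "norm (c \<alpha>)" \<alpha>] by (simp add: mult_ac)
      finally show "norm (mpow \<alpha> h *\<^sub>R c \<alpha> - mpow \<alpha> 0 *\<^sub>R c \<alpha> - l \<alpha> h *\<^sub>R c \<alpha>)
          \<le> (norm h / r)\<^sup>2 * (norm (c \<alpha>) * r ^ mdeg \<alpha>)" .
    qed
    then show ?thesis by (simp add: power_divide mult.commute)
  qed
  have "(f has_derivative L) (at x)"
    unfolding has_derivative_at
  proof (intro conjI \<open>bounded_linear L\<close>)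
    have "((\<lambda>h::'a. S / r\<^sup>2 * norm h) \<longlongrightarrow> S / r\<^sup>2 * norm (0::'a)) (at 0)"
      by (intro tendsto_intros)
    then have lim: "((\<lambda>h::'a. S / r\<^sup>2 * norm h) \<longlongrightarrow> 0) (at 0)" by simp
    have ev: "eventually (\<lambda>h::'a. norm h < r) (at 0)"
      using r by (auto simp: eventually_at intro!: exI[of _ r])
    show "(\<lambda>h. norm (f (x + h) - f x - L h) / norm h) \<midarrow>0\<rightarrow> 0"
    proof (rule Lim_null_comparison[OF _ lim])
      show "eventually (\<lambda>h. norm (norm (f (x + h) - f x - L h) / norm h) \<le> S / r\<^sup>2 * norm h) (at 0)"
        using ev
      proof eventually_elim
        case (elim h)
        then show ?case using est[of h]
          by (cases "h = 0") (auto simp: divide_le_eq power2_eq_square mult_ac)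
      qed
    qed
  qed
  then show ?thesis by (rule differentiableI)
qed

text \<open>The remainders e_m satisfy e_(m+1) = (a + t) e_m + m a^(m-1) t^2. Doubling \<rho> in the
  bound pays for the factor m, because m \<le> 2^m.\<close>

lemma power_second_order_bound:
  fixes a t \<rho> :: real
  assumes "\<bar>a\<bar> \<le> \<rho>" "\<bar>a + t\<bar> \<le> \<rho>" "0 < \<rho>"
  shows "\<bar>(a + t) ^ m - a ^ m - real m * a ^ (m - 1) * t\<bar> * \<rho>\<^sup>2 \<le> (2 * \<rho>) ^ m * t\<^sup>2"
proof (induction m)
  case 0
  show ?case by simp
next
  case (Suc m)
  define e where "e k = (a + t) ^ k - a ^ k - real k * a ^ (k - 1) * t" for k
  have e: "e (Suc m) = (a + t) * e m + real m * a ^ (m - 1) * t\<^sup>2"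
    unfolding e_def by (cases m) (auto simp: algebra_simps power2_eq_square)
  have 1: "\<bar>(a + t) * e m\<bar> * \<rho>\<^sup>2 \<le> \<rho> * ((2 * \<rho>) ^ m * t\<^sup>2)"
    using mult_mono[OF assms(2) Suc.IH[folded e_def]] assms by (simp add: abs_mult mult_ac)
  have 2: "\<bar>real m * a ^ (m - 1) * t\<^sup>2\<bar> * \<rho>\<^sup>2 \<le> real m * \<rho> ^ Suc m * t\<^sup>2"
  proof (cases m)
    case (Suc k)
    have "\<bar>a\<bar> ^ k \<le> \<rho> ^ k" using assms(1) by (intro power_mono) auto
    then have "\<bar>a\<bar> ^ k * (real m * t\<^sup>2 * \<rho>\<^sup>2) \<le> \<rho> ^ k * (real m * t\<^sup>2 * \<rho>\<^sup>2)"
      by (intro mult_right_mono) auto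
    then show ?thesis using Suc by (simp add: abs_mult power_abs mult_ac power2_eq_square)
  qed simp
  have 3: "real m * \<rho> ^ Suc m * t\<^sup>2 \<le> 2 ^ m * \<rho> ^ Suc m * t\<^sup>2"
    using assms(3) by (intro mult_right_mono) (auto intro: less_imp_le of_nat_less_two_power)
  have "\<bar>e (Suc m)\<bar> * \<rho>\<^sup>2 \<le> (\<bar>(a + t) * e m\<bar> + \<bar>real m * a ^ (m - 1) * t\<^sup>2\<bar>) * \<rho>\<^sup>2"
    unfolding e by (intro mult_right_mono abs_triangle_ineq) auto
  also have "\<dots> \<le> \<rho> * ((2 * \<rho>) ^ m * t\<^sup>2) + 2 ^ m * \<rho> ^ Suc m * t\<^sup>2"
    by (subst distrib_right) (rule add_mono[OF 1 order.trans[OF 2 3]])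
  also have "\<dots> = (2 * \<rho>) ^ Suc m * t\<^sup>2"
    by (simp add: power_mult_distrib algebra_simps)
  finally show ?case unfolding e_def .
qed

text \<open>The series \<open>g\<close> of termwise derivatives in direction b has finite norm on
  the smaller cube. At each z there, the second order bound shows that t \<mapsto> f(z + t b) has
  derivative g z at 0; differentiability of f at z is known from re-expansion, and uniqueness of the
  derivative identifies the two.\<close>

lemma ps_bound_deriv:
  fixes f :: "'a::euclidean_space \<Rightarrow> 'b::banach"
  assumes f: "ps_bound x r f K" and r: "0 < r" and b: "b \<in> Basis"
  obtains g K' where "ps_bound x (r / 4) g K'"
    "\<And>z. z \<in> cube x (r / 4) \<Longrightarrow> f differentiable (at z) \<and> frechet_derivative f (at z) b = g z"
proof -
  obtain c S where c': "ps_expansion x r f c S" "S \<le> K"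
    by (rule ps_boundE[OF f])
  note c = ps_expansionD(1)[OF c'(1)] c'(2) ps_expansionD(2)[OF c'(1)]
  have cs: "((\<lambda>\<alpha>. t * (norm (c \<alpha>) * r ^ mdeg \<alpha>)) has_sum t * S) midx" for t
    by (rule has_sum_cmult_right[OF c(1)])
  define p where "p \<alpha> w = (\<Prod>b'\<in>Basis - {b}. (w \<bullet> b') ^ \<alpha> b')" for \<alpha> and w :: 'a
  have mp: "mpow \<alpha> w = (w \<bullet> b) ^ \<alpha> b * p \<alpha> w" for \<alpha> w
    unfolding mpow_def p_def using b by (intro prod.remove) auto
  have md: "mdeg \<alpha> = \<alpha> b + (\<Sum>b'\<in>Basis - {b}. \<alpha> b')" for \<alpha>
    unfolding mdeg_def using b by (intro sum.remove) auto
  define d where "d \<alpha> w = real (\<alpha> b) * (w \<bullet> b) ^ (\<alpha> b - 1) * p \<alpha> w" for \<alpha> w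
  have d_bound: "ps_bound x (r / 4) (\<lambda>y. d \<alpha> (y - x)) (1 / r * r ^ mdeg \<alpha>)" for \<alpha>
  proof (cases "\<alpha> b")
    case 0
    then show ?thesis using ps_bound_const[of x "r/4" "0::real"] r
      by (auto simp: d_def elim!: ps_bound_mono)
  next
    case (Suc k)
    let ?m = "\<Sum>b'\<in>Basis - {b}. \<alpha> b'"
    have "ps_bound x (r / 4) (\<lambda>y. p \<alpha> (y - x)) ((r / 4) ^ ?m)"
      unfolding p_def power_sum using r by (intro ps_bound_prod ps_bound_power ps_bound_coord) auto
    then have "ps_bound x (r / 4) (\<lambda>y. d \<alpha> (y - x)) (norm (real (\<alpha> b)) * (r / 4) ^ (\<alpha> b - 1) * (r / 4) ^ ?m)"
      unfolding d_def using r b by (intro ps_bound_mult ps_bound_const ps_bound_power ps_bound_coord) auto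
    \<comment> \<open>The exponent brought down by differentiation is absorbed by the passage from r
      to r / 4, since k + 1 \<le> 4^k.\<close>
    moreover have "real (Suc k) * (r / 4) ^ k * (r / 4) ^ ?m \<le> r ^ k * r ^ ?m"
    proof (intro mult_mono)
      have "real (Suc k) \<le> 4 ^ k"
      proof (induction k)
        case (Suc k) then show ?case by simp
      qed simp
      then have "real (Suc k) * (r ^ k / 4 ^ k) \<le> 4 ^ k * (r ^ k / 4 ^ k)"
        using r by (intro mult_right_mono) auto
      then show "real (Suc k) * (r / 4) ^ k \<le> r ^ k" by (simp add: power_divide)
      show "(r / 4) ^ ?m \<le> r ^ ?m" using r by (intro power_mono) auto
    qed (use r in auto)
    moreover have "1 / r * r ^ mdeg \<alpha> = r ^ k * r ^ ?m"
      using r Suc by (simp add: md power_add)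
    ultimately show ?thesis using Suc by (auto elim!: ps_bound_mono)
  qed
  have d_sc: "ps_bound x (r / 4) (\<lambda>y. d \<alpha> (y - x) *\<^sub>R c \<alpha>) (1 / r * (norm (c \<alpha>) * r ^ mdeg \<alpha>))" for \<alpha>
    using ps_bound_scaleR[OF _ d_bound[of \<alpha>] ps_bound_const[of x "r/4" "c \<alpha>"]] r by (simp add: mult_ac)
  define g where "g y = infsum (\<lambda>\<alpha>. d \<alpha> (y - x) *\<^sub>R c \<alpha>) midx" for y
  have g: "((\<lambda>\<alpha>. d \<alpha> (y - x) *\<^sub>R c \<alpha>) has_sum g y) midx" if "y \<in> cube x (r / 4)" for y
    unfolding g_def
    by (rule has_sum_infsum[OF abs_summable_summable[OF
          Infinite_Sum.abs_summable_on_comparison_test'[OF has_sum_imp_summable[OF cs]]]])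
       (rule norm_le_ps_bound[OF d_sc that])
  have g_bound: "ps_bound x (r / 4) g (1 / r * S)"
    by (rule ps_bound_has_sum[OF _ d_sc cs g]) (use r in auto)
  show ?thesis
  proof (rule that[OF g_bound], intro conjI)
    fix z assume z: "z \<in> cube x (r / 4)"
    have z2: "z \<in> cube x (r / 2)" using z cube_mono[of "r/4" "r/2" x] r by auto
    show diff: "f differentiable (at z)"
      using ps_bound_differentiable[OF ps_bound_recenter[OF f r z2]] r by simp
    define w where "w = z - x"
    have wb: "\<bar>w \<bullet> b'\<bar> \<le> r / 4" if "b' \<in> Basis" for b' using cubeD[OF z that] by (simp add: w_def)
    have est: "norm (f (z + t *\<^sub>R b) - f z - t *\<^sub>R g z) \<le> 4 / r\<^sup>2 * S * t\<^sup>2" if t: "\<bar>t\<bar> \<le> r / 4" for t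
    proof -
      have comp: "(w + t *\<^sub>R b) \<bullet> b' = w \<bullet> b' + (if b' = b then t else 0)" if "b' \<in> Basis" for b'
        using that b by (simp add: inner_add_left inner_Basis)
      have "z + t *\<^sub>R b \<in> cube x r"
        unfolding cube_def
      proof (intro CollectI ballI)
        fix b' :: 'a assume b': "b' \<in> Basis"
        have "(z + t *\<^sub>R b - x) \<bullet> b' = w \<bullet> b' + (if b' = b then t else 0)"
          using comp[OF b'] by (simp add: w_def algebra_simps)
        then show "\<bar>(z + t *\<^sub>R b - x) \<bullet> b'\<bar> \<le> r" using wb[OF b'] t r by (simp split: if_splits)
      qed
      note s1 = c(3)[OF this]
      have "z \<in> cube x r" using z cube_mono[of "r/4" r x] r by auto
      note s2 = c(3)[OF this]
      have s: "((\<lambda>\<alpha>. mpow \<alpha> (w + t *\<^sub>R b) *\<^sub>R c \<alpha> - mpow \<alpha> w *\<^sub>R c \<alpha> - t *\<^sub>R d \<alpha> w *\<^sub>R c \<alpha>)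
          has_sum (f (z + t *\<^sub>R b) - f z - t *\<^sub>R g z)) midx"
        using has_sum_minus[OF has_sum_minus[OF s1 s2] has_sum_scaleR[OF g[OF z], of t]]
        by (simp add: w_def algebra_simps)
      have "norm (f (z + t *\<^sub>R b) - f z - t *\<^sub>R g z) \<le> (4 / r\<^sup>2 * t\<^sup>2) * S"
      proof (rule norm_infsum_le[OF s cs])
        fix \<alpha> :: "'a \<Rightarrow> nat"
        let ?m = "\<Sum>b'\<in>Basis - {b}. \<alpha> b'" and ?a = "w \<bullet> b"
        have pp: "p \<alpha> (w + t *\<^sub>R b) = p \<alpha> w"
          unfolding p_def using comp by (intro prod.cong) auto
        let ?e = "(?a + t) ^ \<alpha> b - ?a ^ \<alpha> b - real (\<alpha> b) * ?a ^ (\<alpha> b - 1) * t"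
        have eq: "mpow \<alpha> (w + t *\<^sub>R b) *\<^sub>R c \<alpha> - mpow \<alpha> w *\<^sub>R c \<alpha> - t *\<^sub>R d \<alpha> w *\<^sub>R c \<alpha> = (?e * p \<alpha> w) *\<^sub>R c \<alpha>"
          unfolding mp pp d_def comp[OF b] by (simp add: algebra_simps)
        \<comment> \<open>Here \<rho> = r / 2 fits, since both the coordinate of w and t are at most
          r / 4 in absolute value, and 2 \<rho> = r restores the weight of the given
          expansion.\<close>
        have "\<bar>?e\<bar> * (r / 2)\<^sup>2 \<le> (2 * (r / 2)) ^ \<alpha> b * t\<^sup>2"
          by (rule power_second_order_bound) (use abs_triangle_ineq[of ?a t] wb[OF b] t r in linarith)+
        then have e_le: "\<bar>?e\<bar> \<le> 4 / r\<^sup>2 * t\<^sup>2 * r ^ \<alpha> b"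
          using r by (simp add: field_simps)
        have p_le: "\<bar>p \<alpha> w\<bar> \<le> r ^ ?m"
          unfolding p_def abs_prod power_sum power_abs
        proof (intro prod_mono conjI power_mono)
          fix b' assume "b' \<in> Basis - {b}"
          then show "\<bar>w \<bullet> b'\<bar> \<le> r" using wb[of b'] r by auto
        qed auto
        have "\<bar>?e\<bar> * \<bar>p \<alpha> w\<bar> \<le> (4 / r\<^sup>2 * t\<^sup>2 * r ^ \<alpha> b) * r ^ ?m"
          using r by (intro mult_mono e_le p_le) auto
        also have "\<dots> = 4 / r\<^sup>2 * t\<^sup>2 * r ^ mdeg \<alpha>" by (simp add: md power_add)
        finally have "\<bar>?e\<bar> * \<bar>p \<alpha> w\<bar> * norm (c \<alpha>) \<le> 4 / r\<^sup>2 * t\<^sup>2 * r ^ mdeg \<alpha> * norm (c \<alpha>)"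
          by (rule mult_right_mono) simp
        then show "norm (mpow \<alpha> (w + t *\<^sub>R b) *\<^sub>R c \<alpha> - mpow \<alpha> w *\<^sub>R c \<alpha> - t *\<^sub>R d \<alpha> w *\<^sub>R c \<alpha>)
            \<le> 4 / r\<^sup>2 * t\<^sup>2 * (norm (c \<alpha>) * r ^ mdeg \<alpha>)"
          unfolding eq by (simp add: abs_mult mult_ac)
      qed
      then show ?thesis by (simp add: mult_ac)
    qed
    have 1: "((\<lambda>t. f (z + t *\<^sub>R b)) has_vector_derivative g z) (at 0)"
      unfolding has_vector_derivative_def has_derivative_at
    proof (intro conjI bounded_linear_scaleR_left)
      have "((\<lambda>t. 4 / r\<^sup>2 * S * \<bar>t\<bar>) \<longlongrightarrow> 4 / r\<^sup>2 * S * \<bar>0\<bar>) (at 0)"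
        by (intro tendsto_intros)
      then have lim: "((\<lambda>t. 4 / r\<^sup>2 * S * \<bar>t\<bar>) \<longlongrightarrow> 0) (at (0::real))" by simp
      have ev: "eventually (\<lambda>t::real. \<bar>t\<bar> < r / 4) (at 0)"
        using r by (auto simp: eventually_at intro!: exI[of _ "r / 4"])
      show "(\<lambda>t. norm (f (z + (0 + t) *\<^sub>R b) - f (z + 0 *\<^sub>R b) - t *\<^sub>R g z) / norm t) \<midarrow>0\<rightarrow> 0"
      proof (rule Lim_null_comparison[OF _ lim])
        show "eventually (\<lambda>t. norm (norm (f (z + (0 + t) *\<^sub>R b) - f (z + 0 *\<^sub>R b) - t *\<^sub>R g z) / norm t)
            \<le> 4 / r\<^sup>2 * S * \<bar>t\<bar>) (at 0)"
          using ev
        proof eventually_elim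
          case (elim t)
          then show ?case using est[of t]
            by (cases "t = 0") (auto simp: divide_le_eq power2_eq_square mult_ac)
        qed
      qed
    qed
    have "(f has_derivative frechet_derivative f (at z)) (at (z + 0 *\<^sub>R b))"
      using diff by (simp add: frechet_derivative_works)
    then have "((f \<circ> (\<lambda>t. z + t *\<^sub>R b)) has_derivative (frechet_derivative f (at z) \<circ> (\<lambda>t. t *\<^sub>R b))) (at 0)"
      by (intro diff_chain_at) (auto intro!: derivative_eq_intros)
    then have 2: "((\<lambda>t. f (z + t *\<^sub>R b)) has_vector_derivative frechet_derivative f (at z) b) (at 0)"
      unfolding has_vector_derivative_def o_def
      using linear_frechet_derivative[OF diff] by (simp add: linear_cmul)
    show "frechet_derivative f (at z) b = g z"
      by (rule vector_derivative_unique_at[OF 2 1])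
  qed
qed

lemma ps_analytic_differentiable: "ps_analytic f x \<Longrightarrow> f differentiable (at x)"
  by (auto simp: ps_analytic_def intro: ps_bound_differentiable)

lemma ps_analytic_frechet_derivative:
  assumes "ps_analytic f x" "b \<in> Basis"
  shows "ps_analytic (\<lambda>z. frechet_derivative f (at z) b) x"
proof -
  obtain r K where r: "0 < r" "ps_bound x r f K" using assms(1) by (auto simp: ps_analytic_def)
  obtain g K' where g: "ps_bound x (r / 4) g K'"
    "\<And>z. z \<in> cube x (r / 4) \<Longrightarrow> f differentiable (at z) \<and> frechet_derivative f (at z) b = g z"
    using ps_bound_deriv[OF r(2,1) assms(2)] by blast
  have "ps_bound x (r / 4) (\<lambda>z. frechet_derivative f (at z) b) K'"
    by (rule ps_bound_cong[OF g(1)]) (use g(2) in auto)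
  with r(1) show ?thesis by (auto intro: ps_analyticI[of "r / 4"])
qed

lemma ps_analytic_imp_Ck_on:
  assumes "\<And>x. x \<in> S \<Longrightarrow> ps_analytic f x"
  shows "Ck_on k S f"
  using assms
proof (induction k arbitrary: f)
  case 0
  then show ?case
    by (auto intro!: differentiable_imp_continuous_on
        simp: differentiable_on_def ps_analytic_differentiable differentiable_at_withinI)
next
  case (Suc k)
  then show ?case
    by (auto simp: ps_analytic_differentiable intro!: Suc.IH ps_analytic_frechet_derivative)
qed

lemma ps_analytic_imp_real_analytic_on:
  assumes "\<And>x. x \<in> S \<Longrightarrow> ps_analytic f x"
  shows "real_analytic_on S f"
  unfolding real_analytic_on_def
proof
  fix x assume "x \<in> S"
  from assms[OF this] obtain r K where r: "0 < r" "ps_bound x r f K" by (auto simp: ps_analytic_def)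
  from r(2) obtain c S where "ps_expansion x r f c S" by (rule ps_boundE)
  then show "\<exists>r>0. \<exists>c. \<forall>y\<in>ball x r. ((\<lambda>\<alpha>. (\<Prod>b\<in>Basis. ((y - x) \<bullet> b) ^ \<alpha> b) *\<^sub>R c \<alpha>) has_sum f y)
      {\<alpha>. \<forall>b. b \<notin> Basis \<longrightarrow> \<alpha> b = 0}"
    using r(1) ball_subset_cube unfolding ps_expansion_def mpow_def midx_def by blast
qed

section \<open>The potential of a solution and its holomorphic function\<close>

text \<open>Poincare lemma: \<phi>(p) integrates the form u dx - v dy along the segment from p0 to
  p, which stays in B by convexity. Differentiation under the integral sign produces an integrand
  that, because the form is closed, is the derivative in t of t times the form at the point
  \<open>\<gamma> p t\<close>; its integral is the form at p.\<close>

lemma closed_form_potential: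
  fixes u v ux uy vx vy :: "real \<times> real \<Rightarrow> real"
  assumes B: "open B" "convex B" and p0: "p0 \<in> B"
    and u: "\<And>p. p \<in> B \<Longrightarrow> (u has_derivative (\<lambda>h. fst h * ux p + snd h * uy p)) (at p)"
    and v: "\<And>p. p \<in> B \<Longrightarrow> (v has_derivative (\<lambda>h. fst h * vx p + snd h * vy p)) (at p)"
    and c: "continuous_on B ux" "continuous_on B uy" "continuous_on B vx" "continuous_on B vy"
    and curl: "\<And>p. p \<in> B \<Longrightarrow> uy p = - vx p"
  obtains \<phi> where "\<And>p. p \<in> B \<Longrightarrow> (\<phi> has_derivative (\<lambda>h. fst h * u p - snd h * v p)) (at p)"
proof -
  define \<gamma> where "\<gamma> p t = p0 + t *\<^sub>R (p - p0)" for p and t :: real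
  define d where "d p = p - p0" for p
  have \<gamma>B: "\<gamma> p t \<in> B" if "p \<in> B" "0 \<le> t" "t \<le> 1" for p t
  proof -
    have "(1 - t) *\<^sub>R p0 + t *\<^sub>R p \<in> B"
      using B(2) p0 that by (intro convexD_alt) auto
    then show ?thesis by (simp add: \<gamma>_def algebra_simps)
  qed
  \<comment> \<open>The coordinate functionals are packed as bounded linear functions because the
    Leibniz rule integrates the derivative as an element of that Banach space.\<close>
  define E1 :: "(real \<times> real) \<Rightarrow>\<^sub>L real" where "E1 = Blinfun fst"
  define E2 :: "(real \<times> real) \<Rightarrow>\<^sub>L real" where "E2 = Blinfun snd"
  have E: "blinfun_apply E1 = fst" "blinfun_apply E2 = snd"
    unfolding E1_def E2_def by (simp_all add: bounded_linear_Blinfun_apply bounded_linear_fst bounded_linear_snd)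
  define f where "f p t = fst (d p) * u (\<gamma> p t) - snd (d p) * v (\<gamma> p t)" for p t
  \<comment> \<open>The derivative of \<open>f p t\<close> in p, already rewritten with the curl
    equation so that it is visibly the derivative of \<open>t *\<^sub>R (u (\<gamma> p t) *\<^sub>R
    E1 - v (\<gamma> p t) *\<^sub>R E2)\<close> in t.\<close>
  define fx where "fx p t =
     (u (\<gamma> p t) + t * (fst (d p) * ux (\<gamma> p t) + snd (d p) * uy (\<gamma> p t))) *\<^sub>R E1 -
     (v (\<gamma> p t) + t * (fst (d p) * vx (\<gamma> p t) + snd (d p) * vy (\<gamma> p t))) *\<^sub>R E2" for p t
  have cu: "continuous_on B u" "continuous_on B v"
    by (rule has_derivative_continuous_on[OF has_derivative_at_withinI], erule u)
       (rule has_derivative_continuous_on[OF has_derivative_at_withinI], erule v)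
  have der: "((\<lambda>p. f p t) has_derivative blinfun_apply (fx p t)) (at p within B)"
    if "p \<in> B" "t \<in> cbox 0 1" for p t
  proof -
    have t: "0 \<le> t" "t \<le> 1" using that by auto
    have g: "((\<lambda>p. \<gamma> p t) has_derivative (\<lambda>h. t *\<^sub>R h)) (at p)"
      unfolding \<gamma>_def by (auto intro!: derivative_eq_intros)
    have U: "((\<lambda>p. u (\<gamma> p t)) has_derivative (\<lambda>h. fst (t *\<^sub>R h) * ux (\<gamma> p t) + snd (t *\<^sub>R h) * uy (\<gamma> p t))) (at p)"
      by (rule has_derivative_compose[OF g u[OF \<gamma>B[OF that(1) t]]])
    have V: "((\<lambda>p. v (\<gamma> p t)) has_derivative (\<lambda>h. fst (t *\<^sub>R h) * vx (\<gamma> p t) + snd (t *\<^sub>R h) * vy (\<gamma> p t))) (at p)"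
      by (rule has_derivative_compose[OF g v[OF \<gamma>B[OF that(1) t]]])
    have d1: "((\<lambda>p. fst (d p)) has_derivative fst) (at p)" "((\<lambda>p. snd (d p)) has_derivative snd) (at p)"
      unfolding d_def by (auto intro!: derivative_eq_intros)
    have cl: "uy (\<gamma> p t) = - vx (\<gamma> p t)" by (rule curl[OF \<gamma>B[OF that(1) t]])
    have "((\<lambda>p. f p t) has_derivative blinfun_apply (fx p t)) (at p)"
      unfolding f_def
      by (rule has_derivative_eq_rhs[OF has_derivative_diff[OF has_derivative_mult[OF d1(1) U] has_derivative_mult[OF d1(2) V]]], rule ext)
         (simp add: fx_def E cl blinfun.diff_left blinfun.add_left blinfun.scaleR_left algebra_simps)
    then show ?thesis by (rule has_derivative_at_withinI)
  qed
  have g_cont: "continuous_on (B \<times> cbox 0 1) (\<lambda>q. \<gamma> (fst q) (snd q))"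
    unfolding \<gamma>_def by (intro continuous_intros)
  have g_img: "(\<lambda>q. \<gamma> (fst q) (snd q)) ` (B \<times> cbox 0 1) \<subseteq> B" using \<gamma>B by auto
  note cc = continuous_on_compose2[OF _ g_cont g_img]
  have fx_cont: "continuous_on (B \<times> cbox 0 1) (\<lambda>(p, t). fx p t)"
    unfolding fx_def d_def case_prod_beta
    by (intro continuous_intros cc[OF cu(1)] cc[OF cu(2)] cc[OF c(1)] cc[OF c(2)] cc[OF c(3)] cc[OF c(4)])
  have g_cont1: "continuous_on (cbox 0 1) (\<lambda>t. \<gamma> p t)" for p
    unfolding \<gamma>_def by (intro continuous_intros)
  have f_int: "f p integrable_on cbox 0 1" if "p \<in> B" for p
  proof (rule integrable_continuous)
    have img: "(\<lambda>t. \<gamma> p t) ` cbox 0 1 \<subseteq> B"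
      by (rule image_subsetI) (simp add: \<gamma>B[OF that])
    show "continuous_on (cbox 0 1) (f p)"
      unfolding f_def d_def
      by (intro continuous_intros continuous_on_compose2[OF cu(1) g_cont1 img]
           continuous_on_compose2[OF cu(2) g_cont1 img])
  qed
  have "((\<lambda>p. integral (cbox 0 1) (f p)) has_derivative (\<lambda>h. fst h * u p - snd h * v p)) (at p)"
    if p: "p \<in> B" for p
  proof -
    have "(fx p has_integral (1 *\<^sub>R (u (\<gamma> p 1) *\<^sub>R E1 - v (\<gamma> p 1) *\<^sub>R E2) -
        0 *\<^sub>R (u (\<gamma> p 0) *\<^sub>R E1 - v (\<gamma> p 0) *\<^sub>R E2))) {0..1}"
    proof (rule fundamental_theorem_of_calculus[of 0 1 "\<lambda>t. t *\<^sub>R (u (\<gamma> p t) *\<^sub>R E1 - v (\<gamma> p t) *\<^sub>R E2)"])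
      fix t :: real assume t: "t \<in> {0..1}"
      then have tB: "\<gamma> p t \<in> B" using \<gamma>B[OF p] by auto
      have g: "((\<lambda>t. \<gamma> p t) has_derivative (\<lambda>s. s *\<^sub>R d p)) (at t)"
        unfolding \<gamma>_def d_def by (auto intro!: derivative_eq_intros)
      have U: "((\<lambda>t. u (\<gamma> p t)) has_derivative (\<lambda>s. fst (s *\<^sub>R d p) * ux (\<gamma> p t) + snd (s *\<^sub>R d p) * uy (\<gamma> p t))) (at t)"
        by (rule has_derivative_compose[OF g u[OF tB]])
      have V: "((\<lambda>t. v (\<gamma> p t)) has_derivative (\<lambda>s. fst (s *\<^sub>R d p) * vx (\<gamma> p t) + snd (s *\<^sub>R d p) * vy (\<gamma> p t))) (at t)"
        by (rule has_derivative_compose[OF g v[OF tB]])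
      have "((\<lambda>t. t *\<^sub>R (u (\<gamma> p t) *\<^sub>R E1 - v (\<gamma> p t) *\<^sub>R E2)) has_derivative (\<lambda>s. s *\<^sub>R fx p t)) (at t)"
        by (rule has_derivative_eq_rhs[OF has_derivative_scaleR[OF has_derivative_ident
              has_derivative_diff[OF has_derivative_scaleR_left[OF U] has_derivative_scaleR_left[OF V]]]])
           (auto simp: fx_def algebra_simps)
      then show "((\<lambda>t. t *\<^sub>R (u (\<gamma> p t) *\<^sub>R E1 - v (\<gamma> p t) *\<^sub>R E2)) has_vector_derivative fx p t) (at t within {0..1})"
        unfolding has_vector_derivative_def by (rule has_derivative_at_withinI)
    qed simp
    then have "integral (cbox 0 1) (fx p) = u p *\<^sub>R E1 - v p *\<^sub>R E2"
      by (simp add: \<gamma>_def integral_unique)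
    moreover have "((\<lambda>p. integral (cbox 0 1) (f p)) has_derivative blinfun_apply (integral (cbox 0 1) (fx p))) (at p within B)"
      by (rule leibniz_rule[OF der f_int fx_cont p B(2)])
    moreover have "blinfun_apply (u p *\<^sub>R E1 - v p *\<^sub>R E2) = (\<lambda>h. fst h * u p - snd h * v p)"
      by (rule ext) (simp add: blinfun.diff_left blinfun.scaleR_left E mult.commute)
    ultimately show ?thesis
      by (simp add: at_within_open[OF p B(1)])
  qed
  then show ?thesis by (rule that)
qed

text \<open>The identities are kept multiplied by y and y^2, so that one and the same statement
  applies to discs on and off the real axis; dividing is postponed to the two places where it is
  justified in different ways.\<close>

definition encodes_solution ::
  "(complex \<Rightarrow> complex) \<Rightarrow> (real \<times> real \<Rightarrow> real) \<Rightarrow> (real \<times> real \<Rightarrow> real) \<Rightarrow> complex set \<Rightarrow> bool" where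
  "encodes_solution g u v S \<longleftrightarrow> g holomorphic_on S \<and>
     (\<forall>x y. Complex x y \<in> S \<longrightarrow> y * u (x, y) = Im (deriv g (Complex x y)) \<and>
        y\<^sup>2 * v (x, y) = Im (g (Complex x y)) - y * Re (deriv g (Complex x y)))"

lemma encodes_solutionD:
  assumes "encodes_solution g u v S"
  shows "g holomorphic_on S"
    and "Complex x y \<in> S \<Longrightarrow> y * u (x, y) = Im (deriv g (Complex x y))"
    and "Complex x y \<in> S \<Longrightarrow> y\<^sup>2 * v (x, y) = Im (g (Complex x y)) - y * Re (deriv g (Complex x y))"
  using assms unfolding encodes_solution_def by blast+

text \<open>The function h = (\<phi> - y v) + i y u is the intended g'. Of its Cauchy-Riemann
  equations, one is u_y = - v_x and the other is y (u_x - v_y) = 2 v. A primitive of h on the convex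
  domain has imaginary part y \<phi> up to a constant.\<close>

lemma holomorphic_representation:
  fixes u v ux uy vx vy :: "real \<times> real \<Rightarrow> real"
  assumes B: "open B" "convex B"
    and u: "\<And>p. p \<in> B \<Longrightarrow> (u has_derivative (\<lambda>h. fst h * ux p + snd h * uy p)) (at p)"
    and v: "\<And>p. p \<in> B \<Longrightarrow> (v has_derivative (\<lambda>h. fst h * vx p + snd h * vy p)) (at p)"
    and c: "continuous_on B ux" "continuous_on B uy" "continuous_on B vx" "continuous_on B vy"
    and curl: "\<And>p. p \<in> B \<Longrightarrow> uy p = - vx p"
    and div: "\<And>p. p \<in> B \<Longrightarrow> snd p * (ux p - vy p) = 2 * v p"
  obtains g where "encodes_solution g u v {w. (Re w, Im w) \<in> B}"
proof (cases "B = {}")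
  case True
  then show ?thesis using that[of "\<lambda>_. 0"] by (simp add: encodes_solution_def)
next
  case False
  then obtain p0 where "p0 \<in> B" by blast
  from closed_form_potential[OF B this u v c curl] obtain \<phi> where
    \<phi>: "\<And>p. p \<in> B \<Longrightarrow> (\<phi> has_derivative (\<lambda>h. fst h * u p - snd h * v p)) (at p)" by blast
  define e where "e w = (Re w, Im w)" for w
  define S where "S = {w. e w \<in> B}"
  have e_der: "(e has_derivative e) (at w)" for w
    unfolding e_def[abs_def] by (auto intro!: derivative_eq_intros)
  have e_lin: "linear e"
    by (rule linearI) (auto simp: e_def)
  have "continuous_on UNIV e"
    using e_der by (auto intro!: has_derivative_continuous_on)
  then have S_open: "open S"
    unfolding S_def using open_vimage[OF B(1)] by (simp add: vimage_def)
  have S_conv: "convex S"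
    unfolding S_def using convex_linear_vimage[OF e_lin B(2)] by (simp add: vimage_def)
  define h where "h w = of_real (\<phi> (e w) - Im w * v (e w)) + \<i> * of_real (Im w * u (e w))" for w
  have h_der: "(h has_field_derivative Complex (u (e w) + Im w * uy (e w)) (Im w * ux (e w))) (at w)"
    if w: "w \<in> S" for w
  proof -
    have eB: "e w \<in> B" using w by (simp add: S_def)
    have \<phi>': "((\<lambda>w. \<phi> (e w)) has_derivative (\<lambda>k. Re k * u (e w) - Im k * v (e w))) (at w)"
      using has_derivative_compose[OF e_der \<phi>[OF eB]] by (simp add: e_def)
    have u': "((\<lambda>w. u (e w)) has_derivative (\<lambda>k. Re k * ux (e w) + Im k * uy (e w))) (at w)"
      using has_derivative_compose[OF e_der u[OF eB]] by (simp add: e_def)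
    have v': "((\<lambda>w. v (e w)) has_derivative (\<lambda>k. Re k * vx (e w) + Im k * vy (e w))) (at w)"
      using has_derivative_compose[OF e_der v[OF eB]] by (simp add: e_def)
    have cl: "vx (e w) = - uy (e w)" using curl[OF eB] by simp
    have dv: "Im w * ux (e w) = 2 * v (e w) + Im w * vy (e w)"
      using div[OF eB] by (simp add: e_def algebra_simps)
    have Im': "(Im has_derivative Im) (at w)" by (auto intro!: derivative_eq_intros)
    show ?thesis
      unfolding has_field_derivative_def h_def
    proof (rule has_derivative_eq_rhs[OF has_derivative_add[OF has_derivative_of_real[OF
              has_derivative_diff[OF \<phi>' has_derivative_mult[OF Im' v']]]
            has_derivative_mult_right[OF has_derivative_of_real[OF has_derivative_mult[OF Im' u']]]]], rule ext)
      fix k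
      show "of_real (Re k * u (e w) - Im k * v (e w) -
             (Im w * (Re k * vx (e w) + Im k * vy (e w)) + Im k * v (e w))) +
            \<i> * of_real (Im w * (Re k * ux (e w) + Im k * uy (e w)) + Im k * u (e w)) =
            Complex (u (e w) + Im w * uy (e w)) (Im w * ux (e w)) * k"
        \<comment> \<open>The divergence equation is needed multiplied by each component of k,
          products that rewriting would not form; the curl equation enters as the rewrite rule
          \<open>cl\<close>.\<close>
        using arg_cong[OF dv, of "\<lambda>x. Re k * x"] arg_cong[OF dv, of "\<lambda>x. Im k * x"]
        by (simp add: complex_eq_iff cl algebra_simps)
    qed
  qed
  have "h holomorphic_on S"
    unfolding holomorphic_on_open[OF S_open] using h_der by blast
  then obtain g1 where g1: "\<And>w. w \<in> S \<Longrightarrow> (g1 has_field_derivative h w) (at w within S)"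
    using holomorphic_convex_primitive'[OF S_conv S_open] by blast
  have g1': "(g1 has_field_derivative h w) (at w)" if "w \<in> S" for w
    using g1[OF that] by (simp add: at_within_open[OF that S_open])
  have "((\<lambda>w. Im (g1 w) - Im w * \<phi> (e w)) has_derivative (\<lambda>k. 0)) (at w within S)" if w: "w \<in> S" for w
  proof -
    have eB: "e w \<in> B" using w by (simp add: S_def)
    have \<phi>': "((\<lambda>w. \<phi> (e w)) has_derivative (\<lambda>k. Re k * u (e w) - Im k * v (e w))) (at w)"
      using has_derivative_compose[OF e_der \<phi>[OF eB]] by (simp add: e_def)
    have Im': "(Im has_derivative Im) (at w)" by (auto intro!: derivative_eq_intros)
    have g': "((\<lambda>w. Im (g1 w)) has_derivative (\<lambda>k. Im (h w * k))) (at w)"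
      using g1'[OF w] unfolding has_field_derivative_def by (rule has_derivative_Im)
    have "((\<lambda>w. Im (g1 w) - Im w * \<phi> (e w)) has_derivative (\<lambda>k. 0)) (at w)"
      by (rule has_derivative_eq_rhs[OF has_derivative_diff[OF g' has_derivative_mult[OF Im' \<phi>']]])
         (auto simp: h_def algebra_simps)
    then show ?thesis by (rule has_derivative_at_withinI)
  qed
  from has_derivative_zero_constant[OF S_conv this] obtain C where
    C: "\<And>w. w \<in> S \<Longrightarrow> Im (g1 w) - Im w * \<phi> (e w) = C" by blast
  \<comment> \<open>Subtracting the imaginary constant leaves the derivative h unchanged and makes
    Im g equal to y \<phi>, as the identity for v requires.\<close>
  define g where "g w = g1 w - \<i> * of_real C" for w
  have g_der: "(g has_field_derivative h w) (at w)" if "w \<in> S" for w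
    unfolding g_def by (rule derivative_eq_intros g1'[OF that] refl)+ simp
  show ?thesis
  proof (rule that[of g], unfold encodes_solution_def, intro conjI allI impI)
    show "g holomorphic_on {w. (Re w, Im w) \<in> B}"
      using holomorphic_on_open[OF S_open, of g] g_der unfolding S_def e_def by blast
    fix x y assume "Complex x y \<in> {w. (Re w, Im w) \<in> B}"
    then have w: "Complex x y \<in> S" by (simp add: S_def e_def)
    have d: "deriv g (Complex x y) = h (Complex x y)" by (rule DERIV_imp_deriv[OF g_der[OF w]])
    show "y * u (x, y) = Im (deriv g (Complex x y))"
      unfolding d by (simp add: h_def e_def)
    show "y\<^sup>2 * v (x, y) = Im (g (Complex x y)) - y * Re (deriv g (Complex x y))"
      unfolding d using C[OF w] by (simp add: h_def g_def e_def algebra_simps power2_eq_square)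
  qed
qed

text \<open>Carries over to y = 0 those equations that are assumed only for y \<noteq> 0 or are
  obtained by dividing by y.\<close>

lemma eq_at_axis_by_continuity:
  fixes f :: "real \<times> real \<Rightarrow> 'b::t2_space"
  assumes "open D" "continuous_on D f" "continuous_on D g" "(x, 0) \<in> D"
    and eq: "\<And>y. (x, y) \<in> D \<Longrightarrow> 0 < y \<Longrightarrow> f (x, y) = g (x, y)"
  shows "f (x, 0) = g (x, 0)"
proof -
  have l: "((\<lambda>y. (x, y)) \<longlongrightarrow> (x, 0)) (at_right (0::real))"
    by (intro tendsto_intros)
  have "isCont f (x, 0)" "isCont g (x, 0)"
    using assms by (auto simp: continuous_on_eq_continuous_at)
  then have lf: "((\<lambda>y. f (x, y)) \<longlongrightarrow> f (x, 0)) (at_right (0::real))"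
    and lg: "((\<lambda>y. g (x, y)) \<longlongrightarrow> g (x, 0)) (at_right (0::real))"
    using isCont_tendsto_compose[OF _ l] by blast+
  have "eventually (\<lambda>y. (x, y) \<in> D) (at_right (0::real))"
    using topological_tendstoD[OF l assms(1,4)] .
  then have "eventually (\<lambda>y. f (x, y) = g (x, y)) (at_right (0::real))"
    using eventually_at_right_less[of "0::real"] by eventually_elim (rule eq)
  then have "((\<lambda>y. f (x, y)) \<longlongrightarrow> g (x, 0)) (at_right (0::real))"
    using lg by (simp cong: tendsto_cong)
  with lf show ?thesis
    using tendsto_unique trivial_limit_at_right_real by blast
qed

section \<open>Composition with holomorphic functions\<close>

text \<open>The Taylor series of f at q p converges absolutely at radius R / 4, and on a small
  enough cube the norm of q - q p is at most R / 4, so the series may be substituted.\<close>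

lemma ps_analytic_holomorphic:
  fixes q :: "'a::euclidean_space \<Rightarrow> complex"
  assumes f: "f holomorphic_on S" "open S" and q: "q p \<in> S" "ps_analytic q p"
  shows "ps_analytic (\<lambda>y. f (q y)) p"
proof -
  obtain R where R: "0 < R" "ball (q p) R \<subseteq> S" using f(2) q(1) open_contains_ball by blast
  have fR: "f holomorphic_on ball (q p) R" using f(1) R(2) by (rule holomorphic_on_subset)
  define a where "a n = (deriv ^^ n) f (q p) / fact n" for n
  have a: "(\<lambda>n. a n * (w - q p) ^ n) sums f w" if "w \<in> ball (q p) R" for w
    unfolding a_def by (rule holomorphic_power_series[OF fR that])
  have "q p + of_real (R / 2) \<in> ball (q p) R" using R(1) by (simp add: dist_norm)
  from sums_summable[OF a[OF this]] have "summable (\<lambda>n. a n * of_real (R / 2) ^ n)" by simp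
  then have "summable (\<lambda>n. norm (a n * of_real (R / 4) ^ n))"
    by (rule powser_insidea) (use R in auto)
  then have s: "summable (\<lambda>n. norm (a n) * (R / 4) ^ n)"
    using R(1) by (simp add: norm_mult norm_power norm_divide)
  have "ps_analytic (\<lambda>y. q y - q p) p"
    by (intro ps_analytic_diff q ps_analytic_const)
  then have "eventually (\<lambda>\<rho>. ps_bound p \<rho> (\<lambda>y. q y - q p) (R / 4)) (at_right 0)"
    by (rule ps_analytic_small) (use R in auto)
  then have "eventually (\<lambda>\<rho>. 0 < \<rho> \<and> ps_bound p \<rho> (\<lambda>y. q y - q p) (R / 4)) (at_right 0)"
    using eventually_at_right_less[of "0::real"] by eventually_elim auto
  then obtain \<rho> where \<rho>: "0 < \<rho>" "ps_bound p \<rho> (\<lambda>y. q y - q p) (R / 4)"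
    using eventually_happens'[OF trivial_limit_at_right_real] by blast
  have "\<exists>L. ps_bound p \<rho> (\<lambda>y. f (q y)) L"
  proof (rule ps_bound_powser[OF \<rho> s a])
    fix y assume "y \<in> cube p \<rho>"
    from norm_le_ps_bound[OF \<rho>(2) this] show "q y \<in> ball (q p) R"
      using R(1) by (simp add: dist_norm norm_minus_commute)
  qed
  with \<rho>(1) show ?thesis by (auto intro: ps_analyticI)
qed

lemma ps_analytic_of_real: "ps_analytic f p \<Longrightarrow> ps_analytic (\<lambda>y. complex_of_real (f y)) p"
  by (rule ps_analytic_linear[OF bounded_linear_of_real])

lemma ps_analytic_inverse:
  fixes f :: "'a::euclidean_space \<Rightarrow> real"
  assumes "ps_analytic f p" "f p \<noteq> 0"
  shows "ps_analytic (\<lambda>y. inverse (f y)) p"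
proof -
  have "ps_analytic (\<lambda>y. inverse (complex_of_real (f y))) p"
    by (rule ps_analytic_holomorphic[of _ "- {0}"])
       (use assms in \<open>auto intro!: holomorphic_intros ps_analytic_of_real\<close>)
  from ps_analytic_linear[OF bounded_linear_Re this] show ?thesis
    by (simp flip: of_real_inverse)
qed

text \<open>The principal branch is holomorphic off the nonpositive reals; near p the values of f
  stay positive, and there its real part is the real square root.\<close>

lemma ps_analytic_sqrt:
  fixes f :: "'a::euclidean_space \<Rightarrow> real"
  assumes "ps_analytic f p" "0 < f p"
  shows "ps_analytic (\<lambda>y. sqrt (f y)) p"
proof -
  have "ps_analytic (\<lambda>y. csqrt (complex_of_real (f y))) p"
    by (rule ps_analytic_holomorphic[of _ "- \<real>\<^sub>\<le>\<^sub>0"])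
       (use assms in \<open>auto intro!: holomorphic_on_csqrt ps_analytic_of_real\<close>)
  from ps_analytic_linear[OF bounded_linear_Re this] have "ps_analytic (\<lambda>y. Re (csqrt (complex_of_real (f y)))) p" .
  moreover have "eventually (\<lambda>y. 0 < f y) (nhds p)"
    using differentiable_imp_continuous_within[OF ps_analytic_differentiable[OF assms(1)]] assms(2)
    by (intro order_tendstoD(1)[OF _ assms(2)]) (simp add: isCont_def tendsto_at_iff_tendsto_nhds)
  then have "eventually (\<lambda>y. Re (csqrt (complex_of_real (f y))) = sqrt (f y)) (nhds p)"
    by eventually_elim simp
  ultimately show ?thesis by (rule ps_analytic_cong)
qed

section \<open>Expansion in x and y^2 at a point of the axis\<close>

text \<open>\<open>re_pow n s (y\<^sup>2)\<close> and \<open>y * im_pow n s (y\<^sup>2)\<close> are the real and imaginary parts of \<open>(s + i y) ^ n\<close>.\<close>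
fun re_pow im_pow :: "nat \<Rightarrow> real \<Rightarrow> real \<Rightarrow> real" where
  "re_pow 0 s t = 1"
| "im_pow 0 s t = 0"
| "re_pow (Suc n) s t = s * re_pow n s t - t * im_pow n s t"
| "im_pow (Suc n) s t = s * im_pow n s t + re_pow n s t"

text \<open>The polynomial \<open>(im_pow (n + 1) s t / (n + 1) - re_pow n s t) / t\<close>.\<close>
fun odd_pow :: "nat \<Rightarrow> real \<Rightarrow> real \<Rightarrow> real" where
  "odd_pow 0 s t = 0"
| "odd_pow (Suc n) s t = (real n + 1) / (real n + 2) * (s * odd_pow n s t + im_pow n s t)"

lemma Complex_power: "Complex s y ^ n = Complex (re_pow n s (y\<^sup>2)) (y * im_pow n s (y\<^sup>2))"
  by (induction n) (auto simp: complex_eq_iff power2_eq_square algebra_simps)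

text \<open>At t = 0 the right side is s^n - s^n, so it is divisible by t; the recursion of
  \<open>odd_pow\<close> is the one satisfied by the quotient.\<close>

lemma odd_pow_eq: "t * odd_pow n s t = im_pow (Suc n) s t / (real n + 1) - re_pow n s t"
proof (induction n)
  case (Suc n)
  have *: "(m + 1) / (m + 2) * (s * (p / (m + 1) - q) + t * r) = (s * p + (s * q - t * r)) / (m + 2) - (s * q - t * r)"
    if "0 \<le> m" for m p q r :: real
  proof -
    have "m + 1 \<noteq> 0" "m + 2 \<noteq> 0" using that by auto
    then show ?thesis by (simp add: divide_simps) (simp add: algebra_simps)
  qed
  have "t * odd_pow (Suc n) s t = (real n + 1) / (real n + 2) * (s * (t * odd_pow n s t) + t * im_pow n s t)"
    by (simp add: add_divide_distrib algebra_simps)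
  also have "\<dots> = (s * im_pow (Suc n) s t + re_pow (Suc n) s t) / (real n + 2) - re_pow (Suc n) s t"
    unfolding Suc re_pow.simps(2) by (rule *) simp
  also have "\<dots> = im_pow (Suc (Suc n)) s t / (real (Suc n) + 1) - re_pow (Suc n) s t"
    unfolding im_pow.simps(2)[of "Suc n"] by simp
  finally show ?case .
qed simp

context
  fixes x0 \<sigma> :: real
  assumes \<sigma>: "0 < \<sigma>" "\<sigma> \<le> 1"
begin

lemma ps_bound_fst: "ps_bound (x0, 0::real) (\<sigma>\<^sup>2) (\<lambda>p. fst p - x0) (\<sigma>\<^sup>2)"
  using ps_bound_coord[of "(1::real, 0::real)" "(x0, 0)" "\<sigma>\<^sup>2"] by (simp add: Basis_prod_def inner_prod_def)

lemma ps_bound_snd: "ps_bound (x0, 0::real) (\<sigma>\<^sup>2) (\<lambda>p. snd p) (\<sigma>\<^sup>2)"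
  using ps_bound_coord[of "(0::real, 1::real)" "(x0, 0)" "\<sigma>\<^sup>2"] by (simp add: Basis_prod_def inner_prod_def)

text \<open>If s and y are of size \<sigma>, then (s + i y)^n is at most (2 \<sigma>)^n, and
  dividing the imaginary part by y loses one factor \<sigma>. As t stands for y^2 and a cube has one
  half-width, both s and t get \<sigma>^2; since \<sigma> \<le> 1, this is at most \<sigma>. The two
  bounds are proved together because the recursions are coupled.\<close>

lemma ps_bound_re_im_pow:
  "ps_bound (x0, 0) (\<sigma>\<^sup>2) (\<lambda>p. re_pow n (fst p - x0) (snd p)) ((2 * \<sigma>) ^ n) \<and>
   ps_bound (x0, 0) (\<sigma>\<^sup>2) (\<lambda>p. im_pow n (fst p - x0) (snd p)) ((2 * \<sigma>) ^ n / \<sigma>)"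
proof (induction n)
  case 0
  show ?case
    using ps_bound_const[of "(x0, 0::real)" "\<sigma>\<^sup>2" "1::real"] ps_bound_const[of "(x0, 0::real)" "\<sigma>\<^sup>2" "0::real"] \<sigma>
    by (auto elim: ps_bound_mono)
next
  case (Suc n)
  note IH = Suc[THEN conjunct1] Suc[THEN conjunct2]
  have s2: "0 < \<sigma>\<^sup>2" using \<sigma> by simp
  have le: "\<sigma>\<^sup>2 \<le> \<sigma>" using \<sigma> by (simp add: power2_eq_square mult_le_one)
  have 1: "ps_bound (x0, 0) (\<sigma>\<^sup>2) (\<lambda>p. - (snd p * im_pow n (fst p - x0) (snd p))) (1 * (\<sigma>\<^sup>2 * ((2 * \<sigma>) ^ n / \<sigma>)))"
    using ps_bound_linear[OF ps_bound_mult[OF s2 ps_bound_snd IH(2)] bounded_linear_minus[OF bounded_linear_ident], of 1] s2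
    by simp
  have "ps_bound (x0, 0) (\<sigma>\<^sup>2) (\<lambda>p. re_pow (Suc n) (fst p - x0) (snd p))
     (\<sigma>\<^sup>2 * (2 * \<sigma>) ^ n + 1 * (\<sigma>\<^sup>2 * ((2 * \<sigma>) ^ n / \<sigma>)))"
    using ps_bound_add[OF s2 ps_bound_mult[OF s2 ps_bound_fst IH(1)] 1] by simp
  moreover have "\<sigma>\<^sup>2 * (2 * \<sigma>) ^ n + 1 * (\<sigma>\<^sup>2 * ((2 * \<sigma>) ^ n / \<sigma>)) \<le> (2 * \<sigma>) ^ Suc n"
    using mult_right_mono[OF le, of "(2 * \<sigma>) ^ n"] \<sigma> by (simp add: power2_eq_square)
  moreover have "ps_bound (x0, 0) (\<sigma>\<^sup>2) (\<lambda>p. im_pow (Suc n) (fst p - x0) (snd p))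
     (\<sigma>\<^sup>2 * ((2 * \<sigma>) ^ n / \<sigma>) + (2 * \<sigma>) ^ n)"
    using ps_bound_add[OF s2 ps_bound_mult[OF s2 ps_bound_fst IH(2)] IH(1)] by simp
  moreover have "\<sigma>\<^sup>2 * ((2 * \<sigma>) ^ n / \<sigma>) + (2 * \<sigma>) ^ n \<le> (2 * \<sigma>) ^ Suc n / \<sigma>"
    using mult_right_mono[OF \<sigma>(2), of "(2 * \<sigma>) ^ n"] \<sigma> by (simp add: power2_eq_square)
  ultimately show ?case by (blast intro: ps_bound_mono)
qed

text \<open>Dividing by t costs the factor 1 / \<sigma>^2. The rational factor in the recursion is
  below 1, and 1 + 1 / \<sigma> \<le> 2 / \<sigma> because \<sigma> \<le> 1.\<close>

lemma ps_bound_odd_pow: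
  "ps_bound (x0, 0) (\<sigma>\<^sup>2) (\<lambda>p. odd_pow n (fst p - x0) (snd p)) ((2 * \<sigma>) ^ n / \<sigma>\<^sup>2)"
proof (induction n)
  case 0
  show ?case
    using ps_bound_const[of "(x0, 0::real)" "\<sigma>\<^sup>2" "0::real"] \<sigma> by (auto elim: ps_bound_mono)
next
  case (Suc n)
  let ?q = "(real n + 1) / (real n + 2)"
  have s2: "0 < \<sigma>\<^sup>2" using \<sigma> by simp
  have "ps_bound (x0, 0) (\<sigma>\<^sup>2) (\<lambda>p. odd_pow (Suc n) (fst p - x0) (snd p))
     (norm ?q * (\<sigma>\<^sup>2 * ((2 * \<sigma>) ^ n / \<sigma>\<^sup>2) + (2 * \<sigma>) ^ n / \<sigma>))"
    unfolding odd_pow.simps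
    by (intro ps_bound_mult ps_bound_const ps_bound_add ps_bound_fst Suc ps_bound_re_im_pow[THEN conjunct2] s2)
  moreover have "norm ?q * (\<sigma>\<^sup>2 * ((2 * \<sigma>) ^ n / \<sigma>\<^sup>2) + (2 * \<sigma>) ^ n / \<sigma>) \<le> (2 * \<sigma>) ^ Suc n / \<sigma>\<^sup>2"
  proof -
    have "norm ?q * (\<sigma>\<^sup>2 * ((2 * \<sigma>) ^ n / \<sigma>\<^sup>2) + (2 * \<sigma>) ^ n / \<sigma>)
       \<le> 1 * (\<sigma>\<^sup>2 * ((2 * \<sigma>) ^ n / \<sigma>\<^sup>2) + (2 * \<sigma>) ^ n / \<sigma>)"
      using \<sigma> by (intro mult_right_mono) auto
    also have "\<dots> = (2 * \<sigma>) ^ n * (1 + 1 / \<sigma>)" using \<sigma> by (simp add: distrib_left)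
    also have "\<dots> \<le> (2 * \<sigma>) ^ n * (2 / \<sigma>)"
      using \<sigma> by (intro mult_left_mono) (auto simp: field_simps)
    also have "\<dots> = (2 * \<sigma>) ^ Suc n / \<sigma>\<^sup>2" using \<sigma> by (simp add: power2_eq_square)
    finally show ?thesis .
  qed
  ultimately show ?case by (rule ps_bound_mono)
qed

end

lemma ps_bound_suminf:
  fixes f :: "nat \<Rightarrow> 'a::euclidean_space \<Rightarrow> 'b::banach"
  assumes r: "0 < r" and f: "\<And>n. ps_bound x r (f n) (K n)" and K: "summable K"
  shows "ps_bound x r (\<lambda>y. \<Sum>n. f n y) (\<Sum>n. K n)"
proof (rule ps_bound_has_sum[OF r f])
  have "0 \<le> K n" for n using ps_bound_nonneg[OF f] r by simp
  then show "(K has_sum (\<Sum>n. K n)) UNIV"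
    using K by (intro norm_summable_imp_has_sum) (auto simp: summable_sums)
  fix y assume y: "y \<in> cube x r"
  have "summable (\<lambda>n. norm (f n y))"
    by (rule summable_comparison_test'[OF K, of 0]) (use norm_le_ps_bound[OF f y] in auto)
  then show "((\<lambda>n. f n y) has_sum (\<Sum>n. f n y)) UNIV"
    by (intro norm_summable_imp_has_sum) (auto intro: summable_sums summable_norm_cancel)
qed

text \<open>As u is even and v is odd in y, the identities at w and at its conjugate w' combine to 2
  y u = Im (g'(w) - g'(w')) and 2 y^2 v = Im (g(w) - g(w')) - y Re (g'(w) + g'(w')). Around a real
  centre only the real parts \<open>r n\<close> of the Taylor coefficients of g' survive in these
  combinations, and u, v / y become the series with terms
  \<open>r n * im_pow n s (y\<^sup>2)\<close> and
  \<open>r n * odd_pow n s (y\<^sup>2)\<close>.\<close>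

lemma axis_expansion:
  fixes u v :: "real \<times> real \<Rightarrow> real" and x0 R :: real
  assumes R: "0 < R" and enc: "encodes_solution g u v (ball (of_real x0) R)"
    and sym: "\<And>x y. Complex x y \<in> ball (of_real x0) R \<Longrightarrow> u (x, - y) = u (x, y) \<and> v (x, - y) = - v (x, y)"
  obtains \<rho> H1 K1 H2 K2 where "0 < \<rho>" "ps_bound (x0, 0) \<rho> H1 K1" "ps_bound (x0, 0) \<rho> H2 K2"
    "\<And>x y. \<bar>x - x0\<bar> \<le> \<rho> \<Longrightarrow> y\<^sup>2 \<le> \<rho> \<Longrightarrow> y \<noteq> 0 \<Longrightarrow> u (x, y) = H1 (x, y\<^sup>2) \<and> v (x, y) = y * H2 (x, y\<^sup>2)"
proof -
  note g = encodes_solutionD(1)[OF enc] and u = encodes_solutionD(2)[OF enc] and v = encodes_solutionD(3)[OF enc]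
  define z0 where "z0 = complex_of_real x0"
  \<comment> \<open>The bounds on the polynomials grow like (2 \<sigma>)^n; with 3 \<sigma> < R the
    disc contains a point beyond 2 \<sigma>, which makes the coefficients absolutely summable
    against this growth.\<close>
  define \<sigma> where "\<sigma> = min 1 (R / 4)"
  have \<sigma>: "0 < \<sigma>" "\<sigma> \<le> 1" "3 * \<sigma> < R" using R by (auto simp: \<sigma>_def)
  have s2: "0 < \<sigma>\<^sup>2" using \<sigma> by simp
  have g': "deriv g holomorphic_on ball z0 R" using g by (simp add: z0_def holomorphic_deriv)
  define A where "A n = (deriv ^^ n) g z0 / fact n" for n
  define a where "a n = (deriv ^^ n) (deriv g) z0 / fact n" for n
  have aA: "A (Suc n) = a n / of_nat (Suc n)" for n
    unfolding A_def a_def funpow_Suc_right o_def by (simp add: field_simps)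
  have A: "(\<lambda>n. A n * (w - z0) ^ n) sums g w" if "w \<in> ball z0 R" for w
    unfolding A_def using holomorphic_power_series[OF g] that by (simp add: z0_def)
  have a: "(\<lambda>n. a n * (w - z0) ^ n) sums deriv g w" if "w \<in> ball z0 R" for w
    unfolding a_def by (rule holomorphic_power_series[OF g' that])
  have "z0 + of_real (3 * \<sigma>) \<in> ball z0 R" using \<sigma> by (simp add: dist_norm)
  from sums_summable[OF a[OF this]] have "summable (\<lambda>n. a n * of_real (3 * \<sigma>) ^ n)" by simp
  then have "summable (\<lambda>n. norm (a n * of_real (2 * \<sigma>) ^ n))"
    by (rule powser_insidea) (use \<sigma> in auto)
  then have sa: "summable (\<lambda>n. norm (a n) * (2 * \<sigma>) ^ n)"
    using \<sigma>(1) by (simp add: norm_mult norm_power)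
  define r where "r n = Re (a n)" for n
  have sr: "summable (\<lambda>n. norm (r n) * (2 * \<sigma>) ^ n)"
    by (rule summable_comparison_test'[OF sa, of 0])
       (use \<sigma> abs_Re_le_cmod in \<open>auto simp: r_def abs_mult intro!: mult_right_mono\<close>)
  have s1: "summable (\<lambda>n. norm (r n) * ((2 * \<sigma>) ^ n / \<sigma>))"
    and s2': "summable (\<lambda>n. norm (r n) * ((2 * \<sigma>) ^ n / \<sigma>\<^sup>2))"
    using summable_divide[OF sr, of \<sigma>] summable_divide[OF sr, of "\<sigma>\<^sup>2"] by simp_all
  define H1 where "H1 p = (\<Sum>n. r n * im_pow n (fst p - x0) (snd p))" for p
  define H2 where "H2 p = (\<Sum>n. r n * odd_pow n (fst p - x0) (snd p))" for p
  have H1: "ps_bound (x0, 0) (\<sigma>\<^sup>2) H1 (\<Sum>n. norm (r n) * ((2 * \<sigma>) ^ n / \<sigma>))"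
    unfolding H1_def[abs_def]
    by (intro ps_bound_suminf ps_bound_mult ps_bound_const ps_bound_re_im_pow[THEN conjunct2] s1 s2 \<sigma>)
  have H2: "ps_bound (x0, 0) (\<sigma>\<^sup>2) H2 (\<Sum>n. norm (r n) * ((2 * \<sigma>) ^ n / \<sigma>\<^sup>2))"
    unfolding H2_def[abs_def]
    by (intro ps_bound_suminf ps_bound_mult ps_bound_const ps_bound_odd_pow s2' s2 \<sigma>)
  show ?thesis
  proof (rule that[OF s2 H1 H2])
    fix x y assume xy: "\<bar>x - x0\<bar> \<le> \<sigma>\<^sup>2" "y\<^sup>2 \<le> \<sigma>\<^sup>2" "y \<noteq> 0"
    define s where "s = x - x0"
    let ?w = "Complex x y" and ?w' = "Complex x (-y)" and ?W = "Complex s y" and ?W' = "Complex s (-y)"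
    have "\<bar>y\<bar> \<le> \<sigma>" using xy(2) \<sigma>(1) by (simp add: abs_le_square_iff[symmetric])
    moreover have "\<bar>s\<bar> \<le> \<sigma>" using xy(1) \<sigma> by (simp add: s_def power2_eq_square mult_le_one order.trans)
    ultimately have "\<bar>s\<bar> + \<bar>y\<bar> < R" using \<sigma> by linarith
    then have "cmod ?W < R" "cmod ?W' < R"
      using cmod_le[of "?W"] cmod_le[of "?W'"] by auto
    moreover have W: "?w - z0 = ?W" "?w' - z0 = ?W'"
      by (auto simp: z0_def s_def complex_eq_iff)
    ultimately have w: "?w \<in> ball z0 R" "?w' \<in> ball z0 R"
      by (simp_all add: dist_norm norm_minus_commute[of z0] W)
    note pw = Complex_power[of s y] Complex_power[of s "-y"]
    have a1: "(\<lambda>n. a n * ?W ^ n) sums deriv g ?w" using a[OF w(1)] by (simp add: W)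
    have a2: "(\<lambda>n. a n * ?W' ^ n) sums deriv g ?w'" using a[OF w(2)] by (simp add: W)
    have A1: "(\<lambda>n. A n * ?W ^ n) sums g ?w" using A[OF w(1)] by (simp add: W)
    have A2: "(\<lambda>n. A n * ?W' ^ n) sums g ?w'" using A[OF w(2)] by (simp add: W)
    have sy: "u (x, - y) = u (x, y)" "v (x, - y) = - v (x, y)" using sym[of x y] w by (auto simp: z0_def)
    have u1: "y * u (x, y) = Im (deriv g ?w)" "- y * u (x, y) = Im (deriv g ?w')"
      using u[of x y] u[of x "-y"] w sy by (simp_all add: z0_def)
    have v1: "y\<^sup>2 * v (x, y) = Im (g ?w) - y * Re (deriv g ?w)"
      "- y\<^sup>2 * v (x, y) = Im (g ?w') + y * Re (deriv g ?w')"
      using v[of x y] v[of x "-y"] w sy by (simp_all add: z0_def)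
    have "(\<lambda>n. (Im (a n * ?W ^ n) - Im (a n * ?W' ^ n)) / (2 * y)) sums
        ((Im (deriv g ?w) - Im (deriv g ?w')) / (2 * y))"
      by (intro sums_divide sums_diff sums_Im a1 a2)
    moreover have "(Im (deriv g ?w) - Im (deriv g ?w')) / (2 * y) = u (x, y)"
      using xy(3) by (simp flip: u1)
    moreover have "(Im (a n * ?W ^ n) - Im (a n * ?W' ^ n)) / (2 * y)
        = r n * im_pow n s (y\<^sup>2)" for n
      unfolding pw using xy(3) by (simp add: r_def field_simps)
    ultimately have "(\<lambda>n. r n * im_pow n s (y\<^sup>2)) sums u (x, y)" by simp
    then have 1: "u (x, y) = H1 (x, y\<^sup>2)"
      unfolding H1_def s_def by (simp add: sums_iff)
    have "(\<lambda>n. Im (A n * ?W ^ n) - Im (A n * ?W' ^ n)) sums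
        (Im (g ?w) - Im (g ?w'))"
      by (intro sums_diff sums_Im A1 A2)
    \<comment> \<open>The constant term cancels, so the series of g can be shifted by one and runs
      parallel to that of g', with \<open>A (Suc n)\<close> equal to \<open>a n\<close> divided by n
      + 1.\<close>
    moreover have "Im (A 0 * ?W ^ 0) - Im (A 0 * ?W' ^ 0) = 0" by simp
    ultimately have A3: "(\<lambda>n. Im (A (Suc n) * ?W ^ Suc n) - Im (A (Suc n) * ?W' ^ Suc n)) sums
        (Im (g ?w) - Im (g ?w'))"
      by (subst sums_Suc_iff) simp
    \<comment> \<open>The divisor 2 y^3 removes the factor y common to all terms and the y^2 that
      \<open>odd_pow_eq\<close> provides; the sum becomes v / y.\<close>
    have "(\<lambda>n. ((Im (A (Suc n) * ?W ^ Suc n) - Im (A (Suc n) * ?W' ^ Suc n))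
          - y * (Re (a n * ?W ^ n) + Re (a n * ?W' ^ n))) / (2 * y ^ 3)) sums
        (((Im (g ?w) - Im (g ?w')) -
           y * (Re (deriv g ?w) + Re (deriv g ?w'))) / (2 * y ^ 3))"
      by (intro sums_divide sums_diff[OF A3] sums_mult sums_add sums_Re a1 a2)
    moreover have "((Im (g ?w) - Im (g ?w')) -
           y * (Re (deriv g ?w) + Re (deriv g ?w'))) / (2 * y ^ 3) = v (x, y) / y"
    proof -
      have "(Im (g ?w) - Im (g ?w')) -
           y * (Re (deriv g ?w) + Re (deriv g ?w')) = 2 * y\<^sup>2 * v (x, y)"
        using v1 by (simp add: algebra_simps)
      then show ?thesis using xy(3) by (simp add: power2_eq_square power3_eq_cube)
    qed
    moreover have "((Im (A (Suc n) * ?W ^ Suc n) - Im (A (Suc n) * ?W' ^ Suc n))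
          - y * (Re (a n * ?W ^ n) + Re (a n * ?W' ^ n))) / (2 * y ^ 3)
        = r n * odd_pow n s (y\<^sup>2)" for n
    proof -
      have "Re (A (Suc n)) = r n / (real n + 1)" by (simp add: aA r_def add.commute)
      then have "Im (A (Suc n) * ?W ^ Suc n) - Im (A (Suc n) * ?W' ^ Suc n)
          = 2 * y * (r n * (im_pow (Suc n) s (y\<^sup>2) / (real n + 1)))"
        unfolding pw complex.sel times_complex.sel by (simp add: algebra_simps del: im_pow.simps re_pow.simps)
      moreover have "Re (a n * ?W ^ n) + Re (a n * ?W' ^ n) = 2 * r n * re_pow n s (y\<^sup>2)"
        unfolding pw by (simp add: r_def)
      ultimately have "(Im (A (Suc n) * ?W ^ Suc n) - Im (A (Suc n) * ?W' ^ Suc n))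
          - y * (Re (a n * ?W ^ n) + Re (a n * ?W' ^ n))
          = 2 * y * r n * (im_pow (Suc n) s (y\<^sup>2) / (real n + 1) - re_pow n s (y\<^sup>2))"
        by (simp only:) (simp only: algebra_simps)
      also have "\<dots> = 2 * y * r n * (y\<^sup>2 * odd_pow n s (y\<^sup>2))" unfolding odd_pow_eq ..
      finally show ?thesis using xy(3) by (simp add: power2_eq_square power3_eq_cube)
    qed
    ultimately have "(\<lambda>n. r n * odd_pow n s (y\<^sup>2)) sums (v (x, y) / y)" by simp
    then have "v (x, y) / y = H2 (x, y\<^sup>2)"
      unfolding H2_def s_def by (simp add: sums_iff)
    with 1 xy(3) show "u (x, y) = H1 (x, y\<^sup>2) \<and> v (x, y) = y * H2 (x, y\<^sup>2)" by (auto simp: field_simps)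
  qed
qed

section \<open>Continuation across the axis\<close>

text \<open>Identity theorem with information on one side only: the difference of the series
  vanishes on an interval to the right of 0, hence also at 0 by continuity, and a nonzero power
  series has isolated zeros.\<close>

lemma powser_eqI_right:
  fixes e e' :: "nat \<Rightarrow> real"
  assumes \<delta>: "0 < \<delta>" and eq: "\<And>\<tau>. 0 < \<tau> \<Longrightarrow> \<tau> < \<delta> \<Longrightarrow> (\<lambda>k. e k * \<tau> ^ k) sums G \<tau> \<and> (\<lambda>k. e' k * \<tau> ^ k) sums G \<tau>"
  shows "e = e'"
proof (rule ccontr)
  assume "e \<noteq> e'"
  define d where "d k = e k - e' k" for k
  have d0: "(\<lambda>k. d k * \<tau> ^ k) sums 0" if "0 < \<tau>" "\<tau> < \<delta>" for \<tau>
    using sums_diff[OF conjunct1 conjunct2, OF eq eq, OF that that] by (simp add: d_def algebra_simps)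
  define F where "F x = (\<Sum>k. d k * x ^ k)" for x
  have F: "(\<lambda>k. d k * (x - 0) ^ k) sums F x" if "norm (x - 0) < \<delta> / 2" for x
  proof -
    have "summable (\<lambda>k. d k * x ^ k)"
      by (rule powser_inside[OF sums_summable[OF d0[of "\<delta> / 2"]]]) (use that \<delta> in auto)
    then show ?thesis by (simp add: F_def summable_sums)
  qed
  have F0: "F \<tau> = 0" if "0 < \<tau>" "\<tau> < \<delta>" for \<tau>
    unfolding F_def using d0[OF that] by (simp add: sums_iff)
  have "(F \<longlongrightarrow> d 0) (at 0)"
    by (rule powser_limit_0[of "\<delta> / 2"]) (use \<delta> F in auto)
  then have "(F \<longlongrightarrow> d 0) (at_right 0)"
    by (rule filterlim_mono) (auto simp: at_within_le_at)
  moreover have "eventually (\<lambda>\<tau>. F \<tau> = 0) (at_right 0)"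
    using eventually_at_right_real[OF \<delta>] by eventually_elim (auto intro: F0)
  then have "(F \<longlongrightarrow> 0) (at_right 0)" by (simp add: tendsto_eventually)
  ultimately have "d 0 = 0" by (rule tendsto_unique[OF trivial_limit_at_right_real])
  then have "F 0 = 0" by (simp add: F_def)
  obtain m where m: "d m \<noteq> 0" using \<open>e \<noteq> e'\<close> by (auto simp: d_def)
  with \<open>d 0 = 0\<close> have "m > 0" using gr0I by metis
  obtain s where s: "0 < s" "\<And>z. z \<in> cball 0 s - {0} \<Longrightarrow> F z \<noteq> 0"
    using powser_0_nonzero[of "\<delta> / 2" 0 d F m] F \<delta> \<open>F 0 = 0\<close> m \<open>m > 0\<close> by auto
  have "F (min s (\<delta> / 2)) \<noteq> 0" using s \<delta> by (intro s(2)) auto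
  moreover have "0 < min s (\<delta> / 2)" "min s (\<delta> / 2) < \<delta>" using s(1) \<delta> by linarith+
  ultimately show False using F0 by blast
qed

text \<open>At fixed x, grouping the double series by the exponent of the second variable leaves one
  power series in t, with coefficients independent of t and valid also for t \<le> 0.\<close>

lemma ps_bound_restrict_snd:
  fixes A :: "real \<times> real \<Rightarrow> real"
  assumes A: "ps_bound (x0, 0) \<rho> A K" and \<rho>: "0 < \<rho>" and x: "\<bar>x - x0\<bar> \<le> \<rho>"
  obtains e where "\<And>t. \<bar>t\<bar> \<le> \<rho> \<Longrightarrow> (\<lambda>k. e k * t ^ k) sums A (x, t)"
proof -
  obtain c S where c': "ps_expansion (x0, 0) \<rho> A c S" "S \<le> K"
    by (rule ps_boundE[OF A])
  note c = ps_expansionD(1)[OF c'(1)] c'(2) ps_expansionD(2)[OF c'(1)]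
  have mp: "mpow \<alpha> (p, q) = p ^ \<alpha> (1, 0) * q ^ \<alpha> (0, 1)" for \<alpha> :: "real \<times> real \<Rightarrow> nat" and p q
    by (simp add: mpow_def Basis_prod_def)
  define b :: "real \<times> real" where "b = (0, 1)"
  define m where "m \<alpha> = (x - x0) ^ \<alpha> (1, 0) * c \<alpha>" for \<alpha> :: "real \<times> real \<Rightarrow> nat"
  have s: "((\<lambda>\<alpha>. m \<alpha> * t ^ \<alpha> b) has_sum A (x, t)) midx" if "\<bar>t\<bar> \<le> \<rho>" for t
  proof -
    have "(x, t) \<in> cube (x0, 0) \<rho>" using x that by (auto simp: cube_def Basis_prod_def)
    from c(3)[OF this] show ?thesis by (simp add: mp m_def b_def mult_ac)
  qed
  define L where "L k = {\<alpha> \<in> midx. \<alpha> b = k}" for k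
  define e where "e k = infsum m (L k)" for k
  have e: "(m has_sum e k) (L k)" for k
  proof -
    have "(\<lambda>\<alpha>. m \<alpha> * \<rho> ^ \<alpha> b) summable_on L k"
      using summable_on_subset_banach[OF has_sum_imp_summable[OF s[of \<rho>]], of "L k"] \<rho> by (auto simp: L_def)
    moreover have "(\<lambda>\<alpha>. m \<alpha> * \<rho> ^ \<alpha> b) summable_on L k \<longleftrightarrow> (\<lambda>\<alpha>. m \<alpha> * \<rho> ^ k) summable_on L k"
      by (rule summable_on_cong) (simp add: L_def)
    ultimately have "(\<lambda>\<alpha>. m \<alpha> * \<rho> ^ k) summable_on L k" by blast
    \<comment> \<open>On the level set \<open>L k\<close> the factor \<rho>^k is constant and can be
      divided out, which gives summability of the bare coefficients.\<close>
    then have "(\<lambda>\<alpha>. m \<alpha> * \<rho> ^ k * (1 / \<rho> ^ k)) summable_on L k"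
      by (rule summable_on_cmult_left)
    then show ?thesis unfolding e_def using \<rho> by (intro has_sum_infsum) simp
  qed
  have bij: "bij_betw snd (Sigma UNIV L) midx"
    by (rule bij_betwI[of _ _ _ "\<lambda>\<alpha>. (\<alpha> b, \<alpha>)"]) (auto simp: L_def)
  show ?thesis
  proof (rule that[of e])
    fix t assume t: "\<bar>t\<bar> \<le> \<rho>"
    have "((\<lambda>p. m (snd p) * t ^ (snd p) b) has_sum A (x, t)) (Sigma UNIV L)"
      using s[OF t] has_sum_reindex_bij_betw[OF bij, of "\<lambda>\<alpha>. m \<alpha> * t ^ \<alpha> b"] by simp
    moreover have "((\<lambda>\<alpha>. m (snd (k, \<alpha>)) * t ^ (snd (k, \<alpha>)) b) has_sum e k * t ^ k) (L k)" for k
    proof -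
      have "((\<lambda>\<alpha>. m \<alpha> * t ^ k) has_sum e k * t ^ k) (L k)" by (rule has_sum_cmult_left[OF e])
      then show ?thesis by (rule has_sum_cong[THEN iffD1, rotated]) (simp add: L_def)
    qed
    ultimately have "((\<lambda>k. e k * t ^ k) has_sum A (x, t)) UNIV"
      by (rule has_sum_SigmaD)
    then show "(\<lambda>k. e k * t ^ k) sums A (x, t)" by (rule has_sum_imp_sums)
  qed
qed

text \<open>Below the axis the local expansions agree because each is determined, line by line, by its values at \<open>t > 0\<close>.\<close>
lemma ps_analytic_extension_across_axis:
  fixes G :: "real \<times> real \<Rightarrow> real"
  assumes S: "open S" "\<And>p. p \<in> S \<Longrightarrow> 0 < snd p" "\<And>p. p \<in> S \<Longrightarrow> ps_analytic G p"
    and X: "\<And>x0. x0 \<in> X \<Longrightarrow> \<exists>\<rho>>0. \<exists>A K. ps_bound (x0, 0) \<rho> A K \<and>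
        (\<forall>x t. \<bar>x - x0\<bar> \<le> \<rho> \<longrightarrow> 0 < t \<longrightarrow> t \<le> \<rho> \<longrightarrow> A (x, t) = G (x, t))"
  obtains T H where "open T" "S \<subseteq> T" "X \<times> {0} \<subseteq> T" "\<And>p. p \<in> T \<Longrightarrow> ps_analytic H p"
    "\<And>p. 0 < snd p \<Longrightarrow> H p = G p"
proof -
  \<comment> \<open>\<open>Q x t y\<close> says that y is the value at t of some power series that
    represents \<open>G\<close> on the line through x for small positive arguments. No centre x0
    occurs in it, so expansions at different centres are compared through the same
    predicate.\<close>
  define Q where "Q x t y \<longleftrightarrow> (\<exists>e \<delta>. 0 < \<delta> \<and> (\<forall>\<tau>. 0 < \<tau> \<longrightarrow> \<tau> < \<delta> \<longrightarrow> (\<lambda>k. e k * \<tau> ^ k) sums G (x, \<tau>)) \<and>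
      (\<lambda>k. e k * t ^ k) sums y)" for x t y :: real
  \<comment> \<open>Where no such series exists the value for t \<le> 0 is arbitrary. This is
    harmless: only analyticity on \<open>T\<close> and the values for t > 0 are claimed.\<close>
  define H where "H p = (if 0 < snd p then G p else (THE y. Q (fst p) (snd p) y))" for p
  have uniq: "y = y'" if Qs: "Q x t y" "Q x t y'" for x t y y'
  proof -
    obtain e \<delta> where e: "0 < \<delta>" "\<And>\<tau>. 0 < \<tau> \<Longrightarrow> \<tau> < \<delta> \<Longrightarrow> (\<lambda>k. e k * \<tau> ^ k) sums G (x, \<tau>)"
      "(\<lambda>k. e k * t ^ k) sums y" using Qs(1) unfolding Q_def by blast
    obtain e' \<delta>' where e': "0 < \<delta>'" "\<And>\<tau>. 0 < \<tau> \<Longrightarrow> \<tau> < \<delta>' \<Longrightarrow> (\<lambda>k. e' k * \<tau> ^ k) sums G (x, \<tau>)"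
      "(\<lambda>k. e' k * t ^ k) sums y'" using Qs(2) unfolding Q_def by blast
    have "e = e'"
      by (rule powser_eqI_right[of "min \<delta> \<delta>'" _ "\<lambda>\<tau>. G (x, \<tau>)"]) (use e e' in auto)
    with e(3) e'(3) show ?thesis using sums_unique2 by blast
  qed
  \<comment> \<open>Taking all points of analyticity makes \<open>T\<close> open at once and avoids
    describing neighbourhoods of the axis points.\<close>
  define T where "T = {p. ps_analytic H p}"
  have "open T"
    unfolding T_def using eventually_ps_analytic by (subst open_subopen) (auto simp: eventually_nhds subset_eq)
  moreover have "S \<subseteq> T"
  proof
    fix p assume p: "p \<in> S"
    have "eventually (\<lambda>y. G y = H y) (nhds p)"
      using eventually_nhds_in_open[OF S(1) p] by eventually_elim (simp add: H_def S(2))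
    with S(3)[OF p] show "p \<in> T" unfolding T_def using ps_analytic_cong by blast
  qed
  moreover have "X \<times> {0} \<subseteq> T"
  proof (clarify)
    fix x0 assume "x0 \<in> X"
    from X[OF this] obtain \<rho> A K where \<rho>: "0 < \<rho>" and A: "ps_bound (x0, 0) \<rho> A K"
      and AG: "\<And>x t. \<bar>x - x0\<bar> \<le> \<rho> \<Longrightarrow> 0 < t \<Longrightarrow> t \<le> \<rho> \<Longrightarrow> A (x, t) = G (x, t)" by blast
    have "ps_bound (x0, 0) \<rho> H K"
    proof (rule ps_bound_cong[OF A])
      fix p :: "real \<times> real" assume p: "p \<in> cube (x0, 0) \<rho>"
      obtain x t where xt: "p = (x, t)" by force
      have b: "\<bar>x - x0\<bar> \<le> \<rho>" "\<bar>t\<bar> \<le> \<rho>" using p by (auto simp: xt cube_def Basis_prod_def)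
      show "A p = H p"
      proof (cases "0 < t")
        case True
        then show ?thesis using AG[OF b(1)] b(2) by (simp add: H_def xt)
      next
        case False
        obtain e where e: "\<And>t. \<bar>t\<bar> \<le> \<rho> \<Longrightarrow> (\<lambda>k. e k * t ^ k) sums A (x, t)"
          using ps_bound_restrict_snd[OF A \<rho> b(1)] by blast
        have "Q x t (A (x, t))"
          unfolding Q_def
        proof (intro exI[of _ e] exI[of _ \<rho>] conjI allI impI \<rho> e b(2))
          fix \<tau> assume \<tau>: "0 < \<tau>" "\<tau> < \<rho>"
          show "(\<lambda>k. e k * \<tau> ^ k) sums G (x, \<tau>)" using e[of \<tau>] AG[OF b(1), of \<tau>] \<tau> by simp
        qed
        then have "(THE y. Q x t y) = A (x, t)" using uniq by blast
        then show ?thesis using False by (simp add: H_def xt)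
      qed
    qed
    with \<rho> show "(x0, 0) \<in> T" by (auto simp: T_def intro: ps_analyticI)
  qed
  ultimately show ?thesis
    by (rule that[of T H]) (auto simp: T_def H_def)
qed

section \<open>Extension of real and vector valued solutions\<close>

text \<open>Over t > 0 the functions \<open>G1\<close> and \<open>G2\<close> are forced and
  analytic; the axis expansions are the hypothesis under which each of them extends. The
  representation is immediate for y > 0 and follows by parity for y < 0; at y = 0 it follows for u
  by continuity and for v because v is odd.\<close>

lemma real_solution_extension:
  fixes u v ux uy vx vy :: "real \<times> real \<Rightarrow> real"
  assumes D: "open D" and sym: "\<And>x y. (x, y) \<in> D \<Longrightarrow> (x, - y) \<in> D"
    and parity: "\<And>x y. (x, y) \<in> D \<Longrightarrow> u (x, - y) = u (x, y) \<and> v (x, - y) = - v (x, y)"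
    and u: "\<And>p. p \<in> D \<Longrightarrow> (u has_derivative (\<lambda>h. fst h * ux p + snd h * uy p)) (at p)"
    and v: "\<And>p. p \<in> D \<Longrightarrow> (v has_derivative (\<lambda>h. fst h * vx p + snd h * vy p)) (at p)"
    and c: "continuous_on D ux" "continuous_on D uy" "continuous_on D vx" "continuous_on D vy"
    and eqs: "\<And>x y. (x, y) \<in> D \<Longrightarrow> y \<noteq> 0 \<Longrightarrow> ux (x, y) - vy (x, y) = 2 / y * v (x, y) \<and> uy (x, y) + vx (x, y) = 0"
  obtains D2 H1 H2 where "open D2" "Dstar D \<subseteq> D2"
    "\<And>p. p \<in> D2 \<Longrightarrow> ps_analytic H1 p" "\<And>p. p \<in> D2 \<Longrightarrow> ps_analytic H2 p"
    "\<And>x y. (x, y) \<in> D \<Longrightarrow> u (x, y) = H1 (x, y\<^sup>2) \<and> v (x, y) = y * H2 (x, y\<^sup>2)"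
proof -
  have curl: "uy p = - vx p" if p: "p \<in> D" for p
  proof -
    obtain x y where xy: "p = (x, y)" by force
    show ?thesis
    proof (cases "y = 0")
      case True
      have "uy (x, 0) = - vx (x, 0)"
      proof (rule eq_at_axis_by_continuity[OF D c(2), where g = "\<lambda>p. - vx p"])
        show "continuous_on D (\<lambda>p. - vx p)" by (intro continuous_intros c)
        show "uy (x, y) = - vx (x, y)" if "(x, y) \<in> D" "0 < y" for y
          using eqs[OF that(1)] that(2) by auto
      qed (use p xy True in auto)
      then show ?thesis by (simp add: xy True)
    next
      case False
      then show ?thesis using eqs[of x y] p by (auto simp: xy)
    qed
  qed
  \<comment> \<open>Multiplied by y the equation also holds on the axis, where oddness gives v =
    0.\<close>
  have div: "snd p * (ux p - vy p) = 2 * v p" if p: "p \<in> D" for p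
  proof -
    obtain x y where xy: "p = (x, y)" by force
    show ?thesis
      using eqs[of x y] parity[of x y] p by (cases "y = 0") (auto simp: xy)
  qed
  \<comment> \<open>Identifying the plane with the complex numbers preserves distances, so a ball in
    D is a disc of the same radius; balls also supply the convexity that the potential
    requires.\<close>
  have rep: "\<exists>R g. 0 < R \<and> encodes_solution g u v (ball (Complex (fst p) (snd p)) R) \<and>
      (\<forall>x y. Complex x y \<in> ball (Complex (fst p) (snd p)) R \<longrightarrow> (x, y) \<in> D)"
    if p: "p \<in> D" for p
  proof -
    obtain R where R: "0 < R" "ball p R \<subseteq> D" using D p open_contains_ball by blast
    note sub = subsetD[OF R(2)]
    obtain g where g: "encodes_solution g u v {w. (Re w, Im w) \<in> ball p R}"
      by (rule holomorphic_representation[of "ball p R" u ux uy v vx vy])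
         (auto intro!: u v curl div sub continuous_on_subset[OF c(1) R(2)] continuous_on_subset[OF c(2) R(2)]
            continuous_on_subset[OF c(3) R(2)] continuous_on_subset[OF c(4) R(2)])
    have "dist p (Re w, Im w) = dist (Complex (fst p) (snd p)) w" for w
      by (cases p) (simp add: dist_norm norm_Pair cmod_def)
    then have eq: "{w. (Re w, Im w) \<in> ball p R} = ball (Complex (fst p) (snd p)) R"
      by (simp add: set_eq_iff)
    have "(x, y) \<in> D" if "Complex x y \<in> ball (Complex (fst p) (snd p)) R" for x y
      using that sub unfolding eq[symmetric] by simp
    with R(1) g[unfolded eq] show ?thesis by blast
  qed
  have fs: "ps_analytic (\<lambda>p. fst p) p" "ps_analytic (\<lambda>p. snd p) p" for p :: "real \<times> real"
    by (rule ps_analytic_linear[OF bounded_linear_fst ps_analytic_ident]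
             ps_analytic_linear[OF bounded_linear_snd ps_analytic_ident])+
  \<comment> \<open>Near such a point y is invertible, so u = Im g' / y and v = (Im g - y Re g') /
    y^2 are compositions of analytic germs.\<close>
  have off: "ps_analytic u p \<and> ps_analytic v p" if p: "p \<in> D" "snd p \<noteq> 0" for p
  proof -
    obtain R g where R: "0 < R" and enc: "encodes_solution g u v (ball (Complex (fst p) (snd p)) R)"
      using rep[OF p(1)] by blast
    note g = encodes_solutionD(1)[OF enc] and gu = encodes_solutionD(2)[OF enc] and gv = encodes_solutionD(3)[OF enc]
    define q where "q y = complex_of_real (fst y) + \<i> * of_real (snd y)" for y
    have q: "q y = Complex (fst y) (snd y)" for y by (simp add: q_def complex_eq_iff)
    have qa: "ps_analytic q p"
      unfolding q_def by (intro ps_analytic_add ps_analytic_mult ps_analytic_const ps_analytic_of_real fs)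
    have ga: "ps_analytic (\<lambda>y. g (q y)) p" 
      by (rule ps_analytic_holomorphic[OF g open_ball _ qa]) (simp add: q R)
    have g'a: "ps_analytic (\<lambda>y. deriv g (q y)) p"
      by (rule ps_analytic_holomorphic[OF holomorphic_deriv[OF g open_ball] open_ball _ qa]) (simp add: q R)
    have i: "ps_analytic (\<lambda>y. inverse (snd y)) p" by (rule ps_analytic_inverse[OF fs(2) p(2)])
    have "continuous (at p) q"
      by (rule differentiable_imp_continuous_within[OF ps_analytic_differentiable[OF qa]])
    then have "(q \<longlongrightarrow> q p) (nhds p)" by (simp add: isCont_def tendsto_at_iff_tendsto_nhds)
    then have e1: "eventually (\<lambda>y. q y \<in> ball (q p) R) (nhds p)"
      by (rule topological_tendstoD) (use R in auto)
    have "((\<lambda>y. snd y) \<longlongrightarrow> snd p) (nhds p)" by (intro tendsto_snd) (simp add: filterlim_ident)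
    then have e2: "eventually (\<lambda>y. snd y \<noteq> 0) (nhds p)"
      using p(2) by (rule tendsto_imp_eventually_ne)
    have "ps_analytic (\<lambda>y. inverse (snd y) * Im (deriv g (q y))) p"
      by (intro ps_analytic_mult i ps_analytic_linear[OF bounded_linear_Im] g'a)
    then have 1: "ps_analytic u p"
    proof (rule ps_analytic_cong)
      show "eventually (\<lambda>y. inverse (snd y) * Im (deriv g (q y)) = u y) (nhds p)"
        using e1 e2
      proof eventually_elim
        case (elim y)
        then show ?case using gu[of "fst y" "snd y"] by (simp add: q field_simps)
      qed
    qed
    have "ps_analytic (\<lambda>y. inverse (snd y) ^ 2 * (Im (g (q y)) - snd y * Re (deriv g (q y)))) p"
      by (intro ps_analytic_mult ps_analytic_power ps_analytic_diff i fs
           ps_analytic_linear[OF bounded_linear_Im] ps_analytic_linear[OF bounded_linear_Re] g'a ga)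
    then have 2: "ps_analytic v p"
    proof (rule ps_analytic_cong)
      show "eventually (\<lambda>y. inverse (snd y) ^ 2 * (Im (g (q y)) - snd y * Re (deriv g (q y))) = v y) (nhds p)"
        using e1 e2
      proof eventually_elim
        case (elim y)
        have "inverse (snd y) ^ 2 * (Im (g (q y)) - snd y * Re (deriv g (q y))) = inverse (snd y) ^ 2 * ((snd y)\<^sup>2 * v y)"
          using gv[of "fst y" "snd y"] elim by (simp add: q)
        then show ?case using elim by (simp add: field_simps)
      qed
    qed
    show ?thesis using 1 2 ..
  qed
  define S where "S = {p. 0 < snd p \<and> (fst p, sqrt (snd p)) \<in> D}"
  have "open {p::real \<times> real. 0 < snd p}"
    using open_vimage[OF open_greaterThan[of "0::real"], of snd] by (simp add: vimage_def continuous_on_snd)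
  moreover have "open {p. (fst p, sqrt (snd p)) \<in> D}"
    using open_vimage[OF D, of "\<lambda>p. (fst p, sqrt (snd p))"]
    by (simp add: vimage_def continuous_intros)
  ultimately have S_open: "open S" unfolding S_def by (rule open_Collect_conj)
  have sq: "ps_analytic (\<lambda>p. sqrt (snd p)) p" "ps_analytic (\<lambda>p. (fst p, sqrt (snd p))) p" if "0 < snd p" for p :: "real \<times> real"
    by (intro ps_analytic_Pair fs ps_analytic_sqrt that)+
  define G1 where "G1 p = u (fst p, sqrt (snd p))" for p
  define G2 where "G2 p = inverse (sqrt (snd p)) * v (fst p, sqrt (snd p))" for p
  have G1: "ps_analytic G1 p" and G2: "ps_analytic G2 p" if p: "p \<in> S" for p
  proof -
    have p': "0 < snd p" "(fst p, sqrt (snd p)) \<in> D" using p by (auto simp: S_def)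
    have *: "ps_analytic u (fst p, sqrt (snd p))" "ps_analytic v (fst p, sqrt (snd p))"
      using off[OF p'(2)] p'(1) by auto
    show "ps_analytic G1 p" unfolding G1_def[abs_def]
      by (rule ps_analytic_compose[OF *(1) sq(2)[OF p'(1)]])
    show "ps_analytic G2 p" unfolding G2_def[abs_def]
      by (intro ps_analytic_mult ps_analytic_inverse sq ps_analytic_compose[OF *(2) sq(2)[OF p'(1)]] p'(1)) (use p' in auto)
  qed
  have axis: "\<exists>\<rho>>0. \<exists>A K B L. ps_bound (x0, 0) \<rho> A K \<and> ps_bound (x0, 0) \<rho> B L \<and>
        (\<forall>x t. \<bar>x - x0\<bar> \<le> \<rho> \<longrightarrow> 0 < t \<longrightarrow> t \<le> \<rho> \<longrightarrow> A (x, t) = G1 (x, t) \<and> B (x, t) = G2 (x, t))"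
    if x0: "(x0, 0) \<in> D" for x0
  proof -
    have z: "Complex x0 0 = of_real x0" by (simp add: complex_eq_iff)
    obtain R g where R: "0 < R" and enc: "encodes_solution g u v (ball (of_real x0) R)"
      and gD: "\<And>x y. Complex x y \<in> ball (of_real x0) R \<Longrightarrow> (x, y) \<in> D"
      using rep[OF x0] unfolding fst_conv snd_conv z by blast
    obtain \<rho> A K B L where \<rho>: "0 < \<rho>" "ps_bound (x0, 0) \<rho> A K" "ps_bound (x0, 0) \<rho> B L"
      and AB: "\<And>x y. \<bar>x - x0\<bar> \<le> \<rho> \<Longrightarrow> y\<^sup>2 \<le> \<rho> \<Longrightarrow> y \<noteq> 0 \<Longrightarrow> u (x, y) = A (x, y\<^sup>2) \<and> v (x, y) = y * B (x, y\<^sup>2)"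
      using axis_expansion[OF R enc parity[OF gD]] by blast
    have "A (x, t) = G1 (x, t) \<and> B (x, t) = G2 (x, t)"
      if *: "\<bar>x - x0\<bar> \<le> \<rho>" "0 < t" "t \<le> \<rho>" for x t
    proof -
      have "u (x, sqrt t) = A (x, t) \<and> v (x, sqrt t) = sqrt t * B (x, t)"
        using AB[of x "sqrt t"] * by simp
      then show ?thesis using * by (auto simp: G1_def G2_def)
    qed
    with \<rho> show ?thesis by blast
  qed
  have Spos: "\<And>p. p \<in> S \<Longrightarrow> 0 < snd p" by (simp add: S_def)
  have X1: "\<exists>\<rho>>0. \<exists>A K. ps_bound (x0, 0) \<rho> A K \<and>
      (\<forall>x t. \<bar>x - x0\<bar> \<le> \<rho> \<longrightarrow> 0 < t \<longrightarrow> t \<le> \<rho> \<longrightarrow> A (x, t) = G1 (x, t))"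
    and X2: "\<exists>\<rho>>0. \<exists>A K. ps_bound (x0, 0) \<rho> A K \<and>
      (\<forall>x t. \<bar>x - x0\<bar> \<le> \<rho> \<longrightarrow> 0 < t \<longrightarrow> t \<le> \<rho> \<longrightarrow> A (x, t) = G2 (x, t))"
    if "x0 \<in> {x. (x, 0) \<in> D}" for x0
    using axis[of x0] that by blast+
  obtain T1 H1 where T1: "open T1" "S \<subseteq> T1" "{x. (x, 0) \<in> D} \<times> {0} \<subseteq> T1"
    "\<And>p. p \<in> T1 \<Longrightarrow> ps_analytic H1 p" "\<And>p. 0 < snd p \<Longrightarrow> H1 p = G1 p"
    using ps_analytic_extension_across_axis[OF S_open Spos G1 X1] by blast
  obtain T2 H2 where T2: "open T2" "S \<subseteq> T2" "{x. (x, 0) \<in> D} \<times> {0} \<subseteq> T2"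
    "\<And>p. p \<in> T2 \<Longrightarrow> ps_analytic H2 p" "\<And>p. 0 < snd p \<Longrightarrow> H2 p = G2 p"
    using ps_analytic_extension_across_axis[OF S_open Spos G2 X2] by blast
  have Ds: "Dstar D \<subseteq> T1 \<inter> T2"
  proof
    fix p assume p: "p \<in> Dstar D"
    then obtain x t where xt: "p = (x, t)" "0 \<le> t" "(x, sqrt t) \<in> D" by (auto simp: Dstar_def)
    show "p \<in> T1 \<inter> T2"
    proof (cases "t = 0")
      case True
      then show ?thesis using xt T1(3) T2(3) by auto
    next
      case False
      then have "p \<in> S" using xt by (simp add: S_def)
      then show ?thesis using T1(2) T2(2) by blast
    qed
  qed
  have pos: "u (x, y) = H1 (x, y\<^sup>2) \<and> v (x, y) = y * H2 (x, y\<^sup>2)" if "0 < y" for x y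
    using that by (simp add: T1(5) T2(5) G1_def G2_def)
  have uc: "continuous_on D u"
    by (rule has_derivative_continuous_on[OF has_derivative_at_withinI]) (erule u)
  have "continuous_on T1 H1"
    using T1(4) by (auto intro!: differentiable_imp_continuous_on
        simp: differentiable_on_def ps_analytic_differentiable differentiable_at_withinI)
  moreover have "(\<lambda>p. (fst p, (snd p)\<^sup>2)) ` D \<subseteq> T1"
  proof clarify
    fix x y assume "(x, y) \<in> D"
    then have "(x, \<bar>y\<bar>) \<in> D" using sym[of x y] by (simp add: abs_if)
    then have "(x, y\<^sup>2) \<in> Dstar D" by (simp add: Dstar_def)
    then show "((fst (x, y), (snd (x, y))\<^sup>2)) \<in> T1" using Ds by auto
  qed
  moreover have "continuous_on D (\<lambda>p. (fst p, (snd p)\<^sup>2))"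
    by (intro continuous_intros)
  ultimately have Hc: "continuous_on D (\<lambda>p. H1 (fst p, (snd p)\<^sup>2))"
    using continuous_on_compose2[of T1 H1 D "\<lambda>p. (fst p, (snd p)\<^sup>2)"] by blast
  have ax: "u (x, 0) = H1 (x, 0)" if "(x, 0) \<in> D" for x
    using eq_at_axis_by_continuity[OF D uc Hc that] pos by simp
  show ?thesis
  proof (rule that[of "T1 \<inter> T2" H1 H2])
    show "open (T1 \<inter> T2)" using T1(1) T2(1) by blast
    fix x y assume xy: "(x, y) \<in> D"
    consider "0 < y" | "y = 0" | "0 < - y" by linarith
    then show "u (x, y) = H1 (x, y\<^sup>2) \<and> v (x, y) = y * H2 (x, y\<^sup>2)"
    proof cases
      case 2
      then show ?thesis using ax[of x] parity[OF xy] xy by simp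
    next
      case 3
      then show ?thesis using pos[OF 3, of x] parity[OF xy] by simp
    qed (use pos in auto)
  qed (use Ds T1(4) T2(4) in auto)
qed

text \<open>The partials are explicit functions rather than \<open>pdiff\<close> terms, so that
  product and chain rule can hand over closed formulas for them together with their
  continuity.\<close>

definition has_C1_partials ::
  "(real \<times> real) set \<Rightarrow> (real \<times> real \<Rightarrow> 'b::real_normed_vector) \<Rightarrow> (real \<times> real \<Rightarrow> 'b) \<Rightarrow> (real \<times> real \<Rightarrow> 'b) \<Rightarrow> bool"
  where "has_C1_partials D F Fx Fy \<longleftrightarrow>
    (\<forall>p\<in>D. (F has_derivative (\<lambda>h. fst h *\<^sub>R Fx p + snd h *\<^sub>R Fy p)) (at p)) \<and>
    continuous_on D Fx \<and> continuous_on D Fy"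

text \<open>The system is linear with real coefficients, so it holds for each coordinate; the
  finitely many neighbourhoods are intersected and the extensions reassembled along the
  basis.\<close>

lemma vector_solution_extension:
  fixes F1 F2 F1x F1y F2x F2y :: "real \<times> real \<Rightarrow> 'b::euclidean_space"
  assumes D: "open D" and sym: "\<And>x y. (x, y) \<in> D \<Longrightarrow> (x, - y) \<in> D"
    and parity: "\<And>x y. (x, y) \<in> D \<Longrightarrow> F1 (x, - y) = F1 (x, y) \<and> F2 (x, - y) = - F2 (x, y)"
    and F1: "has_C1_partials D F1 F1x F1y" and F2: "has_C1_partials D F2 F2x F2y"
    and eqs: "\<And>x y. (x, y) \<in> D \<Longrightarrow> y \<noteq> 0 \<Longrightarrow>
        F1x (x, y) - F2y (x, y) = (2 / y) *\<^sub>R F2 (x, y) \<and> F1y (x, y) + F2x (x, y) = 0"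
  obtains D2 H1 H2 where "open D2" "Dstar D \<subseteq> D2"
    "\<And>p. p \<in> D2 \<Longrightarrow> ps_analytic H1 p" "\<And>p. p \<in> D2 \<Longrightarrow> ps_analytic H2 p"
    "\<And>x y. (x, y) \<in> D \<Longrightarrow> F1 (x, y) = H1 (x, y\<^sup>2) \<and> F2 (x, y) = y *\<^sub>R H2 (x, y\<^sup>2)"
proof -
  define Q where "Q b T h1 h2 \<longleftrightarrow> open T \<and> Dstar D \<subseteq> T \<and> (\<forall>p\<in>T. ps_analytic h1 p \<and> ps_analytic h2 p) \<and>
    (\<forall>x y. (x, y) \<in> D \<longrightarrow> F1 (x, y) \<bullet> b = h1 (x, y\<^sup>2) \<and> F2 (x, y) \<bullet> b = y * h2 (x, y\<^sup>2))" for b T h1 h2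
  have "\<forall>b\<in>Basis. \<exists>T h1 h2. Q b T h1 h2"
  proof
    fix b :: 'b
    have der: "((\<lambda>p. F p \<bullet> b) has_derivative (\<lambda>h. fst h * (Fx p \<bullet> b) + snd h * (Fy p \<bullet> b))) (at p)"
      if "has_C1_partials D F Fx Fy" "p \<in> D" for F Fx Fy p
      using has_derivative_inner_left[of F _ "at p" b] that
      by (force simp: has_C1_partials_def inner_add_left)
    have co: "continuous_on D (\<lambda>p. Fx p \<bullet> b)" "continuous_on D (\<lambda>p. Fy p \<bullet> b)"
      if "has_C1_partials D F Fx Fy" for F Fx Fy
      using that by (auto simp: has_C1_partials_def intro!: continuous_intros)
    have par: "F1 (x, - y) \<bullet> b = F1 (x, y) \<bullet> b \<and> F2 (x, - y) \<bullet> b = - (F2 (x, y) \<bullet> b)" if "(x, y) \<in> D" for x y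
      using parity[OF that] by simp
    have eq: "F1x (x, y) \<bullet> b - F2y (x, y) \<bullet> b = 2 / y * (F2 (x, y) \<bullet> b) \<and> F1y (x, y) \<bullet> b + F2x (x, y) \<bullet> b = 0"
      if "(x, y) \<in> D" "y \<noteq> 0" for x y
      using eqs[OF that] by (simp flip: inner_diff_left inner_add_left)
    obtain T h1 h2 where "open T" "Dstar D \<subseteq> T" "\<And>p. p \<in> T \<Longrightarrow> ps_analytic h1 p" "\<And>p. p \<in> T \<Longrightarrow> ps_analytic h2 p"
      "\<And>x y. (x, y) \<in> D \<Longrightarrow> F1 (x, y) \<bullet> b = h1 (x, y\<^sup>2) \<and> F2 (x, y) \<bullet> b = y * h2 (x, y\<^sup>2)"
      using real_solution_extension[OF D sym par der[OF F1] der[OF F2] co[OF F1] co[OF F2] eq] by blast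
    then have "Q b T h1 h2" unfolding Q_def by blast
    then show "\<exists>T h1 h2. Q b T h1 h2" by blast
  qed
  from bchoice[OF this] obtain T where "\<forall>b\<in>Basis. \<exists>h1 h2. Q b (T b) h1 h2" ..
  from bchoice[OF this] obtain h1 where "\<forall>b\<in>Basis. \<exists>h2. Q b (T b) (h1 b) h2" ..
  from bchoice[OF this] obtain h2 where "\<forall>b\<in>Basis. Q b (T b) (h1 b) (h2 b)" ..
  note h = this[unfolded Q_def]
  define H1 where "H1 p = (\<Sum>b\<in>Basis. h1 b p *\<^sub>R b)" for p
  define H2 where "H2 p = (\<Sum>b\<in>Basis. h2 b p *\<^sub>R b)" for p
  show ?thesis
  proof (rule that[of "\<Inter>b\<in>Basis. T b" H1 H2])
    show "open (\<Inter>b\<in>Basis. T b)" using h by (intro open_INT) auto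
    show "Dstar D \<subseteq> (\<Inter>b\<in>Basis. T b)" using h by blast
    show "ps_analytic H1 p" if "p \<in> (\<Inter>b\<in>Basis. T b)" for p
      unfolding H1_def[abs_def] using h that by (intro ps_analytic_sum ps_analytic_scaleR ps_analytic_const) auto
    show "ps_analytic H2 p" if "p \<in> (\<Inter>b\<in>Basis. T b)" for p
      unfolding H2_def[abs_def] using h that by (intro ps_analytic_sum ps_analytic_scaleR ps_analytic_const) auto
    fix x y assume xy: "(x, y) \<in> D"
    show "F1 (x, y) = H1 (x, y\<^sup>2) \<and> F2 (x, y) = y *\<^sub>R H2 (x, y\<^sup>2)"
    proof
      have "F1 (x, y) = (\<Sum>b\<in>Basis. (F1 (x, y) \<bullet> b) *\<^sub>R b)" by (simp add: euclidean_representation)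
      also have "\<dots> = H1 (x, y\<^sup>2)" unfolding H1_def using h xy by (intro sum.cong) auto
      finally show "F1 (x, y) = H1 (x, y\<^sup>2)" .
      have "F2 (x, y) = (\<Sum>b\<in>Basis. (F2 (x, y) \<bullet> b) *\<^sub>R b)" by (simp add: euclidean_representation)
      also have "\<dots> = y *\<^sub>R H2 (x, y\<^sup>2)" unfolding H2_def scaleR_sum_right using h xy by (intro sum.cong) auto
      finally show "F2 (x, y) = y *\<^sub>R H2 (x, y\<^sup>2)" .
    qed
  qed
qed

section \<open>Partial derivatives and parity\<close>

lemma pdiff_has_derivative:
  assumes "(f has_derivative f') (at x)"
  shows "pdiff f e x = f' e"
proof -
  have "(f has_derivative f') (at (x + 0 *\<^sub>R e))" using assms by simp
  then have "((f \<circ> (\<lambda>t. x + t *\<^sub>R e)) has_derivative (f' \<circ> (\<lambda>t. t *\<^sub>R e))) (at 0)"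
    by (intro diff_chain_at) (auto intro!: derivative_eq_intros)
  then have "((\<lambda>t. f (x + t *\<^sub>R e)) has_vector_derivative f' e) (at 0)"
    unfolding has_vector_derivative_def o_def
    using has_derivative_linear[OF assms] by (simp add: linear_cmul)
  then show ?thesis unfolding pdiff_def by (rule vector_derivative_at)
qed

lemma differentiable_has_derivative_pdiff:
  assumes "f differentiable (at x)"
  shows "(f has_derivative (\<lambda>h. pdiff f h x)) (at x)"
  using assms pdiff_has_derivative unfolding differentiable_def
  by (metis (no_types, lifting) ext)

text \<open>Bridge between the two notions of partial derivative: \<open>pdiff\<close> is a
  derivative along a line, whereas \<open>Ck_on\<close> is built from
  \<open>frechet_derivative\<close>.\<close>

lemma pdiff_eq_frechet_derivative:
  "f differentiable (at x) \<Longrightarrow> pdiff f e x = frechet_derivative f (at x) e"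
  by (rule pdiff_has_derivative) (simp add: frechet_derivative_works)

lemma Ck_on_imp_continuous_on: "Ck_on k S f \<Longrightarrow> continuous_on S f"
  by (cases k) (auto intro!: differentiable_imp_continuous_on simp: differentiable_on_def differentiable_at_withinI)

lemma Ck_on_Suc_pdiff:
  assumes "Ck_on (Suc k) S f"
  shows "x \<in> S \<Longrightarrow> f differentiable (at x)" and "b \<in> Basis \<Longrightarrow> continuous_on S (\<lambda>x. pdiff f b x)"
proof -
  show d: "f differentiable (at x)" if "x \<in> S" for x using assms that by simp
  assume "b \<in> Basis"
  then have "continuous_on S (\<lambda>x. frechet_derivative f (at x) b)"
    using assms by (auto intro: Ck_on_imp_continuous_on)
  then show "continuous_on S (\<lambda>x. pdiff f b x)"
    by (subst continuous_on_cong[OF refl pdiff_eq_frechet_derivative[OF d]])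
qed

lemma has_derivative_pdiff_pair:
  fixes f :: "real \<times> real \<Rightarrow> 'b::real_normed_vector"
  assumes "f differentiable (at x)"
  shows "(f has_derivative (\<lambda>h. fst h *\<^sub>R pdiff f (1, 0) x + snd h *\<^sub>R pdiff f (0, 1) x)) (at x)"
proof -
  note d = differentiable_has_derivative_pdiff[OF assms]
  have l: "linear (\<lambda>h. pdiff f h x)" by (rule has_derivative_linear[OF d])
  have "pdiff f h x = fst h *\<^sub>R pdiff f (1, 0) x + snd h *\<^sub>R pdiff f (0, 1) x" for h
  proof -
    have "pdiff f (fst h *\<^sub>R (1, 0) + snd h *\<^sub>R (0, 1)) x =
        pdiff f (fst h *\<^sub>R (1, 0)) x + pdiff f (snd h *\<^sub>R (0, 1)) x"
      by (rule linear_add[OF l])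
    also have "\<dots> = fst h *\<^sub>R pdiff f (1, 0) x + snd h *\<^sub>R pdiff f (0, 1) x"
      by (intro arg_cong2[where f = plus] linear_cmul[OF l])
    finally show ?thesis by simp
  qed
  then show ?thesis by (intro has_derivative_eq_rhs[OF d] ext)
qed

lemma Ck_on_Suc_has_C1_partials:
  fixes F :: "real \<times> real \<Rightarrow> 'b::real_normed_vector"
  assumes "Ck_on (Suc k) D F"
  shows "has_C1_partials D F (pdiff F (1, 0)) (pdiff F (0, 1))"
  unfolding has_C1_partials_def
proof (intro conjI ballI)
  show "(F has_derivative (\<lambda>h. fst h *\<^sub>R pdiff F (1, 0) p + snd h *\<^sub>R pdiff F (0, 1) p)) (at p)" if "p \<in> D" for p
    by (rule has_derivative_pdiff_pair[OF Ck_on_Suc_pdiff(1)[OF assms that]])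
  show "continuous_on D (pdiff F (1, 0))" "continuous_on D (pdiff F (0, 1))"
    using Ck_on_Suc_pdiff(2)[OF assms, of "(1, 0)"] Ck_on_Suc_pdiff(2)[OF assms, of "(0, 1)"]
    by (simp_all add: Basis_prod_def)
qed

lemma has_C1_partials_pdiff:
  assumes "has_C1_partials D F Fx Fy" "p \<in> D"
  shows "pdiff F (1, 0) p = Fx p" "pdiff F (0, 1) p = Fy p"
  using assms pdiff_has_derivative[of F "\<lambda>h. fst h *\<^sub>R Fx p + snd h *\<^sub>R Fy p" p]
  by (auto simp: has_C1_partials_def)

lemma has_C1_partials_cong:
  assumes F: "has_C1_partials D F Fx Fy" and D: "open D" and eq: "\<And>p. p \<in> D \<Longrightarrow> F p = G p"
  shows "has_C1_partials D G Fx Fy"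
  using F unfolding has_C1_partials_def
  by (auto intro: has_derivative_transform_within_open[OF _ D _ eq])

lemma has_C1_partials_continuous_on:
  assumes "has_C1_partials D F Fx Fy"
  shows "continuous_on D F"
  using assms unfolding has_C1_partials_def
  by (intro has_derivative_continuous_on[of D F]) (blast intro: has_derivative_at_withinI)

lemma has_C1_partials_snd_scaleR:
  assumes "has_C1_partials D G Gx Gy"
  shows "has_C1_partials D (\<lambda>p. snd p *\<^sub>R G p) (\<lambda>p. snd p *\<^sub>R Gx p) (\<lambda>p. G p + snd p *\<^sub>R Gy p)"
  unfolding has_C1_partials_def
proof (intro conjI ballI)
  have G: "continuous_on D G" by (rule has_C1_partials_continuous_on[OF assms])
  have c: "continuous_on D Gx" "continuous_on D Gy" using assms by (auto simp: has_C1_partials_def)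
  show "continuous_on D (\<lambda>p. snd p *\<^sub>R Gx p)" "continuous_on D (\<lambda>p. G p + snd p *\<^sub>R Gy p)"
    by (intro continuous_intros c G)+
  fix p assume "p \<in> D"
  then have d: "(G has_derivative (\<lambda>h. fst h *\<^sub>R Gx p + snd h *\<^sub>R Gy p)) (at p)"
    using assms by (simp add: has_C1_partials_def)
  have s: "(snd has_derivative snd) (at p)" by (auto intro!: derivative_eq_intros)
  show "((\<lambda>p. snd p *\<^sub>R G p) has_derivative (\<lambda>h. fst h *\<^sub>R snd p *\<^sub>R Gx p + snd h *\<^sub>R (G p + snd p *\<^sub>R Gy p))) (at p)"
    by (rule has_derivative_eq_rhs[OF has_derivative_scaleR[OF s d]]) (auto simp: algebra_simps)
qed

abbreviation sq :: "real \<times> real \<Rightarrow> real \<times> real" where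
  "sq p \<equiv> (fst p, (snd p)\<^sup>2)"

lemma has_C1_partials_square:
  assumes H: "has_C1_partials D2 H Hx Ht" and sub: "\<And>p. p \<in> D \<Longrightarrow> (sq p) \<in> D2"
  shows "has_C1_partials D (\<lambda>p. H (sq p)) (\<lambda>p. Hx (sq p))
           (\<lambda>p. (2 * snd p) *\<^sub>R Ht (sq p))"
  unfolding has_C1_partials_def
proof (intro conjI ballI)
  have c: "continuous_on D2 Hx" "continuous_on D2 Ht" using H by (auto simp: has_C1_partials_def)
  have q: "continuous_on D (\<lambda>p. sq p)" by (intro continuous_intros)
  have im: "(\<lambda>p. sq p) ` D \<subseteq> D2" using sub by blast
  show "continuous_on D (\<lambda>p. Hx (sq p))" by (rule continuous_on_compose2[OF c(1) q im])
  show "continuous_on D (\<lambda>p. (2 * snd p) *\<^sub>R Ht (sq p))"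
    by (intro continuous_intros continuous_on_compose2[OF c(2) q im])
  fix p assume p: "p \<in> D"
  have d: "(H has_derivative (\<lambda>h. fst h *\<^sub>R Hx (sq p) + snd h *\<^sub>R Ht (sq p))) (at (sq p))"
    using H sub[OF p] by (simp add: has_C1_partials_def)
  have e: "((\<lambda>p. sq p) has_derivative (\<lambda>h. (fst h, 2 * snd p * snd h))) (at p)"
    by (auto intro!: derivative_eq_intros)
  show "((\<lambda>p. H (sq p)) has_derivative
      (\<lambda>h. fst h *\<^sub>R Hx (sq p) + snd h *\<^sub>R (2 * snd p) *\<^sub>R Ht (sq p))) (at p)"
    by (rule has_derivative_eq_rhs[OF has_derivative_compose[OF e d]]) (auto simp: mult_ac)
qed

text \<open>Applied with s = 1 to \<open>F1\<close> and s = -1 to \<open>F2\<close>, this gives the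
  two combinations of derivatives in \<open>slice_dbar\<close> the parity of a stem
  function.\<close>

lemma pdiff_reflect:
  fixes F :: "real \<times> real \<Rightarrow> 'b::real_normed_vector"
  assumes D: "open D" and xy: "(x, y) \<in> D" and d: "F differentiable (at (x, - y))"
    and eq: "\<And>x y. (x, y) \<in> D \<Longrightarrow> F (x, y) = s *\<^sub>R F (x, - y)"
  shows "pdiff F (1, 0) (x, y) = s *\<^sub>R pdiff F (1, 0) (x, - y)"
    and "pdiff F (0, 1) (x, y) = - (s *\<^sub>R pdiff F (0, 1) (x, - y))"
proof -
  have r: "((\<lambda>p. (fst p, - snd p)) has_derivative (\<lambda>h. (fst h, - snd h))) (at (x, y))"
    by (auto intro!: derivative_eq_intros)
  have d': "(F has_derivative (\<lambda>h. fst h *\<^sub>R pdiff F (1, 0) (x, - y) + snd h *\<^sub>R pdiff F (0, 1) (x, - y)))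
     (at (fst (x, y), - snd (x, y)))" using has_derivative_pdiff_pair[OF d] by simp
  have "((\<lambda>p. s *\<^sub>R F (fst p, - snd p)) has_derivative
     (\<lambda>h. s *\<^sub>R (fst h *\<^sub>R pdiff F (1, 0) (x, - y) + (- snd h) *\<^sub>R pdiff F (0, 1) (x, - y)))) (at (x, y))"
    using has_derivative_scaleR_right[OF has_derivative_compose[OF r d']] by simp
  then have "(F has_derivative
     (\<lambda>h. s *\<^sub>R (fst h *\<^sub>R pdiff F (1, 0) (x, - y) + (- snd h) *\<^sub>R pdiff F (0, 1) (x, - y)))) (at (x, y))"
    by (rule has_derivative_transform_within_open[OF _ D xy]) (use eq in auto)
  from pdiff_has_derivative[OF this]
  show "pdiff F (1, 0) (x, y) = s *\<^sub>R pdiff F (1, 0) (x, - y)"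
    "pdiff F (0, 1) (x, y) = - (s *\<^sub>R pdiff F (0, 1) (x, - y))" by auto
qed

section \<open>Octonions and slice functions\<close>

lemma bounded_bilinear_qmult: "bounded_bilinear qmult"
  unfolding bilinear_conv_bounded_bilinear[symmetric] bilinear_def
  by (auto intro!: linearI simp: qmult_def algebra_simps split: prod.splits)

interpretation qmult: bounded_bilinear qmult by (rule bounded_bilinear_qmult)

lemma linear_qconj: "linear qconj"
  by (auto intro!: linearI simp: qconj_def split: prod.splits)

lemma omult_fst_snd:
  "omult x y = (qmult (fst x) (fst y) - qmult (snd y) (qconj (snd x)),
     qmult (qconj (fst x)) (snd y) + qmult (fst y) (snd x))"
  by (simp add: omult_def split: prod.splits)

lemma bounded_bilinear_omult: "bounded_bilinear omult"
  unfolding bilinear_conv_bounded_bilinear[symmetric] bilinear_def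
  by (intro conjI allI linearI) (simp_all add: omult_fst_snd qmult.add_left qmult.add_right qmult.scaleR_left qmult.scaleR_right
      linear_add[OF linear_qconj] linear_cmul[OF linear_qconj] algebra_simps)

interpretation omult: bounded_bilinear omult by (rule bounded_bilinear_omult)

definition ore :: "oct \<Rightarrow> real" where "ore q = fst (fst q)"
definition oim :: "oct \<Rightarrow> oct" where "oim q = q - oreal (ore q)"

lemma linear_ore: "linear ore"
  by (auto intro!: linearI simp: ore_def)

lemma linear_oreal: "linear oreal"
  by (auto intro!: linearI simp: oreal_def)

lemma ore_oreal [simp]: "ore (oreal t) = t"
  by (simp add: ore_def oreal_def)

text \<open>With real part a and imaginary part J, the square of I is a^2 - |J|^2 + 2 a J. If it
  equals -1 and a \<noteq> 0, then J = 0 and a^2 = -1, which is impossible.\<close>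

lemma mem_octS_iff: "I \<in> octS \<longleftrightarrow> ore I = 0 \<and> (norm I)\<^sup>2 = 1"
proof -
  obtain a b c d e f g h where I: "I = ((a, b, c, d), (e, f, g, h))" by (metis prod.collapse)
  have n: "(norm I)\<^sup>2 = a\<^sup>2 + b\<^sup>2 + c\<^sup>2 + d\<^sup>2 + e\<^sup>2 + f\<^sup>2 + g\<^sup>2 + h\<^sup>2"
    by (simp add: I norm_Pair)
  have m: "omult I I = ((a\<^sup>2 - b\<^sup>2 - c\<^sup>2 - d\<^sup>2 - e\<^sup>2 - f\<^sup>2 - g\<^sup>2 - h\<^sup>2, 2*a*b, 2*a*c, 2*a*d), (2*a*e, 2*a*f, 2*a*g, 2*a*h))"
    by (simp add: I omult_def qmult_def qconj_def power2_eq_square algebra_simps)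
  show ?thesis
  proof
    assume "I \<in> octS"
    then have eq: "a\<^sup>2 - b\<^sup>2 - c\<^sup>2 - d\<^sup>2 - e\<^sup>2 - f\<^sup>2 - g\<^sup>2 - h\<^sup>2 = -1" "a*b=0" "a*c=0" "a*d=0" "a*e=0" "a*f=0" "a*g=0" "a*h=0"
      by (auto simp: octS_def m oreal_def)
    have "a = 0"
    proof (rule ccontr)
      assume "a \<noteq> 0"
      with eq have "a\<^sup>2 = -1" by simp
      then show False using zero_le_power2[of a] by linarith
    qed
    with eq(1) show "ore I = 0 \<and> (norm I)\<^sup>2 = 1" unfolding n by (simp add: ore_def I)
  next
    assume "ore I = 0 \<and> (norm I)\<^sup>2 = 1"
    then have "a = 0" "b\<^sup>2 + c\<^sup>2 + d\<^sup>2 + e\<^sup>2 + f\<^sup>2 + g\<^sup>2 + h\<^sup>2 = 1" unfolding n by (auto simp: ore_def I)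
    then show "I \<in> octS" by (simp add: octS_def m oreal_def)
  qed
qed

lemma octS_norm: "I \<in> octS \<Longrightarrow> norm I = 1"
  using norm_ge_zero[of I] by (auto simp: mem_octS_iff power2_eq_1_iff simp del: norm_ge_zero)

lemma ore_slice: "I \<in> octS \<Longrightarrow> ore (oreal x + y *\<^sub>R I) = x"
  by (simp add: mem_octS_iff linear_add[OF linear_ore] linear_cmul[OF linear_ore])

lemma oim_slice: "I \<in> octS \<Longrightarrow> oim (oreal x + y *\<^sub>R I) = y *\<^sub>R I"
  by (simp add: oim_def ore_slice)

lemma uminus_octS: "I \<in> octS \<Longrightarrow> - I \<in> octS"
  by (simp add: mem_octS_iff linear_neg[OF linear_ore])

definition oct_i :: oct where "oct_i = ((0, 1, 0, 0), (0, 0, 0, 0))"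

lemma oct_i_octS: "oct_i \<in> octS"
  by (simp add: octS_def oct_i_def omult_def qmult_def qconj_def oreal_def zero_prod_def)

text \<open>Left multiplication by \<open>oct_i\<close> permutes the eight coordinates up to
  sign.\<close>

lemma omult_oct_i_eq_0: "omult oct_i x = 0 \<Longrightarrow> x = 0"
  by (auto simp: oct_i_def omult_def qmult_def qconj_def prod_eq_iff split: prod.splits)

lemma oim_polar:
  obtains I where "I \<in> octS" "oim q = norm (oim q) *\<^sub>R I"
proof (cases "oim q = 0")
  case True
  then show ?thesis using that[OF oct_i_octS] by simp
next
  case False
  have "ore (oim q) = 0" by (simp add: oim_def linear_diff[OF linear_ore])
  with False have "inverse (norm (oim q)) *\<^sub>R oim q \<in> octS"
    by (simp add: mem_octS_iff linear_cmul[OF linear_ore])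
  from that[OF this] False show ?thesis by simp
qed

text \<open>Exhibits \<open>OmegaD D\<close> as the preimage of D under a continuous map, from which
  openness follows; symmetry of D permits the choice of the nonnegative second coordinate.\<close>

lemma OmegaD_iff:
  assumes sym: "\<And>x y. (x, y) \<in> D \<Longrightarrow> (x, - y) \<in> D"
  shows "q \<in> OmegaD D \<longleftrightarrow> (ore q, norm (oim q)) \<in> D"
proof
  assume "q \<in> OmegaD D"
  then obtain x y I where q: "q = oreal x + y *\<^sub>R I" "(x, y) \<in> D" "I \<in> octS" by (auto simp: OmegaD_def)
  then have "ore q = x" "norm (oim q) = \<bar>y\<bar>" by (auto simp: ore_slice oim_slice octS_norm)
  then show "(ore q, norm (oim q)) \<in> D" using q(2) sym[of x y] by (simp add: abs_if)
next
  assume *: "(ore q, norm (oim q)) \<in> D"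
  have qq: "q = oreal (ore q) + oim q" by (simp add: oim_def)
  obtain I where "I \<in> octS" "oim q = norm (oim q) *\<^sub>R I" by (rule oim_polar)
  with qq have "q = oreal (ore q) + norm (oim q) *\<^sub>R I" by metis
  with * \<open>I \<in> octS\<close> show "q \<in> OmegaD D" unfolding OmegaD_def by blast
qed

text \<open>Off the reals a point has exactly two representations, by (y, I) and by (- y, - I). The
  parities of \<open>G1\<close> and \<open>G2\<close> make both give the same value, so the choice
  in \<open>slice_fun\<close> has no effect.\<close>

lemma slice_fun_eq:
  assumes xy: "(x, y) \<in> D" "y \<noteq> 0" and I: "I \<in> octS"
    and par: "\<And>x y. (x, y) \<in> D \<Longrightarrow> y \<noteq> 0 \<Longrightarrow> G1 (x, - y) = G1 (x, y) \<and> G2 (x, - y) = - G2 (x, y)"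
  shows "slice_fun D G1 G2 (oreal x + y *\<^sub>R I) = G1 (x, y) + omult I (G2 (x, y))"
  unfolding slice_fun_def
proof (rule some_equality)
  show "\<exists>x0 x1 J. (x0, x1) \<in> D \<and> J \<in> octS \<and> oreal x + y *\<^sub>R I = oreal x0 + x1 *\<^sub>R J \<and>
       G1 (x, y) + omult I (G2 (x, y)) = G1 (x0, x1) + omult J (G2 (x0, x1))"
    using xy I by blast
  fix w assume "\<exists>x0 x1 J. (x0, x1) \<in> D \<and> J \<in> octS \<and> oreal x + y *\<^sub>R I = oreal x0 + x1 *\<^sub>R J \<and>
       w = G1 (x0, x1) + omult J (G2 (x0, x1))"
  then obtain x0 x1 J where J: "(x0, x1) \<in> D" "J \<in> octS" and e: "oreal x + y *\<^sub>R I = oreal x0 + x1 *\<^sub>R J"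
    and w: "w = G1 (x0, x1) + omult J (G2 (x0, x1))" by blast
  have x: "x0 = x" using arg_cong[OF e, of ore] I J(2) by (simp add: ore_slice)
  have yI: "y *\<^sub>R I = x1 *\<^sub>R J" using e x by simp
  have "norm (y *\<^sub>R I) = norm (x1 *\<^sub>R J)" unfolding yI ..
  then have "\<bar>y\<bar> = \<bar>x1\<bar>" using I J(2) by (simp add: octS_norm)
  then consider "x1 = y" | "x1 = - y" by linarith
  then show "w = G1 (x, y) + omult I (G2 (x, y))"
  proof cases
    case 1
    with yI xy(2) have "J = I" by simp
    then show ?thesis by (simp add: w x 1)
  next
    case 2
    have "y *\<^sub>R I = y *\<^sub>R (- J)" using yI 2 by simp
    from scaleR_left_imp_eq[OF xy(2) this] have "J = - I" by simp
    then show ?thesis using par[OF xy] by (simp add: w x 2 omult.minus_left omult.minus_right)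
  qed
qed

section \<open>The C^1 system and the conditions that imply it\<close>

text \<open>The hub of the equivalences: the system off the axis for C^1 data. Each condition is
  reduced to it, and the analytic representation derived from it yields them all.\<close>

definition C1_stem_solution ::
  "(real \<times> real) set \<Rightarrow> (real \<times> real \<Rightarrow> 'b::real_normed_vector) \<Rightarrow> (real \<times> real \<Rightarrow> 'b) \<Rightarrow> bool" where
  "C1_stem_solution D F1 F2 \<longleftrightarrow> (\<exists>F1x F1y F2x F2y. has_C1_partials D F1 F1x F1y \<and> has_C1_partials D F2 F2x F2y \<and>
     (\<forall>x y. (x, y) \<in> D \<longrightarrow> y \<noteq> 0 \<longrightarrow>
        F1x (x, y) - F2y (x, y) = (2 / y) *\<^sub>R F2 (x, y) \<and> F1y (x, y) + F2x (x, y) = 0))"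

lemma C1_stem_solution_pdiff:
  assumes "C1_stem_solution D F1 F2" "(x, y) \<in> D" "y \<noteq> 0"
  shows "pdiff F1 (1, 0) (x, y) - pdiff F2 (0, 1) (x, y) = (2 / y) *\<^sub>R F2 (x, y)"
    and "pdiff F1 (0, 1) (x, y) + pdiff F2 (1, 0) (x, y) = 0"
  using assms by (auto simp: C1_stem_solution_def has_C1_partials_pdiff)

lemma C1_stem_solutionI_Ck:
  assumes "Ck_on (Suc k) D F1" "Ck_on (Suc l) D F2"
    and "\<And>x y. (x, y) \<in> D \<Longrightarrow> y \<noteq> 0 \<Longrightarrow>
      pdiff F1 (1, 0) (x, y) - pdiff F2 (0, 1) (x, y) = (2 / y) *\<^sub>R F2 (x, y) \<and>
      pdiff F1 (0, 1) (x, y) + pdiff F2 (1, 0) (x, y) = 0"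
  shows "C1_stem_solution D F1 F2"
  unfolding C1_stem_solution_def
  using Ck_on_Suc_has_C1_partials[OF assms(1)] Ck_on_Suc_has_C1_partials[OF assms(2)] assms(3) by blast

text \<open>For F_2 = y G the product rule gives F_2 a y-derivative G + y G_y, so the coefficient 3
  splits into this one G and the 2 G = 2 F_2 / y of the system.\<close>

lemma C1_stem_solutionI_quotient:
  assumes D: "open D" and "Ck_on (Suc k) D F1" "Ck_on (Suc l) D G"
    and F2: "\<And>x y. (x, y) \<in> D \<Longrightarrow> F2 (x, y) = y *\<^sub>R G (x, y)"
    and eqs: "\<And>x y. (x, y) \<in> D \<Longrightarrow>
      pdiff F1 (1, 0) (x, y) - y *\<^sub>R pdiff G (0, 1) (x, y) = 3 *\<^sub>R G (x, y) \<and>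
      pdiff F1 (0, 1) (x, y) + y *\<^sub>R pdiff G (1, 0) (x, y) = 0"
  shows "C1_stem_solution D F1 F2"
proof -
  note G = Ck_on_Suc_has_C1_partials[OF assms(3)]
  have "has_C1_partials D F2 (\<lambda>p. snd p *\<^sub>R pdiff G (1, 0) p) (\<lambda>p. G p + snd p *\<^sub>R pdiff G (0, 1) p)"
    by (rule has_C1_partials_cong[OF has_C1_partials_snd_scaleR[OF G] D]) (auto simp: F2)
  moreover have "pdiff F1 (1, 0) (x, y) - (G (x, y) + y *\<^sub>R pdiff G (0, 1) (x, y)) = (2 / y) *\<^sub>R F2 (x, y)"
    if "(x, y) \<in> D" "y \<noteq> 0" for x y
  proof -
    have "pdiff F1 (1, 0) (x, y) = 3 *\<^sub>R G (x, y) + y *\<^sub>R pdiff G (0, 1) (x, y)"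
      using eqs[OF that(1)] by (simp add: diff_eq_eq)
    then have "pdiff F1 (1, 0) (x, y) - (G (x, y) + y *\<^sub>R pdiff G (0, 1) (x, y)) = (3 - 1) *\<^sub>R G (x, y)"
      by (simp only: scaleR_left_diff_distrib) simp
    then show ?thesis using that by (simp add: F2)
  qed
  ultimately show ?thesis
    unfolding C1_stem_solution_def
    using Ck_on_Suc_has_C1_partials[OF assms(2)] eqs
    by (intro exI[of _ "pdiff F1 (1, 0)"] exI[of _ "pdiff F1 (0, 1)"]
        exI[of _ "\<lambda>p. snd p *\<^sub>R pdiff G (1, 0) p"] exI[of _ "\<lambda>p. G p + snd p *\<^sub>R pdiff G (0, 1) p"]) simp
qed

lemma square_mem_Dstar:
  assumes "\<And>x y. (x, y) \<in> D \<Longrightarrow> (x, - y) \<in> D" "(x, y) \<in> D"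
  shows "(x, y\<^sup>2) \<in> Dstar D"
  using assms(1)[OF assms(2)] assms(2) by (simp add: Dstar_def abs_if)

lemma C1_partials_square_representation:
  assumes D: "open D" and sym: "\<And>x y. (x, y) \<in> D \<Longrightarrow> (x, - y) \<in> D" and D2: "Dstar D \<subseteq> D2"
    and H1: "has_C1_partials D2 H1 H1x H1t" and H2: "has_C1_partials D2 H2 H2x H2t"
    and F: "\<And>x y. (x, y) \<in> D \<Longrightarrow> F1 (x, y) = H1 (x, y\<^sup>2) \<and> F2 (x, y) = y *\<^sub>R H2 (x, y\<^sup>2)"
  shows "has_C1_partials D F1 (\<lambda>p. H1x (sq p)) (\<lambda>p. (2 * snd p) *\<^sub>R H1t (sq p))"
    and "has_C1_partials D F2 (\<lambda>p. snd p *\<^sub>R H2x (sq p))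
      (\<lambda>p. H2 (sq p) + snd p *\<^sub>R (2 * snd p) *\<^sub>R H2t (sq p))"
proof -
  have sub: "sq p \<in> D2" if "p \<in> D" for p
    using square_mem_Dstar[OF sym, of "fst p" "snd p"] that D2 by auto
  show "has_C1_partials D F1 (\<lambda>p. H1x (sq p)) (\<lambda>p. (2 * snd p) *\<^sub>R H1t (sq p))"
    by (rule has_C1_partials_cong[OF has_C1_partials_square[OF H1 sub] D]) (use F in auto)
  show "has_C1_partials D F2 (\<lambda>p. snd p *\<^sub>R H2x (sq p))
      (\<lambda>p. H2 (sq p) + snd p *\<^sub>R (2 * snd p) *\<^sub>R H2t (sq p))"
    by (rule has_C1_partials_cong[OF has_C1_partials_snd_scaleR[OF has_C1_partials_square[OF H2 sub]] D])
       (use F in auto)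
qed

text \<open>With t = y^2 the chain rule produces 2 y H_1t and H_2 + 2 y^2 H_2t. The first equation
  again splits 3 as 2 + 1, and the second is y times the second equation for H_1, H_2.\<close>

lemma C1_stem_solutionI_square:
  assumes D: "open D" and sym: "\<And>x y. (x, y) \<in> D \<Longrightarrow> (x, - y) \<in> D" and D2: "Dstar D \<subseteq> D2"
    and H: "Ck_on (Suc k) D2 H1" "Ck_on (Suc l) D2 H2"
    and F: "\<And>x y. (x, y) \<in> D \<Longrightarrow> F1 (x, y) = H1 (x, y\<^sup>2) \<and> F2 (x, y) = y *\<^sub>R H2 (x, y\<^sup>2)"
    and eqs: "\<And>x t. (x, t) \<in> Dstar D \<Longrightarrow>
      pdiff H1 (1, 0) (x, t) - (2 * t) *\<^sub>R pdiff H2 (0, 1) (x, t) = 3 *\<^sub>R H2 (x, t) \<and>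
      2 *\<^sub>R pdiff H1 (0, 1) (x, t) + pdiff H2 (1, 0) (x, t) = 0"
  shows "C1_stem_solution D F1 F2"
proof -
  note C = C1_partials_square_representation[OF D sym D2 Ck_on_Suc_has_C1_partials[OF H(1)]
      Ck_on_Suc_has_C1_partials[OF H(2)] F]
  show ?thesis
    unfolding C1_stem_solution_def
  proof (rule exI, rule exI, rule exI, rule exI, intro conjI allI impI)
    show "has_C1_partials D F1 (\<lambda>p. pdiff H1 (1, 0) (sq p)) (\<lambda>p. (2 * snd p) *\<^sub>R pdiff H1 (0, 1) (sq p))"
      by (rule C(1))
    show "has_C1_partials D F2 (\<lambda>p. snd p *\<^sub>R pdiff H2 (1, 0) (sq p))
      (\<lambda>p. H2 (sq p) + snd p *\<^sub>R (2 * snd p) *\<^sub>R pdiff H2 (0, 1) (sq p))"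
      by (rule C(2))
    fix x y assume xy: "(x, y) \<in> D" "y \<noteq> 0"
    note e = eqs[OF square_mem_Dstar[OF sym xy(1)]]
    have 1: "pdiff H1 (1, 0) (x, y\<^sup>2) = 3 *\<^sub>R H2 (x, y\<^sup>2) + (2 * y\<^sup>2) *\<^sub>R pdiff H2 (0, 1) (x, y\<^sup>2)"
      using e by (simp add: diff_eq_eq)
    have "pdiff H1 (1, 0) (x, y\<^sup>2) - (H2 (x, y\<^sup>2) + y *\<^sub>R (2 * y) *\<^sub>R pdiff H2 (0, 1) (x, y\<^sup>2)) = (3 - 1) *\<^sub>R H2 (x, y\<^sup>2)"
      unfolding 1 by (simp only: scaleR_left_diff_distrib) (simp add: power2_eq_square)
    then show "pdiff H1 (1, 0) (sq (x, y)) - (H2 (sq (x, y)) +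
        snd (x, y) *\<^sub>R (2 * snd (x, y)) *\<^sub>R pdiff H2 (0, 1) (sq (x, y))) = (2 / y) *\<^sub>R F2 (x, y)"
      using xy F by simp
    have "(2 * y) *\<^sub>R pdiff H1 (0, 1) (x, y\<^sup>2) + y *\<^sub>R pdiff H2 (1, 0) (x, y\<^sup>2)
        = y *\<^sub>R (2 *\<^sub>R pdiff H1 (0, 1) (x, y\<^sup>2) + pdiff H2 (1, 0) (x, y\<^sup>2))"
      by (simp add: scaleR_add_right)
    then show "(2 * snd (x, y)) *\<^sub>R pdiff H1 (0, 1) (sq (x, y)) +
        snd (x, y) *\<^sub>R pdiff H2 (1, 0) (sq (x, y)) = 0"
      using e by simp
  qed
qed

section \<open>From the first order system in four variables to the plane\<close>

lemma linear_coord4: "linear (coord4 k)"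
  by (auto intro!: linearI simp: coord4_def split: prod.splits)

lemma bounded_linear_coord4: "bounded_linear (coord4 k)"
  using linear_coord4 linear_conv_bounded_linear by blast

lemma e4_Basis: "e4 k \<in> Basis"
  by (auto simp: e4_def Basis_prod_def zero_prod_def)

lemma coord4_e4: "j \<le> 3 \<Longrightarrow> k \<le> 3 \<Longrightarrow> coord4 j (e4 k) = (if j = k then 1 else 0)"
  by (auto simp: coord4_def e4_def)

definition coord4_r2 :: "real \<times> real \<times> real \<times> real \<Rightarrow> real" where
  "coord4_r2 v = (coord4 1 v)\<^sup>2 + (coord4 2 v)\<^sup>2 + (coord4 3 v)\<^sup>2"

lemma Eset_iff: "v \<in> Eset D \<longleftrightarrow> (coord4 0 v, sqrt (coord4_r2 v)) \<in> D"
  by (cases v) (auto simp: Eset_def coord4_def coord4_r2_def)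

lemma open_Eset:
  assumes "open D"
  shows "open (Eset D)"
proof -
  have "continuous_on UNIV (coord4 k)" for k
    by (rule linear_continuous_on[OF bounded_linear_coord4])
  then have "continuous_on UNIV (\<lambda>v. (coord4 0 v, sqrt (coord4_r2 v)))"
    unfolding coord4_r2_def by (intro continuous_intros)
  from open_vimage[OF assms this] show ?thesis by (simp add: vimage_def Eset_iff[symmetric])
qed

lemma has_C1_partials_Eset_slice:
  fixes g :: "real \<times> real \<times> real \<times> real \<Rightarrow> 'b::real_normed_vector"
  assumes g: "Ck_on (Suc k) (Eset D) g" and sub: "\<And>p. p \<in> D \<Longrightarrow> (fst p, snd p, 0, 0) \<in> Eset D"
  shows "has_C1_partials D (\<lambda>p. g (fst p, snd p, 0, 0)) (\<lambda>p. pdiff g (e4 0) (fst p, snd p, 0, 0))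
    (\<lambda>p. pdiff g (e4 1) (fst p, snd p, 0, 0))"
proof -
  define j where "j p = (fst p, snd p, 0::real, 0::real)" for p :: "real \<times> real"
  show ?thesis
    unfolding has_C1_partials_def j_def[symmetric]
  proof (intro conjI ballI)
    have j: "continuous_on D j" unfolding j_def by (intro continuous_intros)
    have im: "j ` D \<subseteq> Eset D" using sub by (auto simp: j_def)
    show "continuous_on D (\<lambda>p. pdiff g (e4 0) (j p))"
      "continuous_on D (\<lambda>p. pdiff g (e4 1) (j p))"
      by (rule continuous_on_compose2[OF Ck_on_Suc_pdiff(2)[OF g e4_Basis] j im])+
    fix p assume p: "p \<in> D"
    note d = differentiable_has_derivative_pdiff[OF Ck_on_Suc_pdiff(1)[OF g sub[OF p, folded j_def]]]
    have l: "linear (\<lambda>h. pdiff g h (j p))" by (rule has_derivative_linear[OF d])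
    have e: "(j has_derivative (\<lambda>h. (fst h, snd h, 0, 0))) (at p)"
      unfolding j_def[abs_def] by (auto intro!: derivative_eq_intros simp: zero_prod_def)
    have "pdiff g (fst h, snd h, 0, 0) (j p) =
        fst h *\<^sub>R pdiff g (e4 0) (j p) + snd h *\<^sub>R pdiff g (e4 1) (j p)" for h
    proof -
      have "(fst h, snd h, 0, 0) = fst h *\<^sub>R e4 0 + snd h *\<^sub>R e4 1" by (simp add: e4_def)
      then have "pdiff g (fst h, snd h, 0, 0) (j p) = pdiff g (fst h *\<^sub>R e4 0 + snd h *\<^sub>R e4 1) (j p)"
        by (rule arg_cong)
      also have "\<dots> = pdiff g (fst h *\<^sub>R e4 0) (j p) + pdiff g (snd h *\<^sub>R e4 1) (j p)"
        by (rule linear_add[OF l])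
      also have "\<dots> = fst h *\<^sub>R pdiff g (e4 0) (j p) + snd h *\<^sub>R pdiff g (e4 1) (j p)"
        by (intro arg_cong2[where f = plus] linear_cmul[OF l])
      finally show ?thesis .
    qed
    then show "((\<lambda>p. g (j p)) has_derivative (\<lambda>h. fst h *\<^sub>R pdiff g (e4 0) (j p) +
        snd h *\<^sub>R pdiff g (e4 1) (j p))) (at p)"
      by (intro has_derivative_eq_rhs[OF has_derivative_compose[OF e d]] ext)
  qed
qed

text \<open>The difference quotient at 0 is k itself, so continuity of k gives the derivative. It
  serves for derivatives transversal to the plane x_2 = x_3 = 0.\<close>

lemma has_vector_derivative_scaleR_at_0:
  fixes k :: "real \<Rightarrow> 'b::real_normed_vector"
  assumes "isCont k 0"
  shows "((\<lambda>s. s *\<^sub>R k s) has_vector_derivative k 0) (at 0)"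
  unfolding has_vector_derivative_def has_derivative_at
proof (intro conjI bounded_linear_scaleR_left)
  have "((\<lambda>s. norm (k s - k 0)) \<longlongrightarrow> norm (k 0 - k 0)) (at 0)"
    using assms by (intro tendsto_intros) (simp add: isCont_def)
  then have lim: "((\<lambda>s. norm (k s - k 0)) \<longlongrightarrow> 0) (at 0)" by simp
  show "(\<lambda>h. norm ((0 + h) *\<^sub>R k (0 + h) - 0 *\<^sub>R k 0 - h *\<^sub>R k 0) / norm h) \<midarrow>0\<rightarrow> 0"
  proof (rule Lim_null_comparison[OF _ lim], rule eventuallyI)
    fix h :: real
    have "(0 + h) *\<^sub>R k (0 + h) - 0 *\<^sub>R k 0 - h *\<^sub>R k 0 = h *\<^sub>R (k h - k 0)" by (simp add: scaleR_diff_right)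
    then show "norm (norm ((0 + h) *\<^sub>R k (0 + h) - 0 *\<^sub>R k 0 - h *\<^sub>R k 0) / norm h) \<le> norm (k h - k 0)"
      by simp
  qed
qed

text \<open>Restrict to the plane x_2 = x_3 = 0, which contains a copy of D. There components 0 and
  1 are \<open>F1\<close> and \<open>F2\<close>, also for y < 0 by parity although r = |y|.
  Components 2 and 3 vanish on the plane; each has derivative F_2 / y in its own direction and 0 in
  the other's. The first two equations of the system thus become the two equations sought, the
  coefficient 2 being the number of transversal directions.\<close>

lemma C1_stem_solutionI_Fcal:
  assumes D: "open D" and sym: "\<And>x y. (x, y) \<in> D \<Longrightarrow> (x, - y) \<in> D"
    and parity: "\<And>x y. (x, y) \<in> D \<Longrightarrow> F1 (x, - y) = F1 (x, y) \<and> F2 (x, - y) = - F2 (x, y)"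
    and C: "\<And>h. h \<le> 3 \<Longrightarrow> Ck_on (Suc k) (Eset D) (Fcal F1 F2 h)"
    and eq1: "\<And>v. v \<in> Eset D \<Longrightarrow> pdiff (Fcal F1 F2 0) (e4 0) v - pdiff (Fcal F1 F2 1) (e4 1) v
           - pdiff (Fcal F1 F2 2) (e4 2) v - pdiff (Fcal F1 F2 3) (e4 3) v = 0"
    and eq2: "\<And>v. v \<in> Eset D \<Longrightarrow> pdiff (Fcal F1 F2 0) (e4 1) v + pdiff (Fcal F1 F2 1) (e4 0) v
           - pdiff (Fcal F1 F2 2) (e4 3) v + pdiff (Fcal F1 F2 3) (e4 2) v = 0"
  shows "C1_stem_solution D F1 F2"
proof -
  have absD: "(x, \<bar>y\<bar>) \<in> D" if "(x, y) \<in> D" for x y using sym[OF that] that by (simp add: abs_if)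
  have sub: "(fst p, snd p, 0, 0) \<in> Eset D" if "p \<in> D" for p
    using absD[of "fst p" "snd p"] that by (simp add: Eset_def)
  have F1_abs: "F1 (x, \<bar>y\<bar>) = F1 (x, y)" if "(x, y) \<in> D" for x y
    using parity[OF that] by (simp add: abs_if)
  have F2_abs: "F2 (x, \<bar>y\<bar>) = sgn y *\<^sub>R F2 (x, y)" if "(x, y) \<in> D" "y \<noteq> 0" for x y
    using parity[OF that(1)] that(2) by (simp add: abs_if sgn_if)
  have F2_0: "F2 (x, 0) = 0" if "(x, 0) \<in> D" for x
    using parity[OF that] by (simp add: eq_neg_iff_add_eq_0 flip: scaleR_2)
  have j0: "Fcal F1 F2 0 (fst p, snd p, 0, 0) = F1 p" if "p \<in> D" for p
    using F1_abs[of "fst p" "snd p"] that by (simp add: Fcal_def coord4_def)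
  have j1: "Fcal F1 F2 1 (fst p, snd p, 0, 0) = F2 p" if "p \<in> D" for p
  proof (cases "snd p = 0")
    case True
    then show ?thesis using F2_0[of "fst p"] that by (cases p) (simp add: Fcal_def coord4_def)
  next
    case False
    have "(snd p / \<bar>snd p\<bar>) * sgn (snd p) = 1" using False by (simp add: sgn_if abs_if)
    moreover have "Fcal F1 F2 1 (fst p, snd p, 0, 0) = (snd p / \<bar>snd p\<bar>) *\<^sub>R F2 (fst p, \<bar>snd p\<bar>)"
      using False by (simp add: Fcal_def coord4_def Let_def)
    ultimately show ?thesis using F2_abs[of "fst p" "snd p"] that False
      by (simp only: scaleR_scaleR scaleR_one prod.collapse simp_thms)
  qed
  note c0 = has_C1_partials_cong[OF has_C1_partials_Eset_slice[OF C[of 0] sub] D j0]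
  note c1 = has_C1_partials_cong[OF has_C1_partials_Eset_slice[OF C[of 1] sub] D j1]
  have F2_cont: "continuous_on D F2" by (rule has_C1_partials_continuous_on[OF c1]) simp
  \<comment> \<open>On the line through (x, y, 0, 0) in direction 2, component 2 equals
    \<open>s *\<^sub>R k x y s\<close>, and likewise for 3. At s = 0 the value is F_2(x, |y|) / |y|,
    which is F_2(x, y) / y since F_2 is odd.\<close>
  define k where "k x y s = (1 / sqrt (y\<^sup>2 + s\<^sup>2)) *\<^sub>R F2 (x, sqrt (y\<^sup>2 + s\<^sup>2))" for x y s
  have k0: "k x y 0 = (1 / y) *\<^sub>R F2 (x, y)" if "(x, y) \<in> D" "y \<noteq> 0" for x y
  proof -
    have "1 / \<bar>y\<bar> * sgn y = 1 / y" using that by (simp add: sgn_if abs_if)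
    then show ?thesis using F2_abs[OF that] by (simp add: k_def)
  qed
  have k_der: "((\<lambda>s. s *\<^sub>R k x y s) has_vector_derivative (1 / y) *\<^sub>R F2 (x, y)) (at 0)"
    if xy: "(x, y) \<in> D" "y \<noteq> 0" for x y
  proof -
    have "isCont F2 (x, sqrt (y\<^sup>2 + 0\<^sup>2))"
      using F2_cont absD[OF xy(1)] D by (simp add: continuous_on_eq_continuous_at)
    moreover have "isCont (\<lambda>s. (x, sqrt (y\<^sup>2 + s\<^sup>2))) 0" by (intro continuous_intros)
    ultimately have "isCont (\<lambda>s. F2 (x, sqrt (y\<^sup>2 + s\<^sup>2))) 0"
      using isCont_o2[of 0 "\<lambda>s. (x, sqrt (y\<^sup>2 + s\<^sup>2))" F2] by simp
    then have "isCont (k x y) 0"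
      unfolding k_def[abs_def] using xy(2) by (intro continuous_intros) auto
    from has_vector_derivative_scaleR_at_0[OF this] k0[OF xy] show ?thesis by simp
  qed
  have p22: "pdiff (Fcal F1 F2 2) (e4 2) (x, y, 0, 0) = (1 / y) *\<^sub>R F2 (x, y)"
    and p33: "pdiff (Fcal F1 F2 3) (e4 3) (x, y, 0, 0) = (1 / y) *\<^sub>R F2 (x, y)"
    and p23: "pdiff (Fcal F1 F2 2) (e4 3) (x, y, 0, 0) = 0"
    and p32: "pdiff (Fcal F1 F2 3) (e4 2) (x, y, 0, 0) = 0"
    if xy: "(x, y) \<in> D" "y \<noteq> 0" for x y
  proof -
    have nz: "y\<^sup>2 + t\<^sup>2 \<noteq> 0" for t using xy(2) by (simp add: sum_power2_eq_zero_iff)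
    have "(\<lambda>t. Fcal F1 F2 2 ((x, y, 0, 0) + t *\<^sub>R e4 2)) = (\<lambda>s. s *\<^sub>R k x y s)"
      "(\<lambda>t. Fcal F1 F2 3 ((x, y, 0, 0) + t *\<^sub>R e4 3)) = (\<lambda>s. s *\<^sub>R k x y s)"
      using nz by (auto simp: Fcal_def coord4_def e4_def k_def Let_def)
    then show "pdiff (Fcal F1 F2 2) (e4 2) (x, y, 0, 0) = (1 / y) *\<^sub>R F2 (x, y)"
      "pdiff (Fcal F1 F2 3) (e4 3) (x, y, 0, 0) = (1 / y) *\<^sub>R F2 (x, y)"
      unfolding pdiff_def using vector_derivative_at[OF k_der[OF xy]] by simp_all
    \<comment> \<open>Along these lines the coordinate in front of F_2 stays zero, so the component
      vanishes identically.\<close>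
    have "(\<lambda>t. Fcal F1 F2 2 ((x, y, 0, 0) + t *\<^sub>R e4 3)) = (\<lambda>s. 0)"
      "(\<lambda>t. Fcal F1 F2 3 ((x, y, 0, 0) + t *\<^sub>R e4 2)) = (\<lambda>s. 0)"
      by (auto simp: Fcal_def coord4_def e4_def Let_def)
    then show "pdiff (Fcal F1 F2 2) (e4 3) (x, y, 0, 0) = 0" "pdiff (Fcal F1 F2 3) (e4 2) (x, y, 0, 0) = 0"
      unfolding pdiff_def by simp_all
  qed
  show ?thesis
    unfolding C1_stem_solution_def
  proof (rule exI, rule exI, rule exI, rule exI, intro conjI allI impI)
    show "has_C1_partials D F1 (\<lambda>p. pdiff (Fcal F1 F2 0) (e4 0) (fst p, snd p, 0, 0)) (\<lambda>p. pdiff (Fcal F1 F2 0) (e4 1) (fst p, snd p, 0, 0))"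
      by (rule c0) simp_all
    show "has_C1_partials D F2 (\<lambda>p. pdiff (Fcal F1 F2 1) (e4 0) (fst p, snd p, 0, 0)) (\<lambda>p. pdiff (Fcal F1 F2 1) (e4 1) (fst p, snd p, 0, 0))"
      by (rule c1) simp_all
    fix x y assume xy: "(x, y) \<in> D" "y \<noteq> 0"
    have v: "(x, y, 0, 0) \<in> Eset D" using sub[OF xy(1)] by simp
    have two: "(2 / y) *\<^sub>R F2 (x, y) = (1 / y) *\<^sub>R F2 (x, y) + (1 / y) *\<^sub>R F2 (x, y)"
      by (simp flip: scaleR_add_left)
    show "pdiff (Fcal F1 F2 0) (e4 0) (fst (x, y), snd (x, y), 0, 0) - pdiff (Fcal F1 F2 1) (e4 1) (fst (x, y), snd (x, y), 0, 0) = (2 / y) *\<^sub>R F2 (x, y)"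
      using eq1[OF v] unfolding p22[OF xy] p33[OF xy] two by (simp add: algebra_simps)
    show "pdiff (Fcal F1 F2 0) (e4 1) (fst (x, y), snd (x, y), 0, 0) + pdiff (Fcal F1 F2 1) (e4 0) (fst (x, y), snd (x, y), 0, 0) = 0"
      using eq2[OF v] unfolding p23[OF xy] p32[OF xy] by simp
  qed
qed

section \<open>Consequences of the analytic representation\<close>

locale analytic_square_representation =
  fixes D D2 :: "(real \<times> real) set" and F1 F2 H1 H2 :: "real \<times> real \<Rightarrow> oct"
  assumes D_open: "open D" and D_sym: "(x, y) \<in> D \<Longrightarrow> (x, - y) \<in> D"
    and D2_open: "open D2" and Dstar_subset: "Dstar D \<subseteq> D2"
    and H1_analytic: "p \<in> D2 \<Longrightarrow> ps_analytic H1 p" and H2_analytic: "p \<in> D2 \<Longrightarrow> ps_analytic H2 p"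
    and F1_eq: "(x, y) \<in> D \<Longrightarrow> F1 (x, y) = H1 (x, y\<^sup>2)"
    and F2_eq: "(x, y) \<in> D \<Longrightarrow> F2 (x, y) = y *\<^sub>R H2 (x, y\<^sup>2)"
    and stem_solution: "C1_stem_solution D F1 F2"
begin

abbreviation "H1x \<equiv> pdiff H1 (1, 0)"
abbreviation "H1t \<equiv> pdiff H1 (0, 1)"
abbreviation "H2x \<equiv> pdiff H2 (1, 0)"
abbreviation "H2t \<equiv> pdiff H2 (0, 1)"

lemma sq_mem: "p \<in> D \<Longrightarrow> sq p \<in> D2"
  using square_mem_Dstar[OF D_sym, of "fst p" "snd p"] Dstar_subset by auto

lemma sq_analytic: "ps_analytic (\<lambda>p. sq p) (p :: real \<times> real)"
  by (intro ps_analytic_Pair ps_analytic_power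
      ps_analytic_linear[OF bounded_linear_fst ps_analytic_ident]
      ps_analytic_linear[OF bounded_linear_snd ps_analytic_ident])

lemma F1_analytic:
  assumes "p \<in> D"
  shows "ps_analytic F1 p"
proof (rule ps_analytic_cong[OF ps_analytic_compose[OF H1_analytic[OF sq_mem[OF assms]] sq_analytic]])
  show "eventually (\<lambda>y. H1 (sq y) = F1 y) (nhds p)"
    using eventually_nhds_in_open[OF D_open assms]
  proof eventually_elim
    case (elim y)
    then show ?case using F1_eq[of "fst y" "snd y"] by simp
  qed
qed

lemma G2_analytic: "p \<in> D \<Longrightarrow> ps_analytic (\<lambda>p. H2 (sq p)) p"
  by (rule ps_analytic_compose[OF H2_analytic[OF sq_mem] sq_analytic])

lemma F2_analytic:
  assumes "p \<in> D"
  shows "ps_analytic F2 p"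
proof (rule ps_analytic_cong[OF ps_analytic_scaleR[OF
        ps_analytic_linear[OF bounded_linear_snd ps_analytic_ident] G2_analytic[OF assms]]])
  show "eventually (\<lambda>y. snd y *\<^sub>R H2 (sq y) = F2 y) (nhds p)"
    using eventually_nhds_in_open[OF D_open assms]
  proof eventually_elim
    case (elim y)
    then show ?case using F2_eq[of "fst y" "snd y"] by simp
  qed
qed

lemma H_C1_partials:
  "has_C1_partials D2 H1 (H1x) (H1t)"
  "has_C1_partials D2 H2 (H2x) (H2t)"
  by (rule Ck_on_Suc_has_C1_partials[OF ps_analytic_imp_Ck_on], erule H1_analytic H2_analytic)+

lemmas F_C1_partials = C1_partials_square_representation[OF D_open D_sym Dstar_subset H_C1_partials, of F1 F2]

lemma F_pdiff:
  assumes "(x, y) \<in> D"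
  shows "pdiff F1 (1, 0) (x, y) = H1x (x, y\<^sup>2)"
    "pdiff F1 (0, 1) (x, y) = (2 * y) *\<^sub>R H1t (x, y\<^sup>2)"
    "pdiff F2 (1, 0) (x, y) = y *\<^sub>R H2x (x, y\<^sup>2)"
    "pdiff F2 (0, 1) (x, y) = H2 (x, y\<^sup>2) + (2 * y\<^sup>2) *\<^sub>R H2t (x, y\<^sup>2)"
  using has_C1_partials_pdiff[OF F_C1_partials(1) assms] has_C1_partials_pdiff[OF F_C1_partials(2) assms]
    F1_eq F2_eq by (simp_all add: power2_eq_square mult_ac)

lemma G2_pdiff:
  assumes "(x, y) \<in> D"
  shows "pdiff (\<lambda>p. H2 (sq p)) (1, 0) (x, y) = H2x (x, y\<^sup>2)"
    "pdiff (\<lambda>p. H2 (sq p)) (0, 1) (x, y) = (2 * y) *\<^sub>R H2t (x, y\<^sup>2)"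
  using has_C1_partials_pdiff[OF has_C1_partials_square[OF H_C1_partials(2) sq_mem] assms] by simp_all

lemma continuous_on_sq:
  assumes "continuous_on D2 f"
  shows "continuous_on D (\<lambda>p. f (sq p))"
proof (rule continuous_on_compose2[OF assms])
  show "continuous_on D (\<lambda>p. sq p)" by (intro continuous_intros)
qed (use sq_mem in blast)

lemma reduced_system_off_axis:
  assumes xy: "(x, y) \<in> D" "y \<noteq> 0"
  shows "H1x (x, y\<^sup>2) = 3 *\<^sub>R H2 (x, y\<^sup>2) + (2 * y\<^sup>2) *\<^sub>R H2t (x, y\<^sup>2)"
    and "H2x (x, y\<^sup>2) = - 2 *\<^sub>R H1t (x, y\<^sup>2)"
proof -
  note e = C1_stem_solution_pdiff[OF stem_solution xy, unfolded F_pdiff[OF xy(1)] F2_eq[OF xy(1)]]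
  have "(3::real) = 2 + 1" by simp
  then have three: "3 *\<^sub>R H2 (x, y\<^sup>2) = 2 *\<^sub>R H2 (x, y\<^sup>2) + H2 (x, y\<^sup>2)"
    by (simp only: scaleR_add_left scaleR_one)
  show "H1x (x, y\<^sup>2) = 3 *\<^sub>R H2 (x, y\<^sup>2) + (2 * y\<^sup>2) *\<^sub>R H2t (x, y\<^sup>2)"
    using e(1) xy(2) by (simp add: three algebra_simps)
  have "y *\<^sub>R (H2x (x, y\<^sup>2) + 2 *\<^sub>R H1t (x, y\<^sup>2)) = 0"
    using e(2) by (simp add: scaleR_add_right mult.commute add.commute)
  then have "H2x (x, y\<^sup>2) + 2 *\<^sub>R H1t (x, y\<^sup>2) = 0"
    using xy(2) by (simp only: scaleR_eq_0_iff) simp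
  then show "H2x (x, y\<^sup>2) = - 2 *\<^sub>R H1t (x, y\<^sup>2)"
    by (simp add: eq_neg_iff_add_eq_0)
qed

text \<open>At y = 0 the chain rule gives no information on \<open>H1t\<close> and
  \<open>H2x\<close>, as a factor y occurs; there the equations come from continuity of both
  sides.\<close>

lemma reduced_system:
  assumes xy: "(x, y) \<in> D"
  shows "H1x (x, y\<^sup>2) = 3 *\<^sub>R H2 (x, y\<^sup>2) + (2 * y\<^sup>2) *\<^sub>R H2t (x, y\<^sup>2)"
    and "H2x (x, y\<^sup>2) = - 2 *\<^sub>R H1t (x, y\<^sup>2)"
proof -
  have c: "continuous_on D (\<lambda>p. H1x (sq p))" "continuous_on D (\<lambda>p. H1t (sq p))"
    "continuous_on D (\<lambda>p. H2x (sq p))" "continuous_on D (\<lambda>p. H2t (sq p))"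
    "continuous_on D (\<lambda>p. H2 (sq p))"
    using H_C1_partials has_C1_partials_continuous_on[OF H_C1_partials(2)]
    by (auto simp: has_C1_partials_def intro: continuous_on_sq)
  have c': "continuous_on D (\<lambda>p. 3 *\<^sub>R H2 (sq p) + (2 * (snd p)\<^sup>2) *\<^sub>R H2t (sq p))"
    "continuous_on D (\<lambda>p. - 2 *\<^sub>R H1t (sq p))"
    by (intro continuous_intros c)+
  have ax: "(H1x (x, 0\<^sup>2) = 3 *\<^sub>R H2 (x, 0\<^sup>2) + (2 * 0\<^sup>2) *\<^sub>R H2t (x, 0\<^sup>2)) \<and>
    (H2x (x, 0\<^sup>2) = - 2 *\<^sub>R H1t (x, 0\<^sup>2))" if "(x, 0) \<in> D"
    using eq_at_axis_by_continuity[OF D_open c(1) c'(1) that] eq_at_axis_by_continuity[OF D_open c(3) c'(2) that]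
      reduced_system_off_axis by simp
  show "H1x (x, y\<^sup>2) = 3 *\<^sub>R H2 (x, y\<^sup>2) + (2 * y\<^sup>2) *\<^sub>R H2t (x, y\<^sup>2)"
    "H2x (x, y\<^sup>2) = - 2 *\<^sub>R H1t (x, y\<^sup>2)"
    using ax reduced_system_off_axis[OF xy] xy by (cases "y = 0"; blast)+
qed

lemma quotient_system:
  assumes "(x, y) \<in> D"
  shows "pdiff F1 (1, 0) (x, y) - y *\<^sub>R pdiff (\<lambda>p. H2 (sq p)) (0, 1) (x, y) = 3 *\<^sub>R H2 (sq (x, y))"
    and "pdiff F1 (0, 1) (x, y) + y *\<^sub>R pdiff (\<lambda>p. H2 (sq p)) (1, 0) (x, y) = 0"
  unfolding F_pdiff[OF assms] G2_pdiff[OF assms] reduced_system[OF assms]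
  by (simp_all add: power2_eq_square mult_ac)

lemma Dstar_system:
  assumes "(x, t) \<in> Dstar D"
  shows "H1x (x, t) - (2 * t) *\<^sub>R H2t (x, t) = 3 *\<^sub>R H2 (x, t)"
    and "2 *\<^sub>R H1t (x, t) + H2x (x, t) = 0"
proof -
  have "(x, sqrt t) \<in> D" "0 \<le> t" using assms by (auto simp: Dstar_def)
  from reduced_system[OF this(1)] this(2)
  show "H1x (x, t) - (2 * t) *\<^sub>R H2t (x, t) = 3 *\<^sub>R H2 (x, t)"
    "2 *\<^sub>R H1t (x, t) + H2x (x, t) = 0" by simp_all
qed

text \<open>The map \<open>cyl\<close> uses r^2 instead of r, so it is polynomial and analytic also
  where r = 0; twice \<open>dot3 v h\<close> is the differential of r^2 at v in direction h.\<close>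

abbreviation "dot3 v h \<equiv> coord4 1 v * coord4 1 h + coord4 2 v * coord4 2 h + coord4 3 v * coord4 3 h"
abbreviation "cyl v \<equiv> (coord4 0 v, coord4_r2 v)"

lemma coord4_r2_nonneg: "0 \<le> coord4_r2 v"
  by (simp add: coord4_r2_def)

lemma cyl_mem: "v \<in> Eset D \<Longrightarrow> cyl v \<in> D2"
  using sq_mem[of "(coord4 0 v, sqrt (coord4_r2 v))"] by (simp add: Eset_iff coord4_r2_nonneg)

lemma coord4_analytic: "ps_analytic (coord4 k) v"
  by (rule ps_analytic_linear[OF bounded_linear_coord4 ps_analytic_ident])

lemma Fcal_0_eq: "v \<in> Eset D \<Longrightarrow> Fcal F1 F2 0 v = H1 (cyl v)"
  using F1_eq[of "coord4 0 v" "sqrt (coord4_r2 v)"] coord4_r2_nonneg[of v]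
  by (simp add: Fcal_def Eset_iff coord4_r2_def Let_def)

text \<open>In (x_h / r) F_2 the factor r of F_2 = r H_2 cancels. At r = 0 the value 0 prescribed
  for \<open>Fcal\<close> agrees because x_h = 0.\<close>

lemma Fcal_Suc_eq:
  assumes v: "v \<in> Eset D" and h: "1 \<le> h" "h \<le> 3"
  shows "Fcal F1 F2 h v = coord4 h v *\<^sub>R H2 (cyl v)"
proof (cases "coord4_r2 v = 0")
  case True
  then have "coord4 1 v = 0 \<and> coord4 2 v = 0 \<and> coord4 3 v = 0"
    unfolding coord4_r2_def by (simp add: add_nonneg_eq_0_iff)
  moreover from h have "h = 1 \<or> h = 2 \<or> h = 3" by linarith
  ultimately have "coord4 h v = 0" by auto
  then show ?thesis using h by (simp add: Fcal_def Let_def)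
next
  case False
  then show ?thesis
    using F2_eq[of "coord4 0 v" "sqrt (coord4_r2 v)"] coord4_r2_nonneg[of v] v h
    by (simp add: Fcal_def Eset_iff coord4_r2_def Let_def)
qed

lemma Fcal_analytic:
  assumes v: "v \<in> Eset D" and h: "h \<le> 3"
  shows "ps_analytic (Fcal F1 F2 h) v"
proof -
  have cyl: "ps_analytic (\<lambda>v. cyl v) v"
    unfolding coord4_r2_def
    by (intro ps_analytic_Pair ps_analytic_add ps_analytic_power coord4_analytic)
  have ev: "eventually (\<lambda>v. v \<in> Eset D) (nhds v)"
    by (rule eventually_nhds_in_open[OF open_Eset[OF D_open] v])
  show ?thesis
  proof (cases "h = 0")
    case True
    show ?thesis
      by (rule ps_analytic_cong[OF ps_analytic_compose[OF H1_analytic[OF cyl_mem[OF v]] cyl]])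
         (use ev in eventually_elim, simp add: True Fcal_0_eq)
  next
    case False
    show ?thesis
      by (rule ps_analytic_cong[OF ps_analytic_scaleR[OF coord4_analytic[of h]
            ps_analytic_compose[OF H2_analytic[OF cyl_mem[OF v]] cyl]]])
         (use ev in eventually_elim, use False h in \<open>simp add: Fcal_Suc_eq\<close>)
  qed
qed

lemma cyl_has_derivative:
  "((\<lambda>v. cyl v) has_derivative (\<lambda>h. (coord4 0 h,
     2 * dot3 v h))) (at v)"
proof -
  have c: "(coord4 k has_derivative coord4 k) (at v)" for k
    by (rule bounded_linear.has_derivative[OF bounded_linear_coord4 has_derivative_ident])
  show ?thesis
    unfolding coord4_r2_def by (rule derivative_eq_intros c refl ext)+ (auto simp: algebra_simps)
qed

lemma H_cyl_has_derivative:
  assumes H: "has_C1_partials D2 H (pdiff H (1, 0)) (pdiff H (0, 1))" and v: "v \<in> Eset D"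
  shows "((\<lambda>v. H (cyl v)) has_derivative (\<lambda>h. coord4 0 h *\<^sub>R pdiff H (1, 0) (cyl v) +
     (2 * dot3 v h) *\<^sub>R pdiff H (0, 1) (cyl v))) (at v)"
proof -
  have "(H has_derivative (\<lambda>h. fst h *\<^sub>R pdiff H (1, 0) (cyl v) + snd h *\<^sub>R pdiff H (0, 1) (cyl v))) (at (cyl v))"
    using H cyl_mem[OF v] by (simp add: has_C1_partials_def)
  from has_derivative_compose[OF cyl_has_derivative this] show ?thesis by simp
qed

lemma Fcal_0_pdiff:
  assumes v: "v \<in> Eset D"
  shows "pdiff (Fcal F1 F2 0) e v = coord4 0 e *\<^sub>R H1x (cyl v) +
     (2 * dot3 v e) *\<^sub>R H1t (cyl v)"
  by (rule pdiff_has_derivative[OF has_derivative_transform_within_open[OF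
        H_cyl_has_derivative[OF H_C1_partials(1) v] open_Eset[OF D_open] v]])
     (simp add: Fcal_0_eq)

lemma Fcal_Suc_pdiff:
  assumes v: "v \<in> Eset D" and k: "1 \<le> k" "k \<le> 3"
  shows "pdiff (Fcal F1 F2 k) e v = coord4 k e *\<^sub>R H2 (cyl v) + coord4 k v *\<^sub>R (coord4 0 e *\<^sub>R H2x (cyl v) +
     (2 * dot3 v e) *\<^sub>R H2t (cyl v))"
proof -
  have c: "(coord4 k has_derivative coord4 k) (at v)"
    by (rule bounded_linear.has_derivative[OF bounded_linear_coord4 has_derivative_ident])
  note d = has_derivative_scaleR[OF c H_cyl_has_derivative[OF H_C1_partials(2) v]]
  have "(Fcal F1 F2 k has_derivative (\<lambda>h. coord4 k v *\<^sub>R (coord4 0 h *\<^sub>R H2x (cyl v) +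
     (2 * dot3 v h) *\<^sub>R H2t (cyl v))
      + coord4 k h *\<^sub>R H2 (cyl v))) (at v)"
    by (rule has_derivative_transform_within_open[OF d open_Eset[OF D_open] v])
       (use k in \<open>simp add: Fcal_Suc_eq\<close>)
  from pdiff_has_derivative[OF this, of e] show ?thesis by (simp add: add.commute)
qed

text \<open>Write X, Y, Z for H_2t, H_1t, H_2 at (x_0, r^2). The first equation reads 3 Z + 2 r^2 X
  minus the sum of Z + 2 x_k^2 X over k = 1, 2, 3. In each of the others 2 x_j Y cancels against - 2
  x_j Y, and the mixed terms 2 x_j x_k X occur with opposite signs.\<close>

lemma Fcal_system:
  assumes v: "v \<in> Eset D"
  shows "pdiff (Fcal F1 F2 0) (e4 0) v - pdiff (Fcal F1 F2 1) (e4 1) v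
           - pdiff (Fcal F1 F2 2) (e4 2) v - pdiff (Fcal F1 F2 3) (e4 3) v = 0"
    "pdiff (Fcal F1 F2 0) (e4 1) v + pdiff (Fcal F1 F2 1) (e4 0) v
           - pdiff (Fcal F1 F2 2) (e4 3) v + pdiff (Fcal F1 F2 3) (e4 2) v = 0"
    "pdiff (Fcal F1 F2 0) (e4 2) v + pdiff (Fcal F1 F2 1) (e4 3) v
           + pdiff (Fcal F1 F2 2) (e4 0) v - pdiff (Fcal F1 F2 3) (e4 1) v = 0"
    "pdiff (Fcal F1 F2 0) (e4 3) v - pdiff (Fcal F1 F2 1) (e4 2) v
           + pdiff (Fcal F1 F2 2) (e4 1) v + pdiff (Fcal F1 F2 3) (e4 0) v = 0"
proof -
  let ?d = "\<lambda>k j. pdiff (Fcal F1 F2 k) (e4 j) v"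
  have *: "(coord4 0 v, sqrt (coord4_r2 v)) \<in> D" using v by (simp add: Eset_iff)
  define X where "X = H2t (cyl v)"
  define Y where "Y = H1t (cyl v)"
  define Z where "Z = H2 (cyl v)"
  let ?c = "\<lambda>k. coord4 k v"
  have r: "H1x (cyl v) = 3 *\<^sub>R Z + (2 * ((?c 1)\<^sup>2 + (?c 2)\<^sup>2 + (?c 3)\<^sup>2)) *\<^sub>R X"
    "H2x (cyl v) = - 2 *\<^sub>R Y"
    unfolding coord4_r2_def[symmetric] using reduced_system[OF *]
    by (simp_all add: X_def Y_def Z_def coord4_r2_nonneg)
  have f0: "pdiff (Fcal F1 F2 0) e v = coord4 0 e *\<^sub>R (3 *\<^sub>R Z + (2 * ((?c 1)\<^sup>2 + (?c 2)\<^sup>2 + (?c 3)\<^sup>2)) *\<^sub>R X) +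
     (2 * dot3 v e) *\<^sub>R Y" for e
    unfolding Fcal_0_pdiff[OF v] r Y_def ..
  have f: "pdiff (Fcal F1 F2 k) e v = coord4 k e *\<^sub>R Z + ?c k *\<^sub>R (coord4 0 e *\<^sub>R (- 2 *\<^sub>R Y) +
     (2 * dot3 v e) *\<^sub>R X)" if "1 \<le> k" "k \<le> 3" for k e
    unfolding Fcal_Suc_pdiff[OF v that] r X_def Z_def ..
  note simps = f0 f coord4_e4 inner_diff_left inner_add_left power2_eq_square algebra_simps
  \<comment> \<open>Passing to coordinates turns the vector identities into polynomial identities
    over the reals.\<close>
  show "?d 0 0 - ?d 1 1
           - ?d 2 2 - ?d 3 3 = 0"
    by (rule euclidean_eqI) (simp add: simps)
  show "?d 0 1 + ?d 1 0
           - ?d 2 3 + ?d 3 2 = 0"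
    by (rule euclidean_eqI) (simp add: simps)
  show "?d 0 2 + ?d 1 3
           + ?d 2 0 - ?d 3 1 = 0"
    by (rule euclidean_eqI) (simp add: simps)
  show "?d 0 3 - ?d 1 2
           + ?d 2 1 + ?d 3 0 = 0"
    by (rule euclidean_eqI) (simp add: simps)
qed

text \<open>With q = x + y I the factor y of F_2 combines with I to the imaginary part of q, so f(q)
  = H_1(x, |Im q|^2) + Im(q) H_2(x, |Im q|^2) where x is the real part. No imaginary unit has to be
  chosen, which gives analyticity also at real points.\<close>

lemma slice_function_analytic:
  assumes f: "\<And>x y I. (x, y) \<in> D \<Longrightarrow> I \<in> octS \<Longrightarrow> f (oreal x + y *\<^sub>R I) = F1 (x, y) + omult I (F2 (x, y))"
    and q: "q \<in> OmegaD D"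
  shows "ps_analytic f q"
proof -
  have oim_lin: "bounded_linear oim"
    unfolding oim_def[abs_def]
    by (intro bounded_linear_sub bounded_linear_ident linear_conv_bounded_linear[THEN iffD1]
        linear_compose[OF linear_ore linear_oreal, unfolded o_def])
  have ore_lin: "bounded_linear ore" using linear_ore linear_conv_bounded_linear by blast
  have qa: "ps_analytic (\<lambda>q. (ore q, oim q \<bullet> oim q)) q"
    by (intro ps_analytic_Pair ps_analytic_bilinear[OF bounded_bilinear_inner]
        ps_analytic_linear[OF oim_lin ps_analytic_ident] ps_analytic_linear[OF ore_lin ps_analytic_ident])
  have mem: "(ore q, norm (oim q)) \<in> D" if "q \<in> OmegaD D" for q
    using that OmegaD_iff[OF D_sym] by blast
  have m2: "(ore q, oim q \<bullet> oim q) \<in> D2"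
    using sq_mem[OF mem[OF q]] by (simp add: power2_norm_eq_inner)
  have "continuous_on UNIV (\<lambda>q. (ore q, norm (oim q)))"
    by (intro continuous_intros linear_continuous_on oim_lin ore_lin)
  from open_vimage[OF D_open this] have op: "open (OmegaD D)"
    by (simp add: vimage_def OmegaD_iff[OF D_sym, symmetric])
  have "ps_analytic (\<lambda>q. H1 (ore q, oim q \<bullet> oim q) + omult (oim q) (H2 (ore q, oim q \<bullet> oim q))) q"
    by (intro ps_analytic_add ps_analytic_bilinear[OF bounded_bilinear_omult]
        ps_analytic_compose[OF H1_analytic[OF m2] qa] ps_analytic_compose[OF H2_analytic[OF m2] qa]
        ps_analytic_linear[OF oim_lin ps_analytic_ident])
  then show ?thesis
  proof (rule ps_analytic_cong)
    show "eventually (\<lambda>q. H1 (ore q, oim q \<bullet> oim q) + omult (oim q) (H2 (ore q, oim q \<bullet> oim q)) = f q) (nhds q)"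
      using eventually_nhds_in_open[OF op q]
    proof eventually_elim
      case (elim q)
      obtain I where I: "I \<in> octS" "oim q = norm (oim q) *\<^sub>R I" by (rule oim_polar)
      have "q = oreal (ore q) + oim q" by (simp add: oim_def)
      with I(2) have "q = oreal (ore q) + norm (oim q) *\<^sub>R I" by metis
      then have "f q = F1 (ore q, norm (oim q)) + omult I (F2 (ore q, norm (oim q)))"
        using f[OF mem[OF elim] I(1)] by simp
      also have "\<dots> = H1 (ore q, (norm (oim q))\<^sup>2) + omult (norm (oim q) *\<^sub>R I) (H2 (ore q, (norm (oim q))\<^sup>2))"
        using F1_eq[OF mem[OF elim]] F2_eq[OF mem[OF elim]] by (simp add: omult.scaleR_left omult.scaleR_right)
      also have "\<dots> = H1 (ore q, oim q \<bullet> oim q) + omult (oim q) (H2 (ore q, oim q \<bullet> oim q))"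
        by (simp add: power2_norm_eq_inner flip: I(2))
      finally show ?case ..
    qed
  qed
qed

end

section \<open>The slice operators and the equivalence of the conditions\<close>

lemma C1_stem_solution_representation:
  fixes F1 F2 :: "real \<times> real \<Rightarrow> oct"
  assumes D: "open D" and sym: "\<And>x y. (x, y) \<in> D \<Longrightarrow> (x, - y) \<in> D"
    and parity: "\<And>x y. (x, y) \<in> D \<Longrightarrow> F1 (x, - y) = F1 (x, y) \<and> F2 (x, - y) = - F2 (x, y)"
    and sol: "C1_stem_solution D F1 F2"
  obtains D2 H1 H2 where "analytic_square_representation D D2 F1 F2 H1 H2"
proof -
  obtain F1x F1y F2x F2y where F: "has_C1_partials D F1 F1x F1y" "has_C1_partials D F2 F2x F2y"
    and eqs: "\<And>x y. (x, y) \<in> D \<Longrightarrow> y \<noteq> 0 \<Longrightarrow>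
        F1x (x, y) - F2y (x, y) = (2 / y) *\<^sub>R F2 (x, y) \<and> F1y (x, y) + F2x (x, y) = 0"
    using sol unfolding C1_stem_solution_def by blast
  obtain D2 H1 H2 where "open D2" "Dstar D \<subseteq> D2"
    "\<And>p. p \<in> D2 \<Longrightarrow> ps_analytic H1 p" "\<And>p. p \<in> D2 \<Longrightarrow> ps_analytic H2 p"
    "\<And>x y. (x, y) \<in> D \<Longrightarrow> F1 (x, y) = H1 (x, y\<^sup>2) \<and> F2 (x, y) = y *\<^sub>R H2 (x, y\<^sup>2)"
    using vector_solution_extension[OF D sym parity F eqs] by blast
  then have "analytic_square_representation D D2 F1 F2 H1 H2"
    using D sym sol by unfold_locales auto
  then show ?thesis by (rule that)
qed

text \<open>At fixed (x, y), comparing I = \<open>oct_i\<close> with its negative separates the stem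
  components: A + I B = F_2 / y for both units gives I B = 0, hence B = 0 and A = F_2 / y. The
  factor 1/2 in the definition of \<open>slice_dbar\<close> turns this into the right side 2 F_2 /
  y.\<close>

lemma slice_dbar_eq_sph_deriv_iff:
  fixes F1 F2 :: "real \<times> real \<Rightarrow> oct"
  assumes D: "open D" and sym: "\<And>x y. (x, y) \<in> D \<Longrightarrow> (x, - y) \<in> D"
    and parity: "\<And>x y. (x, y) \<in> D \<Longrightarrow> F1 (x, - y) = F1 (x, y) \<and> F2 (x, - y) = - F2 (x, y)"
    and d: "\<And>p. p \<in> D \<Longrightarrow> F1 differentiable (at p)" "\<And>p. p \<in> D \<Longrightarrow> F2 differentiable (at p)"
  shows "(\<forall>q \<in> OmegaD D - range oreal. slice_dbar D F1 F2 q = sph_deriv D F2 q) \<longleftrightarrow>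
    (\<forall>x y. (x, y) \<in> D \<and> y \<noteq> 0 \<longrightarrow>
       pdiff F1 (1, 0) (x, y) - pdiff F2 (0, 1) (x, y) = (2 / y) *\<^sub>R F2 (x, y) \<and>
       pdiff F1 (0, 1) (x, y) + pdiff F2 (1, 0) (x, y) = 0)" (is "?L \<longleftrightarrow> ?R")
proof -
  define A where "A p = (1/2) *\<^sub>R (pdiff F1 (1, 0) p - pdiff F2 (0, 1) p)" for p
  define B where "B p = (1/2) *\<^sub>R (pdiff F1 (0, 1) p + pdiff F2 (1, 0) p)" for p
  have par: "A (x, - y) = A (x, y) \<and> B (x, - y) = - B (x, y)" if xy: "(x, y) \<in> D" for x y
  proof -
    note m = sym[OF xy]
    have e1: "F1 (x, y) = 1 *\<^sub>R F1 (x, - y)" if "(x, y) \<in> D" for x y using parity[OF that] by simp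
    have e2: "F2 (x, y) = (- 1) *\<^sub>R F2 (x, - y)" if "(x, y) \<in> D" for x y using parity[OF that] by simp
    note p1 = pdiff_reflect[OF D xy d(1)[OF m] e1] and p2 = pdiff_reflect[OF D xy d(2)[OF m] e2]
    show ?thesis by (simp add: A_def B_def p1 p2 algebra_simps)
  qed
  have dbar: "slice_dbar D F1 F2 (oreal x + y *\<^sub>R I) = A (x, y) + omult I (B (x, y))"
    if "(x, y) \<in> D" "y \<noteq> 0" "I \<in> octS" for x y I
    unfolding slice_dbar_def A_def[symmetric] B_def[symmetric]
    by (rule slice_fun_eq[OF that]) (use par in blast)
  have sph: "sph_deriv D F2 (oreal x + y *\<^sub>R I) = (1 / y) *\<^sub>R F2 (x, y)"
    if "(x, y) \<in> D" "y \<noteq> 0" "I \<in> octS" for x y I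
  proof -
    have "sph_deriv D F2 (oreal x + y *\<^sub>R I) = (1 / snd (x, y)) *\<^sub>R F2 (x, y) + omult I 0"
      unfolding sph_deriv_def by (rule slice_fun_eq[OF that]) (use parity in auto)
    then show ?thesis by (simp add: omult.zero_right)
  qed
  \<comment> \<open>Removing the reals from \<open>OmegaD D\<close> therefore removes exactly the
    points with y = 0, where the spherical derivative is not defined.\<close>
  have nreal: "oreal x + y *\<^sub>R I \<notin> range oreal" if "y \<noteq> 0" "I \<in> octS" for x y I
  proof
    assume "oreal x + y *\<^sub>R I \<in> range oreal"
    then obtain t where t: "oreal x + y *\<^sub>R I = oreal t" by blast
    have "y *\<^sub>R I = oim (oreal t)" using oim_slice[OF that(2), of x y] t by simp
    then have "y *\<^sub>R I = 0" by (simp add: oim_def)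
    then show False using that octS_norm[OF that(2)] by auto
  qed
  show ?thesis
  proof
    assume L: ?L
    show ?R
    proof (intro allI impI)
      fix x y assume xy: "(x, y) \<in> D \<and> y \<noteq> 0"
      have e: "A (x, y) + omult I (B (x, y)) = (1 / y) *\<^sub>R F2 (x, y)" if I: "I \<in> octS" for I
      proof -
        have "oreal x + y *\<^sub>R I \<in> OmegaD D - range oreal"
          using nreal[OF _ I] xy I unfolding OmegaD_def by blast
        with L dbar[OF _ _ I] sph[OF _ _ I] xy show ?thesis by metis
      qed
      have "A (x, y) + omult oct_i (B (x, y)) = A (x, y) - omult oct_i (B (x, y))"
        using e[OF oct_i_octS] e[OF uminus_octS[OF oct_i_octS]] by (simp add: omult.minus_left)
      then have "omult oct_i (B (x, y)) + omult oct_i (B (x, y)) = 0" by (simp add: algebra_simps)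
      then have "2 *\<^sub>R omult oct_i (B (x, y)) = 0" by (simp add: scaleR_2)
      then have z: "omult oct_i (B (x, y)) = 0" by simp
      then have B0: "B (x, y) = 0" by (rule omult_oct_i_eq_0)
      have "2 *\<^sub>R A (x, y) = 2 *\<^sub>R ((1 / y) *\<^sub>R F2 (x, y))" using e[OF oct_i_octS] z by simp
      then show "pdiff F1 (1, 0) (x, y) - pdiff F2 (0, 1) (x, y) = (2 / y) *\<^sub>R F2 (x, y) \<and>
         pdiff F1 (0, 1) (x, y) + pdiff F2 (1, 0) (x, y) = 0"
        using B0 by (simp add: A_def B_def)
    qed
  next
    assume R: ?R
    show ?L
    proof
      fix q assume q: "q \<in> OmegaD D - range oreal"
      then obtain x y I where qq: "q = oreal x + y *\<^sub>R I" "(x, y) \<in> D" "I \<in> octS" by (auto simp: OmegaD_def)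
      have y: "y \<noteq> 0" using q qq by auto
      have "A (x, y) = (1 / y) *\<^sub>R F2 (x, y)" "B (x, y) = 0"
        using R qq(2) y by (simp_all add: A_def B_def)
      then show "slice_dbar D F1 F2 q = sph_deriv D F2 q"
        using dbar[OF qq(2) y qq(3)] sph[OF qq(2) y qq(3)] by (simp add: qq(1) omult.zero_right)
    qed
  qed
qed

theorem theorem2p3:
  fixes D :: "(real \<times> real) set"
    and F1 F2 :: "real \<times> real \<Rightarrow> oct"
    and f :: "oct \<Rightarrow> oct"
  assumes D_open: "open D" and D_ne: "D \<noteq> {}"
    and D_sym: "\<forall>x0 x1. (x0, x1) \<in> D \<longrightarrow> (x0, -x1) \<in> D"
    and Omega_conn: "connected (OmegaD D)"
    and stem: "\<forall>x0 x1. (x0, x1) \<in> D \<longrightarrow> F1 (x0, -x1) = F1 (x0, x1) \<and> F2 (x0, -x1) = - F2 (x0, x1)"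
    and induced: "\<forall>x0 x1 I. (x0, x1) \<in> D \<longrightarrow> I \<in> octS \<longrightarrow>
                    f (oreal x0 + x1 *\<^sub>R I) = F1 (x0, x1) + omult I (F2 (x0, x1))"
  defines "P1 \<equiv> (\<forall>h\<le>3. Ck_on 1 (Eset D) (Fcal F1 F2 h)) \<and>
      (\<forall>v\<in>Eset D.
         pdiff (Fcal F1 F2 0) (e4 0) v - pdiff (Fcal F1 F2 1) (e4 1) v
           - pdiff (Fcal F1 F2 2) (e4 2) v - pdiff (Fcal F1 F2 3) (e4 3) v = 0 \<and>
         pdiff (Fcal F1 F2 0) (e4 1) v + pdiff (Fcal F1 F2 1) (e4 0) v
           - pdiff (Fcal F1 F2 2) (e4 3) v + pdiff (Fcal F1 F2 3) (e4 2) v = 0 \<and>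
         pdiff (Fcal F1 F2 0) (e4 2) v + pdiff (Fcal F1 F2 1) (e4 3) v
           + pdiff (Fcal F1 F2 2) (e4 0) v - pdiff (Fcal F1 F2 3) (e4 1) v = 0 \<and>
         pdiff (Fcal F1 F2 0) (e4 3) v - pdiff (Fcal F1 F2 1) (e4 2) v
           + pdiff (Fcal F1 F2 2) (e4 1) v + pdiff (Fcal F1 F2 3) (e4 0) v = 0)"
    and "P2 \<equiv> Ck_on 2 D F1 \<and> Ck_on 3 D F2 \<and>
      (\<forall>x0 x1. (x0, x1) \<in> D \<and> x1 \<noteq> 0 \<longrightarrow>
         pdiff F1 (1, 0) (x0, x1) - pdiff F2 (0, 1) (x0, x1) = (2 / x1) *\<^sub>R F2 (x0, x1) \<and>
         pdiff F1 (0, 1) (x0, x1) + pdiff F2 (1, 0) (x0, x1) = 0)"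
    and "P2a \<equiv> Ck_on 2 D F1 \<and> Ck_on 3 D F2 \<and>
      (\<forall>q \<in> OmegaD D - range oreal. slice_dbar D F1 F2 q = sph_deriv D F2 q)"
    and "P2b \<equiv> Ck_on 2 D F1 \<and> (\<exists>G2 :: real \<times> real \<Rightarrow> oct. Ck_on 3 D G2 \<and>
      (\<forall>x0 x1. (x0, x1) \<in> D \<longrightarrow> F2 (x0, x1) = x1 *\<^sub>R G2 (x0, x1)) \<and>
      (\<forall>x0 x1. (x0, x1) \<in> D \<longrightarrow>
         pdiff F1 (1, 0) (x0, x1) - x1 *\<^sub>R pdiff G2 (0, 1) (x0, x1) = 3 *\<^sub>R G2 (x0, x1) \<and>
         pdiff F1 (0, 1) (x0, x1) + x1 *\<^sub>R pdiff G2 (1, 0) (x0, x1) = 0))"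
    and "P2c \<equiv> (\<exists>D2 :: (real \<times> real) set. \<exists>H1 H2 :: real \<times> real \<Rightarrow> oct.
      open D2 \<and> Dstar D \<subseteq> D2 \<and> Ck_on 2 D2 H1 \<and> Ck_on 3 D2 H2 \<and>
      (\<forall>x0 x1. (x0, x1) \<in> D \<longrightarrow> F1 (x0, x1) = H1 (x0, x1^2) \<and> F2 (x0, x1) = x1 *\<^sub>R H2 (x0, x1^2)) \<and>
      (\<forall>x0 x1. (x0, x1) \<in> Dstar D \<longrightarrow>
         pdiff H1 (1, 0) (x0, x1) - (2 * x1) *\<^sub>R pdiff H2 (0, 1) (x0, x1) = 3 *\<^sub>R H2 (x0, x1) \<and>
         2 *\<^sub>R pdiff H1 (0, 1) (x0, x1) + pdiff H2 (1, 0) (x0, x1) = 0))"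
  shows "(P1 \<longleftrightarrow> P2) \<and> (P2 \<longleftrightarrow> P2a) \<and> (P2 \<longleftrightarrow> P2b) \<and> (P2 \<longleftrightarrow> P2c) \<and>
         (P2 \<longrightarrow> real_analytic_on D F1 \<and> real_analytic_on D F2 \<and>
                (\<forall>h\<le>3. real_analytic_on (Eset D) (Fcal F1 F2 h)) \<and>
                real_analytic_on (OmegaD D) f)"
proof -
  have sym: "(x, - y) \<in> D" if "(x, y) \<in> D" for x y using D_sym that by blast
  have parity: "F1 (x, - y) = F1 (x, y) \<and> F2 (x, - y) = - F2 (x, y)" if "(x, y) \<in> D" for x y
    using stem that by blast
  \<comment> \<open>\<open>Ck_on\<close> unfolds only at successors, so the numerals have to be
    presented as such.\<close>
  have num: "2 = Suc 1" "3 = Suc 2" "1 = Suc 0" by simp_all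
  have P1: "C1_stem_solution D F1 F2" if P1
  proof (rule C1_stem_solutionI_Fcal[OF D_open sym parity])
    show "Ck_on (Suc 0) (Eset D) (Fcal F1 F2 h)" if "h \<le> 3" for h
      using \<open>P1\<close> that unfolding P1_def One_nat_def by blast
  qed (use that in \<open>simp_all add: P1_def\<close>)
  have P2: "C1_stem_solution D F1 F2" if P2
    by (rule C1_stem_solutionI_Ck[of 1 D F1 2 F2]) (use that in \<open>simp_all only: P2_def num(1,2)[symmetric], blast\<close>)
  have P2a: "P2a \<longleftrightarrow> P2"
  \<comment> \<open>The equivalence of the equations presupposes differentiability; when the common
    smoothness clause fails, both conditions are false.\<close>
  proof (cases "Ck_on 2 D F1 \<and> Ck_on 3 D F2")
    case True
    have "F1 differentiable (at p)" "F2 differentiable (at p)" if "p \<in> D" for p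
      using Ck_on_Suc_pdiff(1)[of 1 D F1 p] Ck_on_Suc_pdiff(1)[of 2 D F2 p] True that
      by (simp_all only: num(1,2)[symmetric])
    from slice_dbar_eq_sph_deriv_iff[OF D_open sym parity this] show ?thesis
      unfolding P2a_def P2_def by blast
  next
    case False
    then show ?thesis unfolding P2a_def P2_def by blast
  qed
  have P2b: "C1_stem_solution D F1 F2" if b: P2b
  proof -
    obtain G2 where "Ck_on 2 D F1" "Ck_on 3 D G2"
      and G: "\<And>x y. (x, y) \<in> D \<Longrightarrow> F2 (x, y) = y *\<^sub>R G2 (x, y)"
      "\<And>x y. (x, y) \<in> D \<Longrightarrow> pdiff F1 (1, 0) (x, y) - y *\<^sub>R pdiff G2 (0, 1) (x, y) = 3 *\<^sub>R G2 (x, y) \<and>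
         pdiff F1 (0, 1) (x, y) + y *\<^sub>R pdiff G2 (1, 0) (x, y) = 0"
      using b unfolding P2b_def by blast
    then have "Ck_on (Suc 1) D F1" "Ck_on (Suc 2) D G2" by (simp_all only: num(1,2)[symmetric])
    from C1_stem_solutionI_quotient[OF D_open this G] show ?thesis .
  qed
  have P2c: "C1_stem_solution D F1 F2" if c: P2c
  proof -
    obtain D2 H1 H2 where "Dstar D \<subseteq> D2" "Ck_on 2 D2 H1" "Ck_on 3 D2 H2"
      and H: "\<And>x y. (x, y) \<in> D \<Longrightarrow> F1 (x, y) = H1 (x, y\<^sup>2) \<and> F2 (x, y) = y *\<^sub>R H2 (x, y\<^sup>2)"
      "\<And>x y. (x, y) \<in> Dstar D \<Longrightarrow> pdiff H1 (1, 0) (x, y) - (2 * y) *\<^sub>R pdiff H2 (0, 1) (x, y) = 3 *\<^sub>R H2 (x, y) \<and>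
         2 *\<^sub>R pdiff H1 (0, 1) (x, y) + pdiff H2 (1, 0) (x, y) = 0"
      using c unfolding P2c_def by blast
    then have *: "Dstar D \<subseteq> D2" "Ck_on (Suc 1) D2 H1" "Ck_on (Suc 2) D2 H2"
      by (simp_all only: num(1,2)[symmetric])
    show ?thesis by (rule C1_stem_solutionI_square[OF D_open sym * H])
  qed
  \<comment> \<open>\<open>P2a\<close> is absent because it is already tied to \<open>P2\<close>;
    the other conditions and the analyticity claims are all read off from one representation by H_1
    and H_2.\<close>
  have "P1 \<and> P2 \<and> P2b \<and> P2c \<and> real_analytic_on D F1 \<and> real_analytic_on D F2 \<and>
      (\<forall>h\<le>3. real_analytic_on (Eset D) (Fcal F1 F2 h)) \<and> real_analytic_on (OmegaD D) f"
    if sol: "C1_stem_solution D F1 F2"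
  proof -
    obtain D2 H1 H2 where "analytic_square_representation D D2 F1 F2 H1 H2"
      by (rule C1_stem_solution_representation[OF D_open sym parity sol])
    then interpret analytic_square_representation D D2 F1 F2 H1 H2 .
    have Ck: "Ck_on k D F1" "Ck_on k D F2" "Ck_on k D (\<lambda>p. H2 (sq p))" "Ck_on k D2 H1" "Ck_on k D2 H2" for k
      by (rule ps_analytic_imp_Ck_on, erule F1_analytic F2_analytic G2_analytic H1_analytic H2_analytic)+
    have "Ck_on 1 (Eset D) (Fcal F1 F2 h)" if "h \<le> 3" for h
      by (rule ps_analytic_imp_Ck_on) (rule Fcal_analytic[OF _ that])
    then have P1
      unfolding P1_def using Fcal_system by blast
    moreover have P2
      unfolding P2_def using Ck C1_stem_solution_pdiff[OF sol] by blast
    moreover have P2b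
      unfolding P2b_def
    proof (intro conjI Ck exI[of _ "\<lambda>p. H2 (sq p)"] allI impI)
      fix x y assume xy: "(x, y) \<in> D"
      show "F2 (x, y) = y *\<^sub>R H2 (sq (x, y))" using F2_eq[OF xy] by simp
      show "pdiff F1 (1, 0) (x, y) - y *\<^sub>R pdiff (\<lambda>p. H2 (sq p)) (0, 1) (x, y) = 3 *\<^sub>R H2 (sq (x, y))"
        "pdiff F1 (0, 1) (x, y) + y *\<^sub>R pdiff (\<lambda>p. H2 (sq p)) (1, 0) (x, y) = 0"
        by (rule quotient_system[OF xy])+
    qed
    moreover have P2c
      unfolding P2c_def
    proof (rule exI[of _ D2], rule exI[of _ H1], rule exI[of _ H2], intro conjI Ck D2_open Dstar_subset allI impI)
      fix x y assume "(x, y) \<in> D"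
      then show "F1 (x, y) = H1 (x, y\<^sup>2)" "F2 (x, y) = y *\<^sub>R H2 (x, y\<^sup>2)" by (rule F1_eq F2_eq)+
    next
      fix x y assume "(x, y) \<in> Dstar D"
      then show "pdiff H1 (1, 0) (x, y) - (2 * y) *\<^sub>R pdiff H2 (0, 1) (x, y) = 3 *\<^sub>R H2 (x, y)"
        "2 *\<^sub>R pdiff H1 (0, 1) (x, y) + pdiff H2 (1, 0) (x, y) = 0" by (rule Dstar_system)+
    qed
    moreover have "real_analytic_on D F1" "real_analytic_on D F2"
      by (rule ps_analytic_imp_real_analytic_on, erule F1_analytic F2_analytic)+
    moreover have "\<forall>h\<le>3. real_analytic_on (Eset D) (Fcal F1 F2 h)"
      by (auto intro!: ps_analytic_imp_real_analytic_on Fcal_analytic)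
    moreover have "real_analytic_on (OmegaD D) f"
      by (rule ps_analytic_imp_real_analytic_on, rule slice_function_analytic) (use induced in auto)
    ultimately show ?thesis by blast
  qed
  with P1 P2 P2a P2b P2c show ?thesis by blast
qed

end
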